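(* Consider the stable ($\rho<1$) $M/G/1$ retrial queue with Bernoulli schedule in steady state, and suppose that the service time $T_\beta$ satisfies $P\{T_\beta>t\}\sim t^{-a}L(t)$ as $t\to\infty$, where $a>1$ and $L$ is slowly varying at $\infty$. Then, as $j\to\infty$, $$P\{R_{orb}>j\mid I_{ser}=1\}\;\sim\;\frac{\lambda_2^{a-1}}{\beta_1(1-\rho)(a-1)(1-\rho_1)^{a-1}}\; j^{-a+1}L(j).$$
   Context: Model ($M/G/1$ retrial queue with Bernoulli schedule). Customers arrive according to a Poisson process with rate $\lambda>0$ at a single-server system that has a (priority) queue of infinite capacity and an orbit. A customer who finds the server idle on arrival is served immediately. A customer who finds the server busy joins the queue (first-in-first-out) with probability $q$, or the orbit with probability $p=1-q$, where $0<q<1$. At a service completion, if the queue is non-empty the customer at its head starts service; otherwise the server becomes idle. Each customer in the orbit independently retries according to a Poisson process with rate $\mu>0$ until finding the server idle, and is then served immediately. Customers leave after service. All service times are i.i.d. copies of $T_\beta$ with distribution function $F_\beta$, $F_\beta(0)=0$, finite mean $\beta_1$, and Laplace-Stieltjes transform (LST) $\beta(s)=E(e^{-sT_\beta})$; arrivals, services, routing choices and retrials are independent. Parameters: $\lambda_1=\lambda q$, $\lambda_2=\lambda p$, $\rho_1=\lambda_1\beta_1$, $\rho_2=\lambda_2\beta_1$, $\rho=\rho_1+\rho_2=\lambda\beta_1$. The system is stable if and only if $\rho<1$, which is assumed. In steady state, $R_{que}$ is the number of customers in the queue (excluding the one in service), $R_{orb}$ is the number of customers in the orbit, and $I_{ser}=1$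 or $0$ according to whether the server is busy or idle. Known facts taken as the starting point (Choi and Park): $P\{I_{ser}=1\}=\rho$ and $$E(z_1^{R_{que}}z_2^{R_{orb}}\mid I_{ser}=1)=M_a(z_1,z_2)\,M_b(z_1,z_2)\,M_c(z_2)\,R_0(z_2),$$ where $$M_a(z_1,z_2)=\frac1\rho\cdot\frac{1-\beta(\lambda-\lambda_1z_1-\lambda_2z_2)}{1-pz_2-qz_1},\qquad M_b(z_1,z_2)=(1-\rho_1)\frac{h(z_2)-z_1}{\beta(\lambda-\lambda_1z_1-\lambda_2z_2)-z_1},$$ $$M_c(z_2)=\frac{1-\rho}{1-\rho_1}\cdot\frac{1-z_2}{h(z_2)-z_2},\qquad R_0(z_2)=\exp\Big\{-\frac{\lambda}{\mu}\int_{z_2}^1\frac{1-h(u)}{h(u)-u}\,du\Big\},$$ with removable singularities filled by continuity, and $h(z)$ is uniquely determined by $h(z)=\beta(\lambda-\lambda_1h(z)-\lambda_2z)$. Equivalently, $h(z)=\alpha(\lambda_2-\lambda_2z)$, where $\alpha$ is the LST of the busy period of the standard $M/G/1$ queue with arrival rate $\lambda_1$ and service time $T_\beta$, satisfying $\alpha(s)=\beta(s+\lambda_1-\lambda_1\alpha(s))$. A measurable $L:(0,\infty)\to(0,\infty)$ is slowly varying at $\infty$ if $\lim_{t\to\infty}L(xt)/L(t)=1$ for all $x>0$. The notation $f\sim g$ means $f/g\to1$. *)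

theory Defs
  imports "HOL-Probability.Probability" "HOL-Library.Landau_Symbols"
begin

subsection \<open>Slow variation and Laplace-Stieltjes transforms\<close>

definition slowly_varying :: "(real \<Rightarrow> real) \<Rightarrow> bool" where
  "slowly_varying L \<longleftrightarrow>
     L \<in> borel_measurable (lebesgue_on {0<..}) \<and>
     (\<forall>t>0. L t > 0) \<and>
     (\<forall>x>0. ((\<lambda>t. L (x * t) / L t) \<longlongrightarrow> 1) at_top)"

definition lst :: "real measure \<Rightarrow> real \<Rightarrow> real" where
  "lst D s = (\<integral>x. exp (- s * x) \<partial>D)"

definition mean :: "real measure \<Rightarrow> real" where
  "mean D = (\<integral>x. x \<partial>D)"


subsection \<open>Sample paths of the retrial queue\<close>

text \<open>
  Customers are numbered \<open>0, 1, 2, \<dots>\<close> in the order of arrival and the system starts empty.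
  For one sample path, \<open>a k\<close> is the arrival epoch of customer \<open>k\<close>, \<open>s k\<close> the service time,
  \<open>c k\<close> tells whether the customer chooses the queue (rather than the orbit) if the server
  is busy on arrival, \<open>r k i\<close> is the \<open>i\<close>-th epoch of the customer's retrial process, and \<open>b k\<close> is
  the epoch at which the service of the customer begins, so that it ends at \<open>b k + s k\<close>.
\<close>

definition is_first :: "real set \<Rightarrow> real \<Rightarrow> bool" where
  "is_first X x \<longleftrightarrow> x \<in> X \<and> (\<forall>y\<in>X. x \<le> y)"

definition busy_before :: "(nat \<Rightarrow> real) \<Rightarrow> (nat \<Rightarrow> real) \<Rightarrow> real \<Rightarrow> bool" where
  "busy_before s b t \<longleftrightarrow> (\<exists>k. b k < t \<and> t \<le> b k + s k)"

text \<open>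
  A customer of the queue starts at the first service completion that follows the arrival and
  also follows the service starts of all earlier customers of the queue. Simultaneous
  events have probability zero in the model below, so the treatment of ties is immaterial.
\<close>

definition service_rules ::
  "(nat \<Rightarrow> real) \<Rightarrow> (nat \<Rightarrow> real) \<Rightarrow> (nat \<Rightarrow> bool) \<Rightarrow> (nat \<Rightarrow> nat \<Rightarrow> real) \<Rightarrow> (nat \<Rightarrow> real) \<Rightarrow> bool" where
  "service_rules a s c r b \<longleftrightarrow>
     (\<forall>k. if \<not> busy_before s b (a k) then b k = a k
          else if c k then
            is_first {b j + s j | j. a k \<le> b j + s j \<and> (\<forall>i<k. c i \<longrightarrow> b i < b j + s j)} (b k)
          else is_first {r k i | i. \<not> busy_before s b (r k i)} (b k))"

record system_state =
  server_busy :: bool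
  in_queue :: nat
  in_orbit :: nat

text \<open>
  A customer who finds the server idle has \<open>b k = a k\<close> and hence never counts as waiting,
  whatever \<open>c k\<close> is.
\<close>

definition state_at ::
  "(nat \<Rightarrow> real) \<Rightarrow> (nat \<Rightarrow> real) \<Rightarrow> (nat \<Rightarrow> bool) \<Rightarrow> (nat \<Rightarrow> real) \<Rightarrow> real \<Rightarrow> system_state" where
  "state_at a s c b t =
     \<lparr>server_busy = (\<exists>k. b k \<le> t \<and> t < b k + s k),
      in_queue = card {k. c k \<and> a k \<le> t \<and> t < b k},
      in_orbit = card {k. \<not> c k \<and> a k \<le> t \<and> t < b k}\<rparr>"


subsection \<open>The stochastic model\<close>

text \<open>
  Poisson processes are given by their independent, exponentially distributed gaps. The retrial
  process of a customer runs from the arrival of that customer on, and is only consulted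
  for customers who have joined the orbit.
\<close>

datatype source = Arrival nat | Service nat | Choice nat | Retrial nat nat

definition input ::
  "(nat \<Rightarrow> 'w \<Rightarrow> real) \<Rightarrow> (nat \<Rightarrow> 'w \<Rightarrow> real) \<Rightarrow> (nat \<Rightarrow> 'w \<Rightarrow> bool) \<Rightarrow> (nat \<Rightarrow> nat \<Rightarrow> 'w \<Rightarrow> real)
     \<Rightarrow> source \<Rightarrow> 'w \<Rightarrow> real" where
  "input A S C R x = (case x of
      Arrival k \<Rightarrow> A k
    | Service k \<Rightarrow> S k
    | Choice k \<Rightarrow> (\<lambda>w. of_bool (C k w))
    | Retrial k i \<Rightarrow> R k i)"

definition arrival_epoch :: "(nat \<Rightarrow> 'w \<Rightarrow> real) \<Rightarrow> 'w \<Rightarrow> nat \<Rightarrow> real" where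
  "arrival_epoch A w k = (\<Sum>i\<le>k. A i w)"

definition retrial_epoch ::
  "(nat \<Rightarrow> 'w \<Rightarrow> real) \<Rightarrow> (nat \<Rightarrow> nat \<Rightarrow> 'w \<Rightarrow> real) \<Rightarrow> 'w \<Rightarrow> nat \<Rightarrow> nat \<Rightarrow> real" where
  "retrial_epoch A R w k i = arrival_epoch A w k + (\<Sum>j\<le>i. R k j w)"

locale bernoulli_retrial_queue = prob_space M
  for M :: "'w measure" +
  fixes lam mu q :: real \<comment> \<open>arrival rate, retrial rate, probability of joining the queue\<close>
    and D :: "real measure" \<comment> \<open>distribution of the service time\<close>
    and A S :: "nat \<Rightarrow> 'w \<Rightarrow> real"
    and C :: "nat \<Rightarrow> 'w \<Rightarrow> bool"
    and R :: "nat \<Rightarrow> nat \<Rightarrow> 'w \<Rightarrow> real"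
    and B :: "nat \<Rightarrow> 'w \<Rightarrow> real" \<comment> \<open>service starts\<close>
  assumes lam_pos: "0 < lam" and mu_pos: "0 < mu" and q_pos: "0 < q" and q_less_1: "q < 1"
    and service_distribution: "real_distribution D"
    and service_pos: "cdf D 0 = 0"
    and service_mean_finite: "integrable D (\<lambda>x. x)"
    and independent: "indep_vars (\<lambda>_. borel) (input A S C R) UNIV"
    and arrival_gaps: "\<And>k. distributed M lborel (A k) (exponential_density lam)"
    and service_times: "\<And>k. distr M borel (S k) = D"
    and choices: "\<And>k. prob {w \<in> space M. C k w} = q"
    and retrial_gaps: "\<And>k i. distributed M lborel (R k i) (exponential_density mu)"
    and starts_measurable: "\<And>k. B k \<in> borel_measurable M"
    and service_discipline: "AE w in M. service_rules (arrival_epoch A w) (\<lambda>k. S k w)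
           (\<lambda>k. C k w) (retrial_epoch A R w) (\<lambda>k. B k w)"

text \<open>The steady state law is the limit law of the system state as time tends to infinity.\<close>

definition steady_state_law ::
  "'w measure \<Rightarrow> (nat \<Rightarrow> 'w \<Rightarrow> real) \<Rightarrow> (nat \<Rightarrow> 'w \<Rightarrow> real) \<Rightarrow> (nat \<Rightarrow> 'w \<Rightarrow> bool) \<Rightarrow> (nat \<Rightarrow> 'w \<Rightarrow> real)
     \<Rightarrow> system_state pmf \<Rightarrow> bool" where
  "steady_state_law M A S C B P \<longleftrightarrow>
     (\<forall>x. ((\<lambda>t. measure M {w \<in> space M.
              state_at (arrival_epoch A w) (\<lambda>k. S k w) (\<lambda>k. C k w) (\<lambda>k. B k w) t = x})
            \<longlongrightarrow> pmf P x) at_top)"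

abbreviation given_busy :: "system_state pmf \<Rightarrow> system_state pmf" where
  "given_busy P \<equiv> cond_pmf P {x. server_busy x}"


subsection \<open>The result of Choi and Park on the steady state\<close>

text \<open>
  The defining equation of \<open>h z\<close> has exactly one solution in \<open>{0..1}\<close> if \<open>0 \<le> z \<le> 1\<close> and
  \<open>lam * q * mean D < 1\<close>.
\<close>

definition h :: "real \<Rightarrow> real \<Rightarrow> real measure \<Rightarrow> real \<Rightarrow> real" where
  "h lam q D z =
     (THE x. 0 \<le> x \<and> x \<le> 1 \<and> x = lst D (lam - lam * q * x - lam * (1 - q) * z))"

definition M_a :: "real \<Rightarrow> real \<Rightarrow> real measure \<Rightarrow> real \<Rightarrow> real \<Rightarrow> real" where
  "M_a lam q D z1 z2 =
     1 / (lam * mean D) *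
     ((1 - lst D (lam - lam * q * z1 - lam * (1 - q) * z2)) / (1 - (1 - q) * z2 - q * z1))"

definition M_b :: "real \<Rightarrow> real \<Rightarrow> real measure \<Rightarrow> real \<Rightarrow> real \<Rightarrow> real" where
  "M_b lam q D z1 z2 =
     (1 - lam * q * mean D) *
     ((h lam q D z2 - z1) / (lst D (lam - lam * q * z1 - lam * (1 - q) * z2) - z1))"

definition M_c :: "real \<Rightarrow> real \<Rightarrow> real measure \<Rightarrow> real \<Rightarrow> real" where
  "M_c lam q D z2 =
     (1 - lam * mean D) / (1 - lam * q * mean D) * ((1 - z2) / (h lam q D z2 - z2))"

definition R_0 :: "real \<Rightarrow> real \<Rightarrow> real \<Rightarrow> real measure \<Rightarrow> real \<Rightarrow> real" where
  "R_0 lam mu q D z2 =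
     exp (- (lam / mu) * integral {z2..1} (\<lambda>u. (1 - h lam q D u) / (h lam q D u - u)))"

text \<open>
  For arguments in \<open>{0..<1}\<close> the only singularity of the formula is at \<open>z1 = h z2\<close>; it is removable
  and therefore omitted, both sides being determined there (and at 1) by continuity.
\<close>

definition choi_park :: "real \<Rightarrow> real \<Rightarrow> real \<Rightarrow> real measure \<Rightarrow> system_state pmf \<Rightarrow> bool" where
  "choi_park lam mu q D P \<longleftrightarrow>
     measure_pmf.prob P {x. server_busy x} = lam * mean D \<and>
     (\<forall>z1\<in>{0..<1}. \<forall>z2\<in>{0..<1}. z1 \<noteq> h lam q D z2 \<longrightarrow>
        measure_pmf.expectation (given_busy P) (\<lambda>x. z1 ^ in_queue x * z2 ^ in_orbit x) =
        M_a lam q D z1 z2 * M_b lam q D z1 z2 * M_c lam q D z2 * R_0 lam mu q D z2)"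

end

theory Submission
  imports Defs
begin

text \<open>
  Letting \<open>z1 \<rightarrow> 1\<close> in the formula of Choi and Park, the generating function of the orbit size given a busy
  server is \<open>const * (1 - h z) / (h z - z) * R_0 z\<close>. In terms of \<open>w = 1 - (q * h z + (1 - q) * z)\<close> both \<open>h\<close> and
  \<open>z\<close> are explicit functions of the Laplace transform of the tail \<open>T t\<close> of the service time. For \<open>m > a - 1\<close>
  the \<open>m\<close>-th derivative of that transform is asymptotic to \<open>const * w powr (- m - 1) * T (1 / w)\<close>; going beyond
  the order \<open>a - 1\<close> makes the derivative diverge at a regularly varying rate whether or not \<open>a\<close> is an
  integer. By the chain and product rules the \<open>m\<close>-th derivative of the generating function is, up to a term
  of smaller order, a multiple of it. Karamata's theorem (convergence of Laplace transforms to that of a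
  gamma law) turns this into the asymptotics of \<open>P {N < R \<le> 2 * N}\<close>, and summing these dyadic blocks gives
  the tail of \<open>R\<close>.
\<close>

section \<open>Orders of growth of derivatives at 0\<close>

text \<open>Below the critical order only bounds with a small loss are available: a finite moment of
  order \<open>\<kappa> + 1 < a\<close> shows that the \<open>k\<close>-th derivative of the tail
  transform is \<open>O(w powr (\<kappa> - k))\<close> for \<open>k > \<kappa>\<close>. This loss is
  harmless, because every term that the chain and product rules produce beside the main one gains
  \<open>min \<kappa> 1\<close> powers of \<open>w\<close>, and \<open>\<kappa>\<close> can be taken
  close to \<open>a - 1\<close>. So a calculus of orders, closed under products, reciprocals and
  linear differential equations, stands in for explicit formulas of the higher derivatives. The way
  back has its own obstacle. The coefficients of the \<open>m\<close>-th derivative behave like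
  \<open>n ^ m\<close> times the masses; their sum diverges for \<open>m > a - 1\<close>, and the
  masses are not known to be monotone, so the tail cannot be read off from partial sums directly.
  Within one block \<open>N < n \<le> 2 * N\<close> the weight can be removed exactly by the choice
  of the test function, and the limit theorem is therefore applied block by block.\<close>

definition growth_le :: "real \<Rightarrow> real \<Rightarrow> (real \<Rightarrow> real) \<Rightarrow> bool" where
  "growth_le e t f \<longleftrightarrow> (\<exists>C. \<forall>w\<in>{0<..<e}. \<bar>f w\<bar> \<le> C * w powr (- max t 0))"

text \<open>
  The derivatives of order \<open>k \<le> n\<close> exist on \<open>(0, e)\<close> and are \<open>O(w powr - max (t + k) 0)\<close>: every
  derivative costs one power of \<open>w\<close>, but nothing is gained below order \<open>0\<close>. So \<open>t < 0\<close> means that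
  about \<open>- t\<close> derivatives stay bounded.
\<close>

fun growth_order :: "real \<Rightarrow> nat \<Rightarrow> real \<Rightarrow> (real \<Rightarrow> real) \<Rightarrow> bool" where
  "growth_order e 0 t f = growth_le e t f"
| "growth_order e (Suc n) t f = (growth_le e t f \<and>
     (\<exists>f'. (\<forall>w\<in>{0<..<e}. (f has_real_derivative f' w) (at w)) \<and> growth_order e n (t + 1) f'))"

lemma growth_le_mono:
  assumes "growth_le e t f" "t \<le> t'" "e \<le> 1"
  shows "growth_le e t' f"
proof -
  obtain C where C: "\<forall>w\<in>{0<..<e}. \<bar>f w\<bar> \<le> C * w powr (- max t 0)"
    using assms unfolding growth_le_def by auto
  have "\<bar>f w\<bar> \<le> \<bar>C\<bar> * w powr (- max t' 0)" if w: "w \<in> {0<..<e}" for w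
  proof -
    have "\<bar>f w\<bar> \<le> C * w powr (- max t 0)" using C w by auto
    also have "\<dots> \<le> \<bar>C\<bar> * w powr (- max t 0)" by (intro mult_right_mono) auto
    also have "\<dots> \<le> \<bar>C\<bar> * w powr (- max t' 0)"
      using w assms by (intro mult_left_mono powr_mono') auto
    finally show ?thesis .
  qed
  then show ?thesis unfolding growth_le_def by blast
qed

lemma growth_le_add:
  assumes "growth_le e t f" "growth_le e t g"
  shows "growth_le e t (\<lambda>w. f w + g w)"
proof -
  obtain C C' where C: "\<forall>w\<in>{0<..<e}. \<bar>f w\<bar> \<le> C * w powr (- max t 0)"
    "\<forall>w\<in>{0<..<e}. \<bar>g w\<bar> \<le> C' * w powr (- max t 0)" using assms by (auto simp: growth_le_def)
  then have "\<forall>w\<in>{0<..<e}. \<bar>f w + g w\<bar> \<le> (C + C') * w powr (- max t 0)"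
    by (smt (verit) distrib_right)
  then show ?thesis unfolding growth_le_def by blast
qed

text \<open>\<open>max t 0 + max u 0\<close> is the largest of 0, \<open>t\<close>, \<open>u\<close>
  and \<open>t + u\<close>; hence the exponent. For negative orders a product is as smooth as its
  worse factor.\<close>

lemma growth_le_mult:
  assumes "growth_le e t f" "growth_le e u g"
  shows "growth_le e (max (max t u) (t + u)) (\<lambda>w. f w * g w)"
proof -
  obtain C C' where C: "\<forall>w\<in>{0<..<e}. \<bar>f w\<bar> \<le> C * w powr (- max t 0)"
    "\<forall>w\<in>{0<..<e}. \<bar>g w\<bar> \<le> C' * w powr (- max u 0)" using assms by (auto simp: growth_le_def)
  have "\<bar>f w * g w\<bar> \<le> (C * C') * w powr (- max (max (max t u) (t + u)) 0)" if w: "w \<in> {0<..<e}" for w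
  proof -
    have b: "\<bar>f w\<bar> \<le> C * w powr (- max t 0)" "\<bar>g w\<bar> \<le> C' * w powr (- max u 0)"
      using C w by auto
    have "\<bar>f w * g w\<bar> \<le> (C * w powr (- max t 0)) * (C' * w powr (- max u 0))"
      unfolding abs_mult using b by (intro mult_mono) linarith+
    also have "\<dots> = (C * C') * w powr (- max t 0 + - max u 0)"
      using w unfolding powr_add by simp
    also have "- max t 0 + - max u 0 = - max (max (max t u) (t + u)) 0" by (auto simp: max_def)
    finally show ?thesis .
  qed
  then show ?thesis unfolding growth_le_def by blast
qed

lemma growth_le_bounded:
  assumes "\<And>w. w \<in> {0<..<e} \<Longrightarrow> \<bar>f w\<bar> \<le> c" "e \<le> 1"
  shows "growth_le e t f"
proof -
  have "growth_le e 0 f" unfolding growth_le_def using assms by (intro exI[of _ c]) auto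
  then have "growth_le e (max t 0) f" by (rule growth_le_mono) (use assms in auto)
  then show ?thesis by (simp add: growth_le_def)
qed

lemma growth_order_imp_le: "growth_order e n t f \<Longrightarrow> growth_le e t f"
  by (cases n) auto

declare growth_order.simps(2) [simp del]

lemma growth_order_SucI:
  assumes "growth_le e t f" "\<And>w. w \<in> {0<..<e} \<Longrightarrow> (f has_real_derivative f' w) (at w)"
    "growth_order e n (t + 1) f'"
  shows "growth_order e (Suc n) t f"
  unfolding growth_order.simps(2) using assms by blast

lemma growth_order_SucD:
  assumes "growth_order e (Suc n) t f"
  shows "growth_le e t f"
    "\<exists>f'. (\<forall>w\<in>{0<..<e}. (f has_real_derivative f' w) (at w)) \<and> growth_order e n (t + 1) f'"
  using assms unfolding growth_order.simps(2) by blast+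

lemma growth_order_cong:
  assumes "growth_order e n t f" "\<And>w. w \<in> {0<..<e} \<Longrightarrow> f w = g w"
  shows "growth_order e n t g"
proof (cases n)
  case 0
  then show ?thesis using assms by (auto simp: growth_le_def)
next
  case (Suc m)
  obtain f' where f': "growth_le e t f"
    "\<And>w. w \<in> {0<..<e} \<Longrightarrow> (f has_real_derivative f' w) (at w)" "growth_order e m (t + 1) f'"
    using assms(1) Suc growth_order_SucD[of e m t f] by blast
  have "(g has_real_derivative f' w) (at w)" if "w \<in> {0<..<e}" for w
    using has_field_derivative_transform_within_open[of f "f' w" w "{0<..<e}" g] f' that assms(2) by auto
  moreover have "growth_le e t g" 
    using growth_order_imp_le[OF assms(1)] assms(2) by (auto simp: growth_le_def)
  ultimately show ?thesis using f' Suc growth_order_SucI by blast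
qed

lemma growth_order_pred: "growth_order e (Suc n) t f \<Longrightarrow> growth_order e n t f"
proof (induction n arbitrary: t f)
  case (Suc n)
  obtain f' where "\<forall>w\<in>{0<..<e}. (f has_real_derivative f' w) (at w)" "growth_order e (Suc n) (t + 1) f'"
    using growth_order_SucD(2)[OF Suc.prems] by blast
  then show ?case
    by (intro growth_order_SucI[OF growth_order_SucD(1)[OF Suc.prems], of f'] Suc.IH) auto
qed (simp add: growth_order_SucD)

lemma growth_order_mono:
  assumes "growth_order e n t f" "t \<le> t'" "e \<le> 1"
  shows "growth_order e n t' f"
  using assms(1,2)
proof (induction n arbitrary: t t' f)
  case 0
  then show ?case using growth_le_mono assms(3) by auto
next
  case (Suc n)
  obtain f' where f': "growth_le e t f"
    "\<And>w. w \<in> {0<..<e} \<Longrightarrow> (f has_real_derivative f' w) (at w)" "growth_order e n (t + 1) f'"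
    using growth_order_SucD[OF Suc.prems(1)] by blast
  show ?case
    by (rule growth_order_SucI[OF growth_le_mono[OF f'(1)] f'(2) Suc.IH[OF f'(3)]])
       (use Suc.prems assms in auto)
qed

lemma growth_order_add:
  assumes "growth_order e n t f" "growth_order e n t g"
  shows "growth_order e n t (\<lambda>w. f w + g w)"
  using assms
proof (induction n arbitrary: t f g)
  case 0
  then show ?case using growth_le_add by auto
next
  case (Suc n)
  obtain f' g' where f': "\<And>w. w \<in> {0<..<e} \<Longrightarrow> (f has_real_derivative f' w) (at w)"
     "growth_order e n (t + 1) f'" "growth_le e t f"
    and g': "\<And>w. w \<in> {0<..<e} \<Longrightarrow> (g has_real_derivative g' w) (at w)"
     "growth_order e n (t + 1) g'" "growth_le e t g"
    using growth_order_SucD[OF Suc.prems(1)] growth_order_SucD[OF Suc.prems(2)] by blast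
  show ?case
    by (rule growth_order_SucI[OF growth_le_add[OF f'(3) g'(3)] _ Suc.IH[OF f'(2) g'(2)]])
       (auto intro!: derivative_eq_intros f' g')
qed

lemma growth_order_const:
  assumes "e \<le> 1"
  shows "growth_order e n t (\<lambda>_. c)"
proof (induction n arbitrary: t c)
  case 0
  then show ?case using growth_le_bounded[of e "\<lambda>_. c" "\<bar>c\<bar>"] assms by auto
next
  case (Suc n)
  show ?case
    by (rule growth_order_SucI[OF _ _ Suc[of _ 0]])
       (use growth_le_bounded[of e "\<lambda>_. c" "\<bar>c\<bar>"] assms in auto)
qed

lemma growth_order_mult_aux:
  assumes "growth_order e n t f" "growth_order e n u g" "e \<le> 1"
  shows "growth_order e n (max (max t u) (t + u)) (\<lambda>w. f w * g w)"
  using assms(1,2)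
proof (induction n arbitrary: t u f g)
  case (0 t u f g)
  then show ?case using growth_le_mult by auto
next
  case (Suc n t u f g)
  obtain f' g' where fg: "\<And>w. w \<in> {0<..<e} \<Longrightarrow> (f has_real_derivative f' w) (at w)"
     "growth_order e n (t + 1) f'" "\<And>w. w \<in> {0<..<e} \<Longrightarrow> (g has_real_derivative g' w) (at w)"
     "growth_order e n (u + 1) g'" "growth_le e t f" "growth_le e u g"
    using growth_order_SucD[OF Suc.prems(1)] growth_order_SucD[OF Suc.prems(2)] by blast
  have d: "((\<lambda>w. f w * g w) has_real_derivative f' w * g w + f w * g' w) (at w)" if "w \<in> {0<..<e}" for w
    using fg that by (auto intro!: derivative_eq_intros)
  have o: "growth_order e n (max (max t u) (t + u) + 1) (\<lambda>w. f' w * g w + f w * g' w)"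
    using Suc.IH[OF fg(2) growth_order_pred[OF Suc.prems(2)]] Suc.IH[OF growth_order_pred[OF Suc.prems(1)] fg(4)]
    by (intro growth_order_add) (auto elim!: growth_order_mono simp: assms)
  show ?case by (rule growth_order_SucI[OF growth_le_mult[OF fg(5,6)] d o])
qed

lemma growth_order_mult:
  assumes "growth_order e n t f" "growth_order e n u g" "e \<le> 1" "t \<le> v" "u \<le> v" "t + u \<le> v"
  shows "growth_order e n v (\<lambda>w. f w * g w)"
  using growth_order_mono[OF growth_order_mult_aux[OF assms(1-3)], of v] assms by simp

lemma growth_order_cmult:
  assumes "growth_order e n t f" "e \<le> 1"
  shows "growth_order e n t (\<lambda>w. c * f w)"
  by (rule growth_order_mult[OF growth_order_const[of e n "min t 0" c] assms(1)]) (use assms in auto)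

text \<open>The product rule for orders would lose a power here, because \<open>growth_le\<close>
  records no decay of the factor \<open>w\<close>. In \<open>(w * f)' = f + w * f'\<close> the
  derivative \<open>f'\<close> has order \<open>t + 2\<close>, so by induction both terms have order
  \<open>t + 1\<close>.\<close>

lemma growth_order_id_mult:
  assumes "growth_order e n (t + 1) f" "e \<le> 1"
  shows "growth_order e n t (\<lambda>w. w * f w)"
  using assms(1)
proof (induction n arbitrary: t f)
  have *: "growth_le e t (\<lambda>w. w * f w)" if f: "growth_le e (t + 1) f" for t f
  proof -
    obtain C where C: "\<forall>w\<in>{0<..<e}. \<bar>f w\<bar> \<le> C * w powr (- max (t + 1) 0)"
      using f unfolding growth_le_def by auto
    have "\<bar>w * f w\<bar> \<le> \<bar>C\<bar> * w powr (- max t 0)" if w: "w \<in> {0<..<e}" for w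
    proof -
      have "\<bar>f w\<bar> \<le> C * w powr (- max (t + 1) 0)" using C w by auto
      also have "\<dots> \<le> \<bar>C\<bar> * w powr (- max (t + 1) 0)" by (intro mult_right_mono) auto
      finally have "\<bar>w * f w\<bar> \<le> w * (\<bar>C\<bar> * w powr (- max (t + 1) 0))"
        using w by (simp add: abs_mult)
      also have "\<dots> = \<bar>C\<bar> * w powr (1 + - max (t + 1) 0)" using w unfolding powr_add by simp
      also have "\<dots> \<le> \<bar>C\<bar> * w powr (- max t 0)"
        using w assms by (intro mult_left_mono powr_mono') auto
      finally show ?thesis .
    qed
    then show ?thesis unfolding growth_le_def by blast
  qed
  {
    case 0
    then show ?case using * by auto
  next
    case (Suc n)
    obtain f' where f': "\<And>w. w \<in> {0<..<e} \<Longrightarrow> (f has_real_derivative f' w) (at w)"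
      "growth_order e n (t + 1 + 1) f'" "growth_le e (t + 1) f"
      using growth_order_SucD[OF Suc.prems] by blast
    have d: "((\<lambda>w. w * f w) has_real_derivative f w + w * f' w) (at w)" if "w \<in> {0<..<e}" for w
      using f' that by (auto intro!: derivative_eq_intros)
    have o: "growth_order e n (t + 1) (\<lambda>w. f w + w * f' w)"
      by (intro growth_order_add Suc.IH growth_order_pred[OF Suc.prems]) (use f' in auto)
    show ?case by (rule growth_order_SucI[OF *[OF f'(3)] d o])
  }
qed

text \<open>The derivative \<open>- f' * (1 / f) * (1 / f)\<close> contains \<open>1 / f\<close>
  again, with one derivative fewer to control, so the induction closes; \<open>t \<le> 0\<close>
  keeps the square of \<open>1 / f\<close> at order \<open>t\<close>.\<close>

lemma growth_order_inverse:
  assumes "growth_order e n t f" "\<And>w. w \<in> {0<..<e} \<Longrightarrow> c \<le> f w" "0 < c" "t \<le> 0" "e \<le> 1"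
  shows "growth_order e n t (\<lambda>w. 1 / f w)"
  using assms(1)
proof (induction n)
  have *: "growth_le e t (\<lambda>w. 1 / f w)"
  proof (rule growth_le_bounded)
    fix w assume w: "w \<in> {0<..<e}"
    show "\<bar>1 / f w\<bar> \<le> 1 / c" using assms(2)[OF w] assms(3) by (simp add: frac_le)
  qed fact
  {
    case 0
    then show ?case using * by auto
  next
    case (Suc n)
    obtain f' where f': "\<And>w. w \<in> {0<..<e} \<Longrightarrow> (f has_real_derivative f' w) (at w)"
      "growth_order e n (t + 1) f'" "growth_le e t f"
      using growth_order_SucD[OF Suc.prems] by blast
    have d: "((\<lambda>w. 1 / f w) has_real_derivative - 1 * (f' w * ((1 / f w) * (1 / f w)))) (at w)"
      if "w \<in> {0<..<e}" for w
      using f' that assms(2)[OF that] \<open>0 < c\<close> by (auto intro!: derivative_eq_intros)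
    have u: "growth_order e n t (\<lambda>w. 1 / f w)" 
      using Suc.IH growth_order_pred[OF Suc.prems] by simp
    have u2: "growth_order e n t (\<lambda>w. (1 / f w) * (1 / f w))"
      by (rule growth_order_mult[OF u u]) (use assms in auto)
    have o: "growth_order e n (t + 1) (\<lambda>w. - 1 * (f' w * ((1 / f w) * (1 / f w))))"
      by (intro growth_order_cmult growth_order_mult[OF f'(2) u2]) (use assms in auto)
    show ?case by (rule growth_order_SucI[OF * d o])
  }
qed

text \<open>Intended for the exponential of an integral: every differentiation reproduces
  \<open>f\<close> itself, so boundedness of \<open>f\<close> and the orders of the coefficient
  determine all derivatives.\<close>

lemma growth_order_linear_ode:
  assumes "\<And>n. growth_order e n (t + 1) \<phi>" "\<And>w. w \<in> {0<..<e} \<Longrightarrow> \<bar>f w\<bar> \<le> c" "t \<le> 0" "e \<le> 1"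
    and deriv: "\<And>w. w \<in> {0<..<e} \<Longrightarrow> (f has_real_derivative \<phi> w * f w) (at w)"
  shows "growth_order e n t f"
proof (induction n)
  case 0
  show ?case using growth_le_bounded assms by auto
next
  case (Suc n)
  have o: "growth_order e n (t + 1) (\<lambda>w. \<phi> w * f w)"
    by (rule growth_order_mult[OF assms(1) Suc]) (use assms in auto)
  show ?case
    by (rule growth_order_SucI[OF growth_le_bounded[OF assms(2,4)] deriv o])
qed

definition smooth_order :: "real \<Rightarrow> real \<Rightarrow> (real \<Rightarrow> real) \<Rightarrow> bool" where
  "smooth_order e t f \<longleftrightarrow> (\<forall>n. growth_order e n t f)"

text \<open>Each number \<open>n\<close> of derivatives supplies its own witness \<open>f'\<close>;
  uniqueness of the derivative lets a single function serve all of them.\<close>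

lemma smooth_order_derivative:
  assumes "smooth_order e t f"
  obtains f' where "\<And>w. w \<in> {0<..<e} \<Longrightarrow> (f has_real_derivative f' w) (at w)" "smooth_order e (t + 1) f'"
proof -
  have Suc: "growth_order e (Suc n) t f" for n using assms by (simp add: smooth_order_def)
  obtain f' where f': "\<And>w. w \<in> {0<..<e} \<Longrightarrow> (f has_real_derivative f' w) (at w)"
    using growth_order_SucD(2)[OF Suc[of 0]] by blast
  have "growth_order e n (t + 1) f'" for n
  proof -
    obtain g where g: "\<And>w. w \<in> {0<..<e} \<Longrightarrow> (f has_real_derivative g w) (at w)"
      "growth_order e n (t + 1) g" using growth_order_SucD(2)[OF Suc[of n]] by blast
    show ?thesis
      by (rule growth_order_cong[OF g(2)]) (use f' g DERIV_unique in blast)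
  qed
  then show ?thesis using f' that[of f'] by (simp add: smooth_order_def)
qed

lemma smooth_order_mono: "smooth_order e t f \<Longrightarrow> t \<le> t' \<Longrightarrow> e \<le> 1 \<Longrightarrow> smooth_order e t' f"
  unfolding smooth_order_def using growth_order_mono by blast

lemma smooth_order_add: "smooth_order e t f \<Longrightarrow> smooth_order e t g \<Longrightarrow> smooth_order e t (\<lambda>w. f w + g w)"
  unfolding smooth_order_def using growth_order_add by blast

lemma smooth_order_const: "e \<le> 1 \<Longrightarrow> smooth_order e t (\<lambda>_. c)"
  unfolding smooth_order_def using growth_order_const by blast

lemma smooth_order_mult:
  "smooth_order e t f \<Longrightarrow> smooth_order e u g \<Longrightarrow> e \<le> 1 \<Longrightarrow> t \<le> v \<Longrightarrow> u \<le> v \<Longrightarrow> t + u \<le> v \<Longrightarrow>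
    smooth_order e v (\<lambda>w. f w * g w)"
  unfolding smooth_order_def using growth_order_mult by blast

lemma smooth_order_cmult: "smooth_order e t f \<Longrightarrow> e \<le> 1 \<Longrightarrow> smooth_order e t (\<lambda>w. c * f w)"
  unfolding smooth_order_def using growth_order_cmult by blast

lemma smooth_order_power:
  assumes "smooth_order e t f" "t \<le> 0" "e \<le> 1"
  shows "smooth_order e t (\<lambda>w. f w ^ n)"
proof (induction n)
  case (Suc n)
  show ?case unfolding power_Suc by (rule smooth_order_mult[OF assms(1) Suc]) (use assms in auto)
qed (use smooth_order_const assms in simp)

lemma smooth_order_imp_le: "smooth_order e t f \<Longrightarrow> growth_le e t f"
  unfolding smooth_order_def using growth_order_imp_le by blast

section \<open>Regularly varying tails\<close>

lemma dyadic_floor: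
  fixes x :: real assumes "1 \<le> x"
  obtains n :: nat where "2 ^ n \<le> x" "x \<le> 2 ^ Suc n"
proof -
  define n where "n = nat \<lfloor>log 2 x\<rfloor>"
  have "0 \<le> log 2 x" using assms by simp
  then have "real n \<le> log 2 x" "log 2 x \<le> real (Suc n)" unfolding n_def by linarith+
  then have "2 powr real n \<le> x" "x \<le> 2 powr real (Suc n)"
    using assms by (auto simp: le_log_iff log_le_iff)
  then show ?thesis using that[of n] by (simp add: powr_realpow del: of_nat_Suc power_Suc)
qed

lemma Gamma_integrable:
  fixes b c :: real
  assumes "-1 < b" "0 < c"
  shows "integrable lborel (\<lambda>t. indicator {0<..} t * (t powr b * exp (- (c * t))))"
    and "(\<integral>t. indicator {0<..} t * (t powr b * exp (- t)) \<partial>lborel) = Gamma (b + 1)"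
proof -
  have eq: "indicator {0..} t * t powr (b + 1 - 1) / exp t = indicator {0<..} t * (t powr b * exp (- t))"
    for t :: real by (auto simp: indicator_def exp_minus field_simps)
  have nn: "(\<integral>\<^sup>+t. ennreal (indicator {0<..} t * (t powr b * exp (- t))) \<partial>lborel) = ennreal (Gamma (b + 1))"
    using Gamma_conv_nn_integral_real[of "b + 1"] assms unfolding eq by simp
  have int: "integrable lborel (\<lambda>t. indicator {0<..} t * (t powr b * exp (- t)))"
    by (rule integrableI_nn_integral_finite[OF _ _ nn]) auto
  show "(\<integral>t. indicator {0<..} t * (t powr b * exp (- t)) \<partial>lborel) = Gamma (b + 1)"
    using assms by (subst integral_eq_nn_integral) (auto simp: nn less_imp_le)
  have "integrable lborel (\<lambda>t. indicator {0<..} (0 + c * t) * ((0 + c * t) powr b * exp (- (0 + c * t))))"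
    by (rule lborel_integrable_real_affine[OF int]) (use assms in auto)
  then have "integrable lborel (\<lambda>t. c powr (- b) * (indicator {0<..} (0 + c * t) * ((0 + c * t) powr b * exp (- (0 + c * t)))))"
    by (rule integrable_mult_right)
  also have "(\<lambda>t. c powr (- b) * (indicator {0<..} (0 + c * t) * ((0 + c * t) powr b * exp (- (0 + c * t)))))
      = (\<lambda>t. indicator {0<..} t * (t powr b * exp (- (c * t))))"
    using assms by (auto simp: indicator_def powr_mult powr_minus zero_less_mult_iff field_simps)
  finally show "integrable lborel (\<lambda>t. indicator {0<..} t * (t powr b * exp (- (c * t))))" .
qed

text \<open>The factor \<open>exp \<bar>x\<bar>\<close> is harmless in \<open>J_derivative\<close>,
  where half of the exponential decay absorbs it.\<close>

lemma exp_remainder: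
  fixes x :: real shows "\<bar>exp x - 1 - x\<bar> \<le> x\<^sup>2 * exp \<bar>x\<bar>"
proof -
  have 1: "0 \<le> exp x - 1 - x" using exp_ge_add_one_self[of x] by linarith
  have "exp x * (1 - x) \<le> exp x * exp (- x)"
    using exp_ge_add_one_self[of "- x"] by (intro mult_left_mono) auto
  then have 2: "exp x - 1 \<le> x * exp x" by (simp add: exp_minus algebra_simps)
  have "exp x - 1 - x \<le> x\<^sup>2 * exp \<bar>x\<bar>"
  proof (cases "0 \<le> x")
    case True
    have "exp x - 1 - x \<le> x * (exp x - 1)" using 2 by (simp add: algebra_simps)
    also have "\<dots> \<le> x * (x * exp x)" using 2 True by (intro mult_left_mono) auto
    finally show ?thesis using True by (simp add: power2_eq_square mult_ac)
  next
    case False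
    have "exp x - 1 - x \<le> (- x) * (1 - exp x)" using 2 by (simp add: algebra_simps)
    also have "\<dots> \<le> (- x) * (- x)"
      by (intro mult_left_mono) (use exp_ge_add_one_self[of x] False in linarith)+
    also have "\<dots> \<le> x\<^sup>2 * exp \<bar>x\<bar>" by (simp add: power2_eq_square mult_left_le mult_le_cancel_left1)
    finally show ?thesis .
  qed
  with 1 show ?thesis by simp
qed

text \<open>The tail itself is the unit of all asymptotics, instead of
  \<open>t powr (- a) * L t\<close>: its monotonicity supplies the uniformity in \<open>x\<close>
  that pointwise limits of ratios lack, and \<open>T \<le> 1\<close> handles small
  arguments.\<close>

locale regularly_varying_tail =
  fixes T :: "real \<Rightarrow> real" and a :: real
  assumes antimono: "\<And>x y. x \<le> y \<Longrightarrow> T y \<le> T x"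
    and pos: "\<And>x. 0 < T x"
    and le_1: "\<And>x. T x \<le> 1"
    and a_gt_1: "1 < a"
    and ratio: "\<And>x. 0 < x \<Longrightarrow> ((\<lambda>t. T (x * t) / T t) \<longlongrightarrow> x powr (- a)) at_top"
begin

lemma borel_measurable_T [measurable]: "T \<in> borel_measurable borel"
proof -
  have "mono (\<lambda>x. - T x)" using antimono by (auto simp: mono_def)
  then have "(\<lambda>x. - (- T x)) \<in> borel_measurable borel"
    by (intro borel_measurable_uminus borel_measurable_mono)
  then show ?thesis by simp
qed

text \<open>Once \<open>t\<close> is large, doubling it multiplies \<open>T\<close> by less than
  \<open>2 powr (- b)\<close>, because the limit \<open>2 powr (- a)\<close> is smaller. Iteration
  handles the powers of two; monotonicity fills the gaps at the cost of the factor
  \<open>2 powr b\<close>.\<close>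

lemma potter_upper:
  assumes "0 < b" "b < a"
  obtains C t0 where "0 < C" "0 < t0" "\<And>t x. t0 \<le> t \<Longrightarrow> 1 \<le> x \<Longrightarrow> T (x * t) \<le> C * x powr (- b) * T t"
proof -
  have "\<forall>\<^sub>F t in at_top. T (2 * t) / T t < 2 powr (- b)"
    using ratio[of 2] assms by (intro order_tendstoD(2)[of _ "2 powr (- a)"]) auto
  then obtain t0 where t0: "\<And>t. t0 \<le> t \<Longrightarrow> T (2 * t) / T t < 2 powr (- b)"
    unfolding eventually_at_top_linorder by auto
  define t1 where "t1 = max t0 1"
  have step: "T (2 * t) \<le> 2 powr (- b) * T t" if "t1 \<le> t" for t
    using t0[of t] that pos[of t] by (simp add: t1_def field_simps)
  have iter: "T (2 ^ n * t) \<le> (2 ^ n) powr (- b) * T t" if t: "t1 \<le> t" for t n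
  proof (induction n)
    case (Suc n)
    have "t * 1 \<le> t * 2 ^ n" by (intro mult_left_mono) (use t in \<open>auto simp: t1_def\<close>)
    then have "T (2 * (2 ^ n * t)) \<le> 2 powr (- b) * T (2 ^ n * t)"
      using t by (intro step) (simp add: mult.commute)
    also have "\<dots> \<le> 2 powr (- b) * ((2 ^ n) powr (- b) * T t)"
      by (intro mult_left_mono Suc) auto
    finally show ?case by (simp add: powr_mult mult_ac)
  qed simp
  have "T (x * t) \<le> 2 powr b * x powr (- b) * T t" if t: "t1 \<le> t" and x: "1 \<le> x" for t x
  proof -
    obtain n where n: "2 ^ n \<le> x" "x \<le> 2 ^ Suc n" using dyadic_floor[OF x] .
    have "T (x * t) \<le> T (2 ^ n * t)"
      by (intro antimono mult_right_mono) (use n t in \<open>auto simp: t1_def\<close>)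
    also have "\<dots> \<le> (2 ^ n) powr (- b) * T t" using iter t by simp
    also have "\<dots> \<le> (x / 2) powr (- b) * T t"
      using n x assms less_imp_le[OF pos] by (intro mult_right_mono powr_mono2') auto
    also have "(x / 2) powr (- b) = 2 powr b * x powr (- b)"
      using x by (simp add: powr_divide powr_minus field_simps)
    finally show ?thesis .
  qed
  then show ?thesis using that[of "2 powr b" t1] by (simp add: t1_def)
qed

text \<open>Doubling again, now from below; \<open>x\<close> is rounded up to a power of two, which
  costs \<open>2 powr (- b)\<close>.\<close>

lemma potter_lower:
  assumes "a < b"
  obtains c t0 where "0 < c" "0 < t0" "\<And>t x. t0 \<le> t \<Longrightarrow> 1 \<le> x \<Longrightarrow> c * x powr (- b) * T t \<le> T (x * t)"
proof -
  have "\<forall>\<^sub>F t in at_top. 2 powr (- b) < T (2 * t) / T t"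
    using ratio[of 2] assms by (intro order_tendstoD(1)[of _ "2 powr (- a)"]) auto
  then obtain t0 where t0: "\<And>t. t0 \<le> t \<Longrightarrow> 2 powr (- b) < T (2 * t) / T t"
    unfolding eventually_at_top_linorder by auto
  define t1 where "t1 = max t0 1"
  have step: "2 powr (- b) * T t \<le> T (2 * t)" if "t1 \<le> t" for t
    using t0[of t] that pos[of t] by (simp add: t1_def field_simps)
  have iter: "(2 ^ n) powr (- b) * T t \<le> T (2 ^ n * t)" if t: "t1 \<le> t" for t n
  proof (induction n)
    case (Suc n)
    have "t * 1 \<le> t * 2 ^ n" by (intro mult_left_mono) (use t in \<open>auto simp: t1_def\<close>)
    have "2 powr (- b) * ((2 ^ n) powr (- b) * T t) \<le> 2 powr (- b) * T (2 ^ n * t)"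
      by (intro mult_left_mono Suc) auto
    also have "\<dots> \<le> T (2 * (2 ^ n * t))"
      using t \<open>t * 1 \<le> t * 2 ^ n\<close> by (intro step) (simp add: mult.commute)
    finally show ?case by (simp add: powr_mult mult_ac)
  qed simp
  have "2 powr (- b) * x powr (- b) * T t \<le> T (x * t)" if t: "t1 \<le> t" and x: "1 \<le> x" for t x
  proof -
    obtain n where n: "2 ^ n \<le> x" "x \<le> 2 ^ Suc n" using dyadic_floor[OF x] .
    have "2 powr (- b) * x powr (- b) = (2 * x) powr (- b)" using x by (simp add: powr_mult)
    also have "\<dots> * T t \<le> (2 ^ Suc n) powr (- b) * T t"
      using n x assms a_gt_1 less_imp_le[OF pos] by (intro mult_right_mono powr_mono2') auto
    also have "\<dots> \<le> T (2 ^ Suc n * t)" using iter t by blast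
    also have "\<dots> \<le> T (x * t)"
      by (intro antimono mult_right_mono) (use n t in \<open>auto simp: t1_def\<close>)
    finally show ?thesis .
  qed
  then show ?thesis using that[of "2 powr (- b)" t1] by (simp add: t1_def)
qed

section \<open>Laplace transforms of the tail with polynomial weights\<close>

definition J :: "nat \<Rightarrow> real \<Rightarrow> real" where
  "J k s = (\<integral>t. indicator {0<..} t * (t ^ k * exp (- (s * t)) * T t) \<partial>lborel)"

lemma J_integrable:
  assumes "0 < s"
  shows "integrable lborel (\<lambda>t. indicator {0<..} t * (t ^ k * exp (- (s * t)) * T t))"
proof (rule Bochner_Integration.integrable_bound[OF Gamma_integrable(1)[of "real k" s]])
  show "AE t in lborel. norm (indicator {0<..} t * (t ^ k * exp (- (s * t)) * T t))
          \<le> norm (indicator {0<..} t * (t powr real k * exp (- (s * t))))"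
  proof (rule AE_I2)
    fix t :: real
    have "\<bar>T t\<bar> \<le> 1" using pos[of t] le_1[of t] by simp
    then show "norm (indicator {0<..} t * (t ^ k * exp (- (s * t)) * T t))
          \<le> norm (indicator {0<..} t * (t powr real k * exp (- (s * t))))"
      by (auto simp: indicator_def powr_realpow abs_mult mult_le_cancel_left1 mult_left_le)
  qed
qed (use assms in auto)

text \<open>So \<open>J k\<close> is \<open>(- 1) ^ k\<close> times the \<open>k\<close>-th
  derivative of the Laplace transform \<open>J 0\<close> of the tail. The error of the difference
  quotient is at most \<open>\<bar>d\<bar> * J (k + 2) (s / 2)\<close>: the second order remainder
  costs two powers of \<open>t\<close> and half of the rate \<open>s\<close>.\<close>

lemma J_derivative:
  assumes s: "0 < s"
  shows "(J k has_real_derivative - J (Suc k) s) (at s)"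
proof -
  let ?K = "J (k + 2) (s / 2)"
  have bound: "\<bar>(J k (s + d) - J k s) / d + J (Suc k) s\<bar> \<le> \<bar>d\<bar> * ?K" if d: "\<bar>d\<bar> < s / 2" "d \<noteq> 0" for d
  proof -
    let ?f = "\<lambda>k s t. indicator {0<..} t * (t ^ k * exp (- (s * t)) * T t) :: real"
    have sd: "0 < s + d" using d s by (auto simp: abs_if split: if_splits)
    have "\<bar>J k (s + d) - J k s + d * J (Suc k) s\<bar> =
        \<bar>\<integral>t. ?f k (s + d) t - ?f k s t + d * ?f (Suc k) s t \<partial>lborel\<bar>"
      unfolding J_def using J_integrable[OF s] J_integrable[OF sd] by (simp del: power_Suc)
    also have "\<dots> \<le> (\<integral>t. \<bar>?f k (s + d) t - ?f k s t + d * ?f (Suc k) s t\<bar> \<partial>lborel)"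
      by (rule integral_abs_bound)
    also have "\<dots> \<le> (\<integral>t. d\<^sup>2 * ?f (k + 2) (s / 2) t \<partial>lborel)"
    proof (rule integral_mono)
      show "integrable lborel (\<lambda>t. \<bar>?f k (s + d) t - ?f k s t + d * ?f (Suc k) s t\<bar>)"
        using J_integrable[OF s] J_integrable[OF sd] by (simp del: power_Suc)
      show "integrable lborel (\<lambda>t. d\<^sup>2 * ?f (k + 2) (s / 2) t)"
        by (rule integrable_mult_right, rule J_integrable) (use s in simp)
      fix t :: real
      show "\<bar>?f k (s + d) t - ?f k s t + d * ?f (Suc k) s t\<bar> \<le> d\<^sup>2 * ?f (k + 2) (s / 2) t"
      proof (cases "0 < t")
        case True
        have "?f k (s + d) t - ?f k s t + d * ?f (Suc k) s t =
            t ^ k * exp (- (s * t)) * T t * (exp (- (d * t)) - 1 - (- (d * t)))"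
          using True by (simp add: algebra_simps exp_add[symmetric])
        then have "\<bar>?f k (s + d) t - ?f k s t + d * ?f (Suc k) s t\<bar> =
            t ^ k * exp (- (s * t)) * T t * \<bar>exp (- (d * t)) - 1 - (- (d * t))\<bar>"
          using True pos[of t] by (simp add: abs_mult)
        also have "\<dots> \<le> t ^ k * exp (- (s * t)) * T t * ((- (d * t))\<^sup>2 * exp \<bar>- (d * t)\<bar>)"
          using True pos[of t] by (intro mult_left_mono exp_remainder) auto
        also have "\<dots> \<le> t ^ k * exp (- (s * t)) * T t * ((- (d * t))\<^sup>2 * exp (s / 2 * t))"
          using True pos[of t] d by (intro mult_left_mono) (auto simp: abs_mult)
        also have "\<dots> = d\<^sup>2 * (t ^ k * t\<^sup>2 * (exp (- (s * t)) * exp (s / 2 * t)) * T t)"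
          by (simp add: power_mult_distrib mult_ac)
        also have "exp (- (s * t)) * exp (s / 2 * t) = exp (- (s / 2 * t))"
          unfolding exp_add[symmetric] by (simp add: field_simps)
        also have "t ^ k * t\<^sup>2 = t ^ (k + 2)" by (simp only: power_add)
        also have "d\<^sup>2 * (t ^ (k + 2) * exp (- (s / 2 * t)) * T t) = d\<^sup>2 * ?f (k + 2) (s / 2) t"
          using True by (simp del: power_Suc add_2_eq_Suc')
        finally show ?thesis .
      qed simp
    qed
    also have "\<dots> = d\<^sup>2 * ?K" unfolding J_def by simp
    finally have *: "\<bar>J k (s + d) - J k s + d * J (Suc k) s\<bar> \<le> d\<^sup>2 * ?K" .
    have "(J k (s + d) - J k s) / d + J (Suc k) s = (J k (s + d) - J k s + d * J (Suc k) s) / d"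
      using d by (simp add: add_divide_distrib)
    then have "\<bar>(J k (s + d) - J k s) / d + J (Suc k) s\<bar> = \<bar>J k (s + d) - J k s + d * J (Suc k) s\<bar> / \<bar>d\<bar>"
      by (simp only: abs_divide)
    also have "\<dots> \<le> d\<^sup>2 * ?K / \<bar>d\<bar>" by (intro divide_right_mono *) simp
    also have "d\<^sup>2 = \<bar>d\<bar> * \<bar>d\<bar>" by (simp only: power2_eq_square abs_mult_self_eq)
    also have "\<bar>d\<bar> * \<bar>d\<bar> * ?K / \<bar>d\<bar> = \<bar>d\<bar> * ?K"
      using d(2) by (simp only: mult.assoc) (rule nonzero_mult_div_cancel_left, simp)
    finally show ?thesis .
  qed
  have "((\<lambda>d. (J k (s + d) - J k s) / d + J (Suc k) s) \<longlongrightarrow> 0) (at 0)"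
  proof (rule Lim_null_comparison)
    show "\<forall>\<^sub>F d in at 0. norm ((J k (s + d) - J k s) / d + J (Suc k) s) \<le> \<bar>d\<bar> * ?K"
      unfolding eventually_at using bound s by (intro exI[of _ "s / 2"]) auto
    show "((\<lambda>d. \<bar>d\<bar> * ?K) \<longlongrightarrow> 0) (at 0)" by (auto intro!: tendsto_eq_intros)
  qed
  then have "((\<lambda>d. (J k (s + d) - J k s) / d + J (Suc k) s - J (Suc k) s) \<longlongrightarrow> 0 - J (Suc k) s) (at 0)"
    by (intro tendsto_intros)
  then show ?thesis by (simp add: DERIV_def)
qed


text \<open>Up to a factor this is the moment of order \<open>\<kappa> + 1 < a\<close> of a law with
  tail \<open>T\<close>. The Potter exponent \<open>b\<close> lies halfway between
  \<open>\<kappa> + 1\<close> and \<open>a\<close>, which makes \<open>t powr (\<kappa> - b)\<close>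
  integrable at infinity.\<close>

lemma moment_integrable:
  assumes "0 \<le> \<kappa>" "\<kappa> < a - 1"
  shows "integrable lborel (\<lambda>t. indicator {0<..} t * (t powr \<kappa> * T t))"
proof -
  define b where "b = (\<kappa> + 1 + a) / 2"
  have b: "0 < b" "b < a" "\<kappa> - b < -1" using assms unfolding b_def by (auto simp: field_simps)
  obtain C t0 where C: "0 < C" "0 < t0" "\<And>t x. t0 \<le> t \<Longrightarrow> 1 \<le> x \<Longrightarrow> T (x * t) \<le> C * x powr (- b) * T t"
    using potter_upper[OF b(1,2)] by blast
  define K where "K = C * t0 powr b * T t0"
  have K: "T t \<le> K * t powr (- b)" if "t0 \<le> t" for t
    using C(3)[of t0 "t / t0"] C(2) that by (simp add: K_def powr_divide powr_minus field_simps)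
  let ?g = "\<lambda>t. indicator {0..t0} t * t0 powr \<kappa> + K * (indicator {t0..} t * t powr (\<kappa> - b)) :: real"
  have "(\<integral>\<^sup>+t. ennreal (indicator {t0..} t * t powr (\<kappa> - b)) \<partial>lborel) = ennreal (- (t0 powr (\<kappa> - b + 1)) / (\<kappa> - b + 1))"
    using nn_integral_has_integral_lebesgue[OF _ has_integral_powr_to_inf[OF b(3) C(2)]] by simp
  then have "integrable lborel (\<lambda>t. indicator {t0..} t * t powr (\<kappa> - b))"
    by (intro integrableI_nn_integral_finite) auto
  then have "integrable lborel ?g"
    by (intro Bochner_Integration.integrable_add integrable_mult_right integrable_mult_left) (auto simp: emeasure_lborel_Icc_eq)
  then show ?thesis
  proof (rule Bochner_Integration.integrable_bound)
    show "AE t in lborel. norm (indicator {0<..} t * (t powr \<kappa> * T t)) \<le> norm (?g t)"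
    proof (rule AE_I2)
      fix t :: real
      have K0: "0 < K" using C pos[of t0] by (simp add: K_def)
      consider "t \<le> 0" | "0 < t" "t < t0" | "t0 \<le> t" by linarith
      then show "norm (indicator {0<..} t * (t powr \<kappa> * T t)) \<le> norm (?g t)"
      proof cases
        case 2
        then have "t powr \<kappa> * T t \<le> t0 powr \<kappa> * 1"
          using assms pos[of t] le_1[of t] by (intro mult_mono powr_mono2) (auto simp: less_imp_le)
        then show ?thesis using 2 pos[of t] by simp
      next
        case 3
        have "t powr \<kappa> * T t \<le> t powr \<kappa> * (K * t powr (- b))"
          using K[OF 3] by (intro mult_left_mono) auto
        also have "\<dots> = K * t powr (\<kappa> - b)" by (simp add: powr_diff powr_minus field_simps)
        also have "\<dots> \<le> \<bar>?g t\<bar>" using 3 K0 by (simp add: indicator_def)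
        finally show ?thesis using 3 C(2) pos[of t] by simp
      qed simp
    qed
  qed simp
qed

lemma T_integrable: "integrable lborel (\<lambda>t. indicator {0<..} t * T t)"
proof -
  have "(\<lambda>t::real. indicator {0<..} t * (t powr 0 * T t)) = (\<lambda>t. indicator {0<..} t * T t)"
    by (auto simp: indicator_def)
  then show ?thesis using moment_integrable[of 0] a_gt_1 by simp
qed

lemma J_nonneg: "0 \<le> J k s"
  unfolding J_def by (intro integral_nonneg_AE AE_I2) (auto simp: indicator_def less_imp_le[OF pos])

text \<open>Crude, but available for every \<open>k\<close>. For \<open>k > \<kappa>\<close> the
  weight \<open>t ^ k * exp (- (s * t))\<close> is
  \<open>t powr \<kappa> * s powr (\<kappa> - k)\<close> times
  \<open>y powr (k - \<kappa>) * exp (- y)\<close> with \<open>y = s * t\<close>, and the last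
  factor is bounded; a finite moment remains.\<close>

lemma J_bound:
  assumes "0 < \<kappa>" "\<kappa> < a - 1"
  obtains C where "\<And>s. 0 < s \<Longrightarrow> J k s \<le> C * s powr (- max (real k - \<kappa>) 0)"
proof (cases "real k \<le> \<kappa>")
  case True
  let ?g = "\<lambda>t. indicator {0<..} t * T t + indicator {0<..} t * (t powr \<kappa> * T t)"
  have g: "integrable lborel ?g"
    using T_integrable moment_integrable[of \<kappa>] assms by (intro Bochner_Integration.integrable_add) auto
  have "J k s \<le> integral\<^sup>L lborel ?g" if "0 < s" for s
    unfolding J_def
  proof (rule integral_mono[OF J_integrable[OF that] g])
    fix t :: real
    show "indicator {0<..} t * (t ^ k * exp (- (s * t)) * T t) \<le> ?g t"
    proof (cases "0 < t")
      case t: True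
      have "t ^ k \<le> 1 + t powr \<kappa>"
      proof (cases "t \<le> 1")
        case True
        then have "t ^ k \<le> 1" using t by (simp add: power_le_one)
        then show ?thesis using t by (smt (verit) powr_ge_zero)
      next
        case False
        then have "t powr real k \<le> t powr \<kappa>" using \<open>real k \<le> \<kappa>\<close> by (intro powr_mono) auto
        then show ?thesis using t by (simp add: powr_realpow)
      qed
      moreover have "exp (- (s * t)) \<le> 1" using that t by simp
      ultimately have "t ^ k * exp (- (s * t)) \<le> (1 + t powr \<kappa>) * 1"
        using t by (intro mult_mono) auto
      then have "t ^ k * exp (- (s * t)) * T t \<le> (1 + t powr \<kappa>) * T t"
        using pos[of t] by (intro mult_right_mono) auto
      then show ?thesis using t by (simp add: algebra_simps)
    qed simp
  qed
  then show ?thesis using True by (intro that[of "integral\<^sup>L lborel ?g"]) (simp add: max_def)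
next
  case False
  define b where "b = real k - \<kappa>"
  have b: "0 < b" using False by (simp add: b_def)
  define n where "n = nat \<lceil>b\<rceil>"
  define C :: real where "C = 1 + fact n"
  have xb: "x powr b * exp (- x) \<le> C" if "0 < x" for x :: real
  proof (cases "x \<le> 1")
    case True
    then have "x powr b \<le> 1" using that b by (simp add: powr_le1)
    then have "x powr b * exp (- x) \<le> 1 * 1" using that by (intro mult_mono) auto
    also have "\<dots> \<le> C" by (simp add: C_def)
    finally show ?thesis by simp
  next
    case False
    have "x powr b \<le> x powr real n" using False b by (intro powr_mono) (auto simp: n_def)
    also have "\<dots> = x ^ n" using that by (simp add: powr_realpow)
    also have "x ^ n / fact n \<le> exp x"
    proof -
      have "(\<Sum>i\<in>{n}. x ^ i /\<^sub>R fact i) \<le> (\<Sum>i. x ^ i /\<^sub>R fact i)"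
        using that by (intro sum_le_suminf summable_exp_generic) auto
      then show ?thesis by (simp add: exp_def divide_inverse mult.commute)
    qed
    then have "x ^ n \<le> fact n * exp x" by (simp add: field_simps)
    finally have "x powr b \<le> fact n * exp x" .
    then have "x powr b * exp (- x) \<le> fact n * exp x * exp (- x)" by (intro mult_right_mono) auto
    then show ?thesis by (simp add: C_def mult.assoc exp_minus)
  qed
  let ?g = "\<lambda>s t. C * s powr (- b) * (indicator {0<..} t * (t powr \<kappa> * T t))"
  have "J k s \<le> C * (\<integral>t. indicator {0<..} t * (t powr \<kappa> * T t) \<partial>lborel) * s powr (- b)" if s: "0 < s" for s
  proof -
    have "J k s \<le> integral\<^sup>L lborel (?g s)"
      unfolding J_def
    proof (rule integral_mono[OF J_integrable[OF s]])
      show "integrable lborel (?g s)" using moment_integrable[of \<kappa>] assms by simp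
      fix t :: real
      show "indicator {0<..} t * (t ^ k * exp (- (s * t)) * T t) \<le> ?g s t"
      proof (cases "0 < t")
        case t: True
        have "t ^ k * exp (- (s * t)) = t powr \<kappa> * s powr (- b) * ((s * t) powr b * exp (- (s * t)))"
          using s t by (simp add: powr_mult powr_minus powr_realpow[symmetric] b_def powr_diff field_simps)
        also have "\<dots> \<le> t powr \<kappa> * s powr (- b) * C"
          using xb[of "s * t"] s t by (intro mult_left_mono) auto
        finally have "t ^ k * exp (- (s * t)) * T t \<le> t powr \<kappa> * s powr (- b) * C * T t"
          using pos[of t] by (intro mult_right_mono) auto
        then show ?thesis using t by (simp add: mult_ac)
      qed simp
    qed
    also have "\<dots> = C * s powr (- b) * (\<integral>t. indicator {0<..} t * (t powr \<kappa> * T t) \<partial>lborel)"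
      by (rule integral_mult_right_zero)
    finally show ?thesis by (simp only: mult_ac)
  qed
  then show ?thesis using b by (intro that) (auto simp: max_def b_def)
qed

text \<open>Substituting \<open>t = \<tau> * x\<close> leaves the integral of
  \<open>x ^ m * exp (- x)\<close> against \<open>T (x * \<tau>) / T \<tau>\<close>, which tends to
  \<open>x powr (- a)\<close>. The condition on \<open>m\<close> makes the limit integrable at 0 and
  leaves room for a Potter exponent \<open>b\<close> between \<open>a\<close> and
  \<open>m + 1\<close> in the majorant.\<close>

lemma J_abelian:
  assumes "a - 1 < real m"
  shows "((\<lambda>\<tau>. J m (1 / \<tau>) / (\<tau> ^ (m + 1) * T \<tau>)) \<longlongrightarrow> Gamma (real m + 1 - a)) at_top"
proof -
  define b where "b = (real m + 1 + a) / 2"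
  have b: "a < b" "-1 < real m - b" using assms unfolding b_def by (auto simp: field_simps)
  obtain c t0 where c: "0 < c" "0 < t0" "\<And>t x. t0 \<le> t \<Longrightarrow> 1 \<le> x \<Longrightarrow> c * x powr (- b) * T t \<le> T (x * t)"
    using potter_lower[OF b(1)] by blast
  \<comment> \<open>The two summands serve \<open>x < 1\<close>: Potter from
    \<open>x * \<tau>\<close> to \<open>\<tau>\<close> if \<open>x * \<tau>\<close> is at least
    \<open>t0\<close>, and otherwise Potter from \<open>t0\<close> to \<open>\<tau>\<close> together
    with \<open>T \<le> 1\<close>.\<close>
  define K where "K = 1 / c + 1 / (c * T t0)"
  have K0: "0 \<le> 1 / c" "0 \<le> 1 / (c * T t0)" using c pos[of t0] by auto
  have dom: "T (x * \<tau>) / T \<tau> \<le> 1 + K * x powr (- b)" if x: "0 < x" and t: "t0 \<le> \<tau>" for x \<tau>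
  proof -
    consider "1 \<le> x" | "x < 1" "t0 \<le> x * \<tau>" | "x < 1" "x * \<tau> < t0" by linarith
    then show ?thesis
    proof cases
      case 1
      have "1 * \<tau> \<le> x * \<tau>" using 1 t c by (intro mult_right_mono) auto
      then have "T (x * \<tau>) / T \<tau> \<le> 1" using antimono[of \<tau> "x * \<tau>"] pos[of \<tau>] by simp
      also have "\<dots> \<le> 1 + K * x powr (- b)" using K0 by (simp add: K_def)
      finally show ?thesis .
    next
      case 2
      have "c * (1 / x) powr (- b) * T (x * \<tau>) \<le> T (1 / x * (x * \<tau>))"
        using x 2 by (intro c(3)) auto
      then have "T (x * \<tau>) / T \<tau> \<le> 1 / c * x powr (- b)"
        using x c pos[of \<tau>] by (simp add: powr_divide powr_minus field_simps)
      also have "\<dots> \<le> K * x powr (- b)" using K0 by (intro mult_right_mono) (auto simp: K_def)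
      finally show ?thesis by simp
    next
      case 3
      have "c * (1 / x) powr (- b) * T t0 \<le> c * (\<tau> / t0) powr (- b) * T t0"
      proof -
        have "(1 / x) powr (- b) \<le> (\<tau> / t0) powr (- b)"
          using 3 x t c b a_gt_1 by (intro powr_mono2') (auto simp: field_simps)
        then show ?thesis using c pos[of t0] by (intro mult_right_mono mult_left_mono) auto
      qed
      also have "\<dots> \<le> T (\<tau> / t0 * t0)" using c t by (intro c(3)) auto
      finally have "c * T t0 \<le> x powr (- b) * T \<tau>"
        using x c by (simp add: powr_divide powr_minus field_simps)
      then have "1 / T \<tau> \<le> 1 / (c * T t0) * x powr (- b)"
        using c pos[of t0] pos[of \<tau>] by (simp add: field_simps)
      also have "\<dots> \<le> K * x powr (- b)" using K0 by (intro mult_right_mono) (auto simp: K_def)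
      finally have "1 / T \<tau> \<le> 1 + K * x powr (- b)" by simp
      moreover have "T (x * \<tau>) / T \<tau> \<le> 1 / T \<tau>"
        using pos[of \<tau>] le_1 by (intro divide_right_mono) (auto simp: less_imp_le)
      ultimately show ?thesis by linarith
    qed
  qed
  let ?s = "\<lambda>\<tau> x. indicator {0<..} x * (x ^ m * exp (- x) * (T (x * \<tau>) / T \<tau>)) :: real"
  let ?f = "\<lambda>x. indicator {0<..} x * (x powr (real m - a) * exp (- x)) :: real"
  let ?w = "\<lambda>x. indicator {0<..} x * (x powr (real m) * exp (- (1 * x))) +
                 K * (indicator {0<..} x * (x powr (real m - b) * exp (- (1 * x)))) :: real"
  have "((\<lambda>\<tau>. integral\<^sup>L lborel (?s \<tau>)) \<longlongrightarrow> integral\<^sup>L lborel ?f) at_top"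
  proof (rule integral_dominated_convergence_at_top[where w = ?w])
    show "integrable lborel ?w"
      using Gamma_integrable(1)[of "real m" 1] Gamma_integrable(1)[of "real m - b" 1] b by simp
    show "AE x in lborel. ((\<lambda>\<tau>. ?s \<tau> x) \<longlongrightarrow> ?f x) at_top"
    proof (rule AE_I2)
      fix x :: real
      show "((\<lambda>\<tau>. ?s \<tau> x) \<longlongrightarrow> ?f x) at_top"
      proof (cases "0 < x")
        case True
        have "((\<lambda>\<tau>. ?s \<tau> x) \<longlongrightarrow> indicator {0<..} x * (x ^ m * exp (- x) * x powr (- a))) at_top"
          by (intro tendsto_intros ratio True)
        then show ?thesis using True by (simp add: powr_diff powr_minus powr_realpow field_simps)
      qed simp
    qed
    have "AE x in lborel. norm (?s \<tau> x) \<le> ?w x" if "t0 \<le> \<tau>" for \<tau>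
    proof (rule AE_I2)
      fix x :: real
      show "norm (?s \<tau> x) \<le> ?w x"
      proof (cases "0 < x")
        case True
        have "norm (?s \<tau> x) = x ^ m * exp (- x) * (T (x * \<tau>) / T \<tau>)"
          using True pos[of \<tau>] pos[of "x * \<tau>"] by simp
        also have "\<dots> \<le> x ^ m * exp (- x) * (1 + K * x powr (- b))"
          using True dom[OF True that] by (intro mult_left_mono) auto
        also have "\<dots> = ?w x" using True
          by (simp add: powr_diff powr_minus powr_realpow field_simps)
        finally show ?thesis .
      qed simp
    qed
    then show "\<forall>\<^sub>F \<tau> in at_top. AE x in lborel. norm (?s \<tau> x) \<le> ?w x"
      using eventually_at_top_linorder by blast
  qed auto
  moreover have "integral\<^sup>L lborel ?f = Gamma (real m + 1 - a)"
    using Gamma_integrable(2)[of "real m - a" 1] assms by (simp add: algebra_simps)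
  moreover have "\<forall>\<^sub>F \<tau> in at_top. integral\<^sup>L lborel (?s \<tau>) = J m (1 / \<tau>) / (\<tau> ^ (m + 1) * T \<tau>)"
    using eventually_gt_at_top[of 0]
  proof eventually_elim
    case (elim \<tau>)
    have "J m (1 / \<tau>) = \<tau> * (\<integral>x. indicator {0<..} (\<tau> * x) * ((\<tau> * x) ^ m * exp (- (1 / \<tau> * (\<tau> * x))) * T (\<tau> * x)) \<partial>lborel)"
      unfolding J_def using elim by (subst lborel_integral_real_affine[of \<tau> _ 0]) auto
    also have "(\<lambda>x. indicator {0<..} (\<tau> * x) * ((\<tau> * x) ^ m * exp (- (1 / \<tau> * (\<tau> * x))) * T (\<tau> * x)))
        = (\<lambda>x. (\<tau> ^ m * T \<tau>) * ?s \<tau> x)"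
      using elim pos[of \<tau>] by (auto simp: indicator_def zero_less_mult_iff power_mult_distrib mult_ac)
    also have "\<tau> * integral\<^sup>L lborel (\<lambda>x. (\<tau> ^ m * T \<tau>) * ?s \<tau> x) = \<tau> * (\<tau> ^ m * T \<tau> * integral\<^sup>L lborel (?s \<tau>))"
      by (subst integral_mult_right_zero) (rule refl)
    finally have "J m (1 / \<tau>) = \<tau> ^ (m + 1) * T \<tau> * integral\<^sup>L lborel (?s \<tau>)"
      by (simp only: power_add power_one_right mult_ac)
    then show ?case using elim pos[of \<tau>] by simp
  qed
  ultimately show ?thesis by (simp add: tendsto_cong)
qed

lemma J_0_tendsto: "(J 0 \<longlongrightarrow> J 0 0) (at_right 0)"
proof -
  have "((\<lambda>\<tau>. J 0 (inverse \<tau>)) \<longlongrightarrow> J 0 0) at_top"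
    unfolding J_def
  proof (rule integral_dominated_convergence_at_top[OF _ _ T_integrable])
    show "AE t in lborel. ((\<lambda>\<tau>. indicator {0<..} t * (t ^ 0 * exp (- (inverse \<tau> * t)) * T t)) \<longlongrightarrow>
            indicator {0<..} t * (t ^ 0 * exp (- (0 * t)) * T t)) at_top"
      by (intro AE_I2 tendsto_intros tendsto_inverse_0_at_top filterlim_ident)
    have "AE t in lborel. norm (indicator {0<..} t * (t ^ 0 * exp (- (inverse \<tau> * t)) * T t)) \<le> indicator {0<..} t * T t"
      if "0 < \<tau>" for \<tau> :: real
    proof (rule AE_I2)
      fix t :: real
      show "norm (indicator {0<..} t * (t ^ 0 * exp (- (inverse \<tau> * t)) * T t)) \<le> indicator {0<..} t * T t"
        using that pos[of t] by (auto simp: indicator_def)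
    qed
    then show "\<forall>\<^sub>F \<tau> in at_top. AE t in lborel.
        norm (indicator {0<..} t * (t ^ 0 * exp (- (inverse \<tau> * t)) * T t)) \<le> indicator {0<..} t * T t"
      using eventually_gt_at_top[of "0::real"] by (rule eventually_mono[rotated]) auto
  qed auto
  then show ?thesis by (simp add: filterlim_at_right_to_top)
qed

end

section \<open>A Tauberian theorem\<close>

lemma measure_pmf_nat_expectation:
  fixes p :: "nat pmf" and f :: "nat \<Rightarrow> real"
  assumes "\<And>n. \<bar>f n\<bar> \<le> B"
  shows "measure_pmf.expectation p f = (\<Sum>n. pmf p n * f n)"
    and "summable (\<lambda>n. pmf p n * f n)"
proof -
  have "integrable (measure_pmf p) f"
    by (rule measure_pmf.integrable_const_bound[of _ B]) (use assms in auto)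
  then have int: "integrable (count_space UNIV) (\<lambda>n. pmf p n * f n)"
    unfolding measure_pmf_eq_density by (subst (asm) integrable_density) auto
  then show "summable (\<lambda>n. pmf p n * f n)"
    by (simp add: integrable_count_space_nat_iff summable_norm_cancel)
  have "measure_pmf.expectation p f = (\<integral>n. pmf p n * f n \<partial>count_space UNIV)"
    unfolding measure_pmf_eq_density by (subst integral_density) auto
  also have "\<dots> = (\<Sum>n. pmf p n * f n)" by (rule integral_count_space_nat[OF int])
  finally show "measure_pmf.expectation p f = (\<Sum>n. pmf p n * f n)" .
qed

definition gamma_law :: "real \<Rightarrow> real measure" where
  "gamma_law g = density lborel (\<lambda>t. ennreal (indicator {0<..} t * (t powr (g - 1) * exp (- t)) / Gamma g))"

context regularly_varying_tail
begin

text \<open>Monotonicity compares \<open>T (f x)\<close> with \<open>T (y * g x)\<close> for fixed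
  \<open>y\<close> on either side of \<open>c\<close>, so the limits for constant factors
  suffice.\<close>

lemma ratio_general:
  fixes f g :: "'b \<Rightarrow> real"
  assumes g: "filterlim g at_top F" and fg: "((\<lambda>x. f x / g x) \<longlongrightarrow> c) F" and c: "0 < c"
  shows "((\<lambda>x. T (f x) / T (g x)) \<longlongrightarrow> c powr (- a)) F"
proof (rule order_tendstoI)
  have cont: "((\<lambda>y. y powr (- a)) \<longlongrightarrow> c powr (- a)) (at c)" using c by (intro tendsto_intros) auto
  have gpos: "\<forall>\<^sub>F x in F. 0 < g x" using g by (auto simp: filterlim_at_top_dense)
  fix l assume l: "l < c powr (- a)"
  have "\<forall>\<^sub>F y in at_right c. l < y powr (- a)"
    using cont by (intro order_tendstoD(1)[OF _ l]) (simp add: filterlim_at_split)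
  then have "\<forall>\<^sub>F y in at_right c. l < y powr (- a) \<and> c < y"
    by (rule eventually_conj) (auto simp: eventually_at_filter)
  then obtain y where y: "l < y powr (- a)" "c < y"
    using eventually_happens'[OF trivial_limit_at_right_real] by blast
  have "((\<lambda>x. T (y * g x) / T (g x)) \<longlongrightarrow> y powr (- a)) F"
    using filterlim_compose[OF ratio g] y c by simp
  then have "\<forall>\<^sub>F x in F. l < T (y * g x) / T (g x)" using y by (auto dest: order_tendstoD(1))
  moreover have "\<forall>\<^sub>F x in F. f x / g x < y" using fg y by (auto dest: order_tendstoD(2))
  ultimately show "\<forall>\<^sub>F x in F. l < T (f x) / T (g x)"
    using gpos
  proof eventually_elim
    case (elim x)
    then have "T (y * g x) / T (g x) \<le> T (f x) / T (g x)"
      using pos[of "g x"] by (intro divide_right_mono antimono) (auto simp: field_simps)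
    with elim show ?case by linarith
  qed
next
  have cont: "((\<lambda>y. y powr (- a)) \<longlongrightarrow> c powr (- a)) (at c)" using c by (intro tendsto_intros) auto
  have gpos: "\<forall>\<^sub>F x in F. 0 < g x" using g by (auto simp: filterlim_at_top_dense)
  fix l assume l: "c powr (- a) < l"
  have "\<forall>\<^sub>F y in at_left c. y powr (- a) < l"
    using cont by (intro order_tendstoD(2)[OF _ l]) (simp add: filterlim_at_split)
  then have "\<forall>\<^sub>F y in at_left c. y powr (- a) < l \<and> y \<in> {0<..<c}"
    by (rule eventually_conj) (use eventually_at_left_real[OF c] in auto)
  then obtain y where y: "y powr (- a) < l" "0 < y" "y < c"
    using eventually_happens'[OF trivial_limit_at_left_real] by auto
  have "((\<lambda>x. T (y * g x) / T (g x)) \<longlongrightarrow> y powr (- a)) F"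
    using filterlim_compose[OF ratio g] y c by simp
  then have "\<forall>\<^sub>F x in F. T (y * g x) / T (g x) < l" using y by (auto dest: order_tendstoD(2))
  moreover have "\<forall>\<^sub>F x in F. y < f x / g x" using fg y by (auto dest: order_tendstoD(1))
  ultimately show "\<forall>\<^sub>F x in F. T (f x) / T (g x) < l"
    using gpos
  proof eventually_elim
    case (elim x)
    then have "T (f x) / T (g x) \<le> T (y * g x) / T (g x)"
      using pos[of "g x"] by (intro divide_right_mono antimono) (auto simp: field_simps)
    with elim show ?case by linarith
  qed
qed

end

section \<open>The gamma law, the limit in Karamata's theorem\<close>

context
  fixes g :: real
  assumes g: "0 < g"
begin

lemma gamma_law_prob: "real_distribution (gamma_law g)"
proof -
  interpret prob_space "gamma_law g"
  proof
    have eq: "indicator {0..} t * t powr (g - 1) / exp t = indicator {0<..} t * (t powr (g - 1) * exp (- t))"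
      for t :: real by (auto simp: indicator_def exp_minus field_simps)
    have "emeasure (gamma_law g) (space (gamma_law g)) =
      (\<integral>\<^sup>+t. ennreal (indicator {0<..} t * (t powr (g - 1) * exp (- t)) / Gamma g) \<partial>lborel)"
      unfolding gamma_law_def by (simp add: emeasure_density)
    also have "\<dots> = (\<integral>\<^sup>+t. ennreal (indicator {0<..} t * (t powr (g - 1) * exp (- t))) / ennreal (Gamma g) \<partial>lborel)"
      using g by (intro nn_integral_cong divide_ennreal[symmetric]) (auto simp: Gamma_real_pos)
    also have "\<dots> = ennreal (Gamma g) / ennreal (Gamma g)"
      using Gamma_conv_nn_integral_real[OF g] unfolding eq by (subst nn_integral_divide) auto
    also have "\<dots> = 1" using Gamma_real_pos[OF g] by (intro ennreal_divide_self) auto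
    finally show "emeasure (gamma_law g) (space (gamma_law g)) = 1" .
  qed
  show ?thesis by unfold_locales (auto simp: gamma_law_def)
qed

lemma gamma_law_integral:
  fixes f :: "real \<Rightarrow> real"
  assumes [measurable]: "f \<in> borel_measurable borel"
  shows "integral\<^sup>L (gamma_law g) f =
    (\<integral>t. indicator {0<..} t * (t powr (g - 1) * exp (- t)) / Gamma g * f t \<partial>lborel)"
  unfolding gamma_law_def using g
  by (subst integral_density) (auto simp: Gamma_real_pos less_imp_le)

lemma gamma_law_laplace:
  "(\<integral>t. exp (- (real k * t)) \<partial>gamma_law g) = (1 + real k) powr (- g)"
proof -
  let ?c = "1 + real k"
  have "(\<integral>t. exp (- (real k * t)) \<partial>gamma_law g) =
      (\<integral>t. indicator {0<..} t * (t powr (g - 1) * exp (- t)) / Gamma g * exp (- (real k * t)) \<partial>lborel)"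
    by (rule gamma_law_integral) simp
  also have "(\<lambda>t. indicator {0<..} t * (t powr (g - 1) * exp (- t)) / Gamma g * exp (- (real k * t)))
      = (\<lambda>t. ?c powr (1 - g) / Gamma g * (indicator {0<..} (0 + ?c * t) * ((0 + ?c * t) powr (g - 1) * exp (- (0 + ?c * t)))))"
  proof
    fix t :: real
    show "indicator {0<..} t * (t powr (g - 1) * exp (- t)) / Gamma g * exp (- (real k * t))
      = ?c powr (1 - g) / Gamma g * (indicator {0<..} (0 + ?c * t) * ((0 + ?c * t) powr (g - 1) * exp (- (0 + ?c * t))))"
    proof (cases "0 < t")
      case True
      have "?c powr (1 - g) * ?c powr (g - 1) = 1" by (simp add: powr_add[symmetric])
      moreover have "exp (- (?c * t)) = exp (- t) * exp (- (real k * t))"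
        by (simp add: exp_add[symmetric] algebra_simps)
      ultimately show ?thesis using True by (simp add: powr_mult)
    qed (auto simp: indicator_def zero_less_mult_iff)
  qed
  also have "(\<integral>t. ?c powr (1 - g) / Gamma g * (indicator {0<..} (0 + ?c * t) * ((0 + ?c * t) powr (g - 1) * exp (- (0 + ?c * t)))) \<partial>lborel)
      = ?c powr (1 - g) / Gamma g * (\<integral>t. indicator {0<..} (0 + ?c * t) * ((0 + ?c * t) powr (g - 1) * exp (- (0 + ?c * t))) \<partial>lborel)"
    by (rule integral_mult_right_zero)
  also have "(\<integral>t. indicator {0<..} (0 + ?c * t) * ((0 + ?c * t) powr (g - 1) * exp (- (0 + ?c * t))) \<partial>lborel) = Gamma g / ?c"
    using lborel_integral_real_affine[of ?c "\<lambda>t. indicator {0<..} t * (t powr (g - 1) * exp (- t))" 0] Gamma_integrable(2)[of "g - 1"] g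
    by (simp add: field_simps)
  also have "?c powr (1 - g) / Gamma g * (Gamma g / ?c) = ?c powr (- g)"
  proof -
    have "Gamma g \<noteq> 0" using Gamma_real_pos[OF g] by simp
    moreover have "?c powr (1 - g) = ?c * ?c powr (- g)" by (simp add: powr_diff powr_minus divide_inverse)
    ultimately show ?thesis by simp
  qed
  finally show ?thesis .
qed

text \<open>The factor \<open>exp t\<close> cancels against the density and a power of
  \<open>t\<close> is left. For \<open>g = m + 1 - a\<close> the value is
  \<open>(1 - 2 powr (1 - a)) / ((a - 1) * Gamma g)\<close>, the constant of a dyadic block.\<close>

lemma gamma_law_interval:
  fixes m :: nat
  assumes "real m + 1 - g > 1"
  shows "(\<integral>t. indicator {1<..2} t * (exp t / t ^ m) \<partial>gamma_law g) =
      (1 - 2 powr (g - real m)) / ((real m - g) * Gamma g)"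
proof -
  let ?F = "\<lambda>t. t powr (g - real m) / (g - real m)"
  have "(\<integral>t. indicator {1<..2} t * (exp t / t ^ m) \<partial>gamma_law g) =
      (\<integral>t. indicator {0<..} t * (t powr (g - 1) * exp (- t)) / Gamma g * (indicator {1<..2} t * (exp t / t ^ m)) \<partial>lborel)"
    by (rule gamma_law_integral) simp
  also have "\<dots> = (\<integral>t. inverse (Gamma g) * (t powr (g - 1 - real m) * indicator {1..2} t) \<partial>lborel)"
  proof (rule integral_cong_AE)
    have "AE t in lborel. t \<noteq> (1::real)" by (rule AE_lborel_singleton)
    then show "AE t in lborel. indicator {0<..} t * (t powr (g - 1) * exp (- t)) / Gamma g * (indicator {1<..2} t * (exp t / t ^ m))
       = inverse (Gamma g) * (t powr (g - 1 - real m) * indicator {1..2} t)"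
      by eventually_elim (auto simp: indicator_def powr_diff powr_realpow powr_add exp_minus field_simps)
  qed auto
  also have "\<dots> = inverse (Gamma g) * (\<integral>t. t powr (g - 1 - real m) * indicator {1..2} t \<partial>lborel)"
    by (rule integral_mult_right_zero)
  also have "(\<integral>t. t powr (g - 1 - real m) * indicator {1..2} t \<partial>lborel) = ?F 2 - ?F 1"
  proof (rule integral_FTC_Icc_nonneg)
    fix t :: real assume "t \<in> {1..2}"
    then have t: "1 \<le> t" "t \<le> 2" by auto
    have "(?F has_real_derivative t powr (g - real m - 1)) (at t)"
      using t assms by (auto intro!: derivative_eq_intros)
    moreover have "g - real m - 1 = g - 1 - real m" by simp
    ultimately show "DERIV ?F t :> t powr (g - 1 - real m)" by simp

  qed auto
  also have "?F 2 - ?F 1 = (1 - 2 powr (g - real m)) / (real m - g)"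
    using assms by (simp add: divide_simps) (simp add: algebra_simps)
  also have "inverse (Gamma g) * ((1 - 2 powr (g - real m)) / (real m - g)) = (1 - 2 powr (g - real m)) / ((real m - g) * Gamma g)"
    by (simp only: divide_inverse inverse_mult_distrib mult_ac)
  finally show ?thesis .
qed

end

text \<open>Under \<open>u = exp (- t)\<close> the half-line is mapped into \<open>{0..1}\<close>,
  and the transforms at integers become moments of \<open>u\<close>. A continuous step function
  turns into a continuous function on \<open>{0..1}\<close>, which Weierstrass approximates
  uniformly by polynomials in \<open>u\<close>, that is by combinations of
  \<open>exp (- (k * t))\<close>.\<close>

lemma weak_conv_from_laplace:
  fixes \<mu> :: "nat \<Rightarrow> real measure"
  assumes "\<And>n. real_distribution (\<mu> n)" "real_distribution M"
    and supp: "\<And>n. AE t in \<mu> n. 0 \<le> t" "AE t in M. 0 \<le> t"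
    and conv: "\<And>k::nat. (\<lambda>n. \<integral>t. exp (- (real k * t)) \<partial>\<mu> n) \<longlonglongrightarrow> (\<integral>t. exp (- (real k * t)) \<partial>M)"
  shows "weak_conv_m \<mu> M"
proof -
  interpret \<mu>: real_distribution "\<mu> n" for n by fact
  interpret M: real_distribution M by fact
  show ?thesis
  proof (rule integral_cts_step_conv_imp_weak_conv[OF assms(1,2)])
    fix x y :: real assume xy: "x < y"
    \<comment> \<open>The extension by 0 is continuous: for small \<open>u > 0\<close> the argument
      \<open>- ln u\<close> exceeds \<open>y\<close>, where the step function already
      vanishes.\<close>
    define \<phi> where "\<phi> u = (if u \<le> 0 then 0 else cts_step x y (- ln u))" for u
    have cont_step: "continuous_on UNIV (cts_step x y)"
      using cts_step_uniformly_continuous[OF xy] by (rule uniformly_continuous_imp_continuous)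
    have "isCont \<phi> u" for u
    proof -
      consider "0 < u" | "u < exp (- y)" using exp_gt_zero[of "- y"] by linarith
      then show ?thesis
      proof cases
        case 1
        have "isCont (cts_step x y) v" for v
          using cont_step by (simp add: continuous_on_eq_continuous_at)
        moreover have "isCont (\<lambda>u. - ln u) u" using 1 by (intro continuous_intros) auto
        ultimately have c: "isCont (\<lambda>u. cts_step x y (- ln u)) u"
          by (intro isCont_o2[where f = "\<lambda>u. - ln u" and g = "cts_step x y"])
        have "\<forall>\<^sub>F v in nhds u. \<phi> v = cts_step x y (- ln v)"
          by (rule eventually_mono[OF eventually_nhds_in_open[of "{0<..}" u]]) (use 1 in \<open>auto simp: \<phi>_def\<close>)
        from isCont_cong[OF this] c show ?thesis by blast
      next
        case 2
        have "\<phi> v = 0" if "v < exp (- y)" for v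
        proof (cases "v \<le> 0")
          case False
          then have "ln v < ln (exp (- y))" using that by (subst ln_less_cancel_iff) auto
          then have "ln v < - y" by simp
          then show ?thesis using xy by (simp add: \<phi>_def cts_step_def)
        qed (simp add: \<phi>_def)
        then have "\<forall>\<^sub>F v in nhds u. \<phi> v = 0"
          by (intro eventually_mono[OF eventually_nhds_in_open[of "{..<exp (- y)}" u]]) (use 2 in auto)
        from isCont_cong[OF this] show ?thesis by simp
      qed
    qed
    then have cont: "continuous_on {0..1} \<phi>" by (simp add: continuous_at_imp_continuous_on)
    have step: "cts_step x y t = \<phi> (exp (- t))" for t by (simp add: \<phi>_def)
    show "(\<lambda>n. integral\<^sup>L (\<mu> n) (cts_step x y)) \<longlonglongrightarrow> integral\<^sup>L M (cts_step x y)"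
    proof (rule LIMSEQ_I)
      fix \<epsilon> :: real assume eps: "0 < \<epsilon>"
      obtain Q where Q: "real_polynomial_function Q" "\<And>u. u \<in> {0..1} \<Longrightarrow> \<bar>\<phi> u - Q u\<bar> < \<epsilon> / 3"
        using Stone_Weierstrass_real_polynomial_function[OF _ cont, of "\<epsilon> / 3"] eps by auto
      obtain c d where cd: "Q = (\<lambda>u. \<Sum>i\<le>d. c i * u ^ i)"
        using Q(1) by (auto simp: real_polynomial_function_iff_sum)
      have Qe: "Q (exp (- t)) = (\<Sum>i\<le>d. c i * exp (- (real i * t)))" for t :: real
        by (simp add: cd exp_of_nat_mult[symmetric])
      have int: "integrable N (\<lambda>t. exp (- (real i * t)))"
        if "real_distribution N" "AE t in N. 0 \<le> t" for N i
      proof -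
        interpret N: real_distribution N by fact
        show ?thesis
          by (rule N.integrable_const_bound[of _ 1]) (use that(2) in \<open>auto elim!: eventually_mono\<close>)
      qed
      have close: "\<bar>integral\<^sup>L N (cts_step x y) - (\<Sum>i\<le>d. c i * (\<integral>t. exp (- (real i * t)) \<partial>N))\<bar> \<le> \<epsilon> / 3"
        if N: "real_distribution N" "AE t in N. 0 \<le> t" for N
      proof -
        interpret N: real_distribution N by fact
        have intQ: "integrable N (\<lambda>t. \<Sum>i\<le>d. c i * exp (- (real i * t)))"
          using int[OF N] by (intro Bochner_Integration.integrable_sum integrable_mult_right)
        have "(\<Sum>i\<le>d. c i * (\<integral>t. exp (- (real i * t)) \<partial>N)) = (\<integral>t. (\<Sum>i\<le>d. c i * exp (- (real i * t))) \<partial>N)"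
          using int[OF N] by (subst Bochner_Integration.integral_sum) auto
        then have "\<bar>integral\<^sup>L N (cts_step x y) - (\<Sum>i\<le>d. c i * (\<integral>t. exp (- (real i * t)) \<partial>N))\<bar>
            = \<bar>\<integral>t. cts_step x y t - (\<Sum>i\<le>d. c i * exp (- (real i * t))) \<partial>N\<bar>"
          using N.integrable_cts_step[OF xy] intQ by simp
        also have "\<dots> \<le> (\<integral>t. \<bar>cts_step x y t - (\<Sum>i\<le>d. c i * exp (- (real i * t)))\<bar> \<partial>N)"
          by (rule integral_abs_bound)
        also have "\<dots> \<le> (\<integral>t. \<epsilon> / 3 \<partial>N)"
        proof (rule integral_mono_AE)
          show "AE t in N. \<bar>cts_step x y t - (\<Sum>i\<le>d. c i * exp (- (real i * t)))\<bar> \<le> \<epsilon> / 3"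
            using N(2)
          proof eventually_elim
            case (elim t)
            then have "exp (- t) \<in> {0..1}" by simp
            then show ?case using Q(2)[of "exp (- t)"] by (simp add: step Qe)
          qed
        qed (use N.integrable_cts_step[OF xy] intQ in auto)
        also have "\<dots> = \<epsilon> / 3" using N.prob_space by simp
        finally show ?thesis .
      qed
      define I where "I N = (\<Sum>i\<le>d. c i * (\<integral>t. exp (- (real i * t)) \<partial>N))" for N
      have lim: "(\<lambda>n. I (\<mu> n)) \<longlonglongrightarrow> I M"
        unfolding I_def by (intro tendsto_intros conv)
      have "0 < \<epsilon> / 3" using eps by simp
      from LIMSEQ_D[OF lim this] obtain n0 where n0: "\<forall>n\<ge>n0. norm (I (\<mu> n) - I M) < \<epsilon> / 3" by blast
      show "\<exists>n0. \<forall>n\<ge>n0. norm (integral\<^sup>L (\<mu> n) (cts_step x y) - integral\<^sup>L M (cts_step x y)) < \<epsilon>"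
      proof (intro exI[of _ n0] allI impI)
        fix n assume "n0 \<le> n"
        then show "norm (integral\<^sup>L (\<mu> n) (cts_step x y) - integral\<^sup>L M (cts_step x y)) < \<epsilon>"
          using n0[rule_format, of n] close[OF \<mu>.real_distribution_axioms supp(1), of n] close[OF M.real_distribution_axioms supp(2)]
          unfolding real_norm_def I_def[symmetric] by linarith
      qed
    qed
  qed
qed

lemma diffs_funpow: "(diffs ^^ m) c n = pochhammer (of_nat (Suc n)) m * c (n + m)"
  for c :: "nat \<Rightarrow> real"
proof (induction m arbitrary: n)
  case (Suc m)
  have "(diffs ^^ Suc m) c n = of_nat (Suc n) * (diffs ^^ m) c (Suc n)" by (simp add: diffs_def)
  then show ?case by (simp add: Suc pochhammer_rec mult_ac add_ac)
qed simp

lemma summable_diffs_funpow_pmf: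
  fixes p :: "nat pmf" and z :: real
  assumes "\<bar>z\<bar> < 1"
  shows "summable (\<lambda>n. (diffs ^^ k) (pmf p) n * z ^ n)"
  using assms
proof (induction k arbitrary: z)
  case 0
  have "\<bar>z ^ n\<bar> \<le> 1" for n using 0 by (simp add: power_abs power_le_one)
  then show ?case using measure_pmf_nat_expectation(2)[of "\<lambda>n. z ^ n" 1 p] by simp
next
  case (Suc k)
  have "summable (\<lambda>n. diffs ((diffs ^^ k) (pmf p)) n * z ^ n)"
    by (rule termdiff_converges[where K = 1]) (use Suc in auto)
  then show ?case by simp
qed

section \<open>Karamata's theorem on dyadic blocks and recovery of the tail\<close>

context regularly_varying_tail
begin

text \<open>Tilt the coefficients to weights proportional to \<open>u n * exp (- n / N)\<close> and
  rescale \<open>n\<close> by \<open>N\<close>. The Laplace transform of the resulting law at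
  \<open>k\<close> is a ratio of two values of the power series and tends to
  \<open>(1 + k) powr (- \<gamma>)\<close>, the transform of the gamma law of shape
  \<open>m + 1 - a\<close>. A test function supported on \<open>(1, 2]\<close> then singles out the
  block and removes the tilt.\<close>

lemma karamata_blocks:
  fixes u :: "nat \<Rightarrow> real" and m :: nat
  assumes nonneg: "\<And>n. 0 \<le> u n"
    and summ: "\<And>z. 0 \<le> z \<Longrightarrow> z < 1 \<Longrightarrow> summable (\<lambda>n. u n * z ^ n)"
    and m: "a - 1 < real m"
    and lim: "((\<lambda>v. (\<Sum>n. u n * (1 - v) ^ n) * v ^ (m + 1) / T (1 / v)) \<longlongrightarrow> K) (at_right 0)"
    and K: "0 < K"
  shows "(\<lambda>N. (\<Sum>n\<in>{N<..2*N}. u n * (real N / real n) ^ m) / (real N ^ (m + 1) * T (real N)))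
           \<longlonglongrightarrow> K * ((1 - 2 powr (1 - a)) / ((a - 1) * Gamma (real m + 1 - a)))"
proof -
  define U where "U z = (\<Sum>n. u n * z ^ n)" for z
  define \<gamma> where "\<gamma> = real m + 1 - a"
  have \<gamma>: "0 < \<gamma>" using m by (simp add: \<gamma>_def)
  \<comment> \<open>The successor keeps the scale positive; the shift is undone in the last
    step.\<close>
  define x where "x N = real (Suc N)" for N
  have x: "0 < x N" for N by (simp add: x_def)
  have xlim: "filterlim x at_top sequentially"
    unfolding x_def by (rule filterlim_compose[OF filterlim_real_sequentially filterlim_Suc])
  have "\<exists>i. 0 < u i"
  proof (rule ccontr)
    assume "\<nexists>i. 0 < u i"
    then have "u i = 0" for i using nonneg[of i] by (metis less_le)
    then show False using lim K by (simp add: tendsto_const_iff)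
  qed
  then obtain i where i: "0 < u i" ..
  have Upos: "0 < U z" if "0 < z" "z < 1" for z
    unfolding U_def using that i nonneg by (intro suminf_pos2[of _ i] summ) auto
  \<comment> \<open>For \<open>v = 1 - exp (- k / x)\<close>, asymptotic to \<open>k / x\<close>,
    the hypothesis contributes \<open>(x / k) ^ (m + 1)\<close> and the ratio of
    \<open>T (1 / v)\<close> to \<open>T x\<close> contributes \<open>k powr a\<close>; the
    exponents of \<open>k\<close> add up to \<open>- \<gamma>\<close>.\<close>
  have lap: "(\<lambda>N. U (exp (- (real k / x N))) / (x N ^ (m + 1) * T (x N))) \<longlonglongrightarrow> K * real k powr (- \<gamma>)"
    if k: "0 < k" for k :: nat
  proof -
    define v where "v N = 1 - exp (- (real k / x N))" for N
    have kx: "(\<lambda>N. real k / x N) \<longlonglongrightarrow> 0"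
      by (intro tendsto_divide_0[OF tendsto_const] filterlim_at_top_imp_at_infinity xlim)
    have vpos: "0 < v N" for N using k x[of N] by (simp add: v_def)
    have "v \<longlonglongrightarrow> 1 - exp (- 0)" unfolding v_def by (intro tendsto_intros kx)
    then have v0: "filterlim v (at_right 0) sequentially"
      using vpos less_imp_neq[OF vpos, symmetric] by (simp add: filterlim_at)
    have "((\<lambda>h. (exp (0 + h) - exp 0) / h) \<longlongrightarrow> exp (0::real)) (at 0)"
      using DERIV_exp[of "0::real"] by (simp add: DERIV_def)
    moreover have "filterlim (\<lambda>N. - (real k / x N)) (at 0) sequentially"
      using tendsto_minus[OF kx] k x by (auto simp: filterlim_at intro!: always_eventually) (metis less_irrefl)
    ultimately have "(\<lambda>N. (exp (0 + - (real k / x N)) - exp 0) / - (real k / x N)) \<longlonglongrightarrow> exp 0"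
      by (rule filterlim_compose)
    then have "(\<lambda>N. (exp (0 + - (real k / x N)) - exp 0) / - (real k / x N) * real k) \<longlonglongrightarrow> exp 0 * real k"
      by (intro tendsto_intros)
    moreover have "(exp (0 + - (real k / x N)) - exp 0) / - (real k / x N) * real k = v N * x N" for N
      using k x[of N] by (simp add: v_def field_simps)
    ultimately have vx: "(\<lambda>N. v N * x N) \<longlonglongrightarrow> real k" by simp
    have "(\<lambda>N. 1 / v N / x N) \<longlonglongrightarrow> 1 / real k"
      using tendsto_divide[OF tendsto_const[of 1] vx] k by (simp add: divide_divide_eq_left)
    then have Tr: "(\<lambda>N. T (1 / v N) / T (x N)) \<longlonglongrightarrow> (1 / real k) powr (- a)"
      by (rule ratio_general[OF xlim]) (use k in simp)
    have L: "(\<lambda>N. U (1 - v N) * v N ^ (m + 1) / T (1 / v N) * (T (1 / v N) / T (x N)) * (1 / (v N * x N) ^ (m + 1)))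
        \<longlonglongrightarrow> K * (1 / real k) powr (- a) * (1 / real k ^ (m + 1))"
      using filterlim_compose[OF lim v0] k by (intro tendsto_intros Tr vx) (auto simp: U_def)
    have E: "U (1 - v N) * v N ^ (m + 1) / T (1 / v N) * (T (1 / v N) / T (x N)) * (1 / (v N * x N) ^ (m + 1))
        = U (exp (- (real k / x N))) / (x N ^ (m + 1) * T (x N))" for N
    proof -
      have "1 - v N = exp (- (real k / x N))" by (simp add: v_def)
      then show ?thesis using vpos[of N] x[of N] pos[of "x N"] pos[of "1 / v N"]
        by (simp add: power_mult_distrib divide_simps)
    qed
    have P: "(1 / real k) powr (- a) * (1 / real k ^ (m + 1)) = real k powr (- \<gamma>)"
    proof -
      have "(1 / real k) powr (- a) = real k powr a" using k by (simp add: powr_divide powr_minus)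
      moreover have "1 / real k ^ (m + 1) = real k powr (- real (m + 1))"
        using k by (simp only: powr_minus powr_realpow of_nat_0_less_iff inverse_eq_divide)
      moreover have "a + - real (m + 1) = - \<gamma>" by (simp add: \<gamma>_def)
      ultimately show ?thesis by (simp only: powr_add[symmetric])
    qed
    have "K * (1 / real k) powr (- a) * (1 / real k ^ (m + 1)) = K * real k powr (- \<gamma>)"
      by (simp only: mult.assoc P)
    with L[unfolded E] show ?thesis by (simp only:)
  qed
  define w where "w N n = u n * exp (- (1 / x N)) ^ n / U (exp (- (1 / x N)))" for N n
  have w0: "0 \<le> w N n" for N n
    unfolding w_def using nonneg Upos[of "exp (- (1 / x N))"] x[of N] by (intro divide_nonneg_pos) auto
  have summ1: "summable (\<lambda>n. u n * exp (- (1 / x N)) ^ n)" for N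
    using x[of N] by (intro summ) auto
  have wsums: "(w N) sums 1" for N
  proof -
    have "w N sums (U (exp (- (1 / x N))) / U (exp (- (1 / x N))))"
      unfolding w_def using summ1[of N] unfolding U_def by (intro sums_divide summable_sums)
    then show ?thesis using Upos[of "exp (- (1 / x N))"] x[of N] by simp
  qed
  define p where "p N = embed_pmf (w N)" for N
  have p: "pmf (p N) n = w N n" for N n
    unfolding p_def
  proof (rule pmf_embed_pmf)
    show "(\<integral>\<^sup>+ n. ennreal (w N n) \<partial>count_space UNIV) = 1"
      using wsums[of N] w0 by (simp add: nn_integral_count_space_nat suminf_ennreal2 sums_iff)
  qed (use w0 in auto)
  define \<mu> where "\<mu> N = distr (measure_pmf (p N)) borel (\<lambda>n. real n / x N)" for N
  have \<mu>: "real_distribution (\<mu> N)" for N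
    unfolding \<mu>_def by (rule prob_space.real_distribution_distr[OF prob_space_measure_pmf]) simp
  have \<mu>_int: "integral\<^sup>L (\<mu> N) f = (\<Sum>n. w N n * f (real n / x N))"
    if [measurable]: "f \<in> borel_measurable borel" and "\<And>t. 0 \<le> t \<Longrightarrow> \<bar>f t\<bar> \<le> C" for f N C
  proof -
    have "integral\<^sup>L (\<mu> N) f = measure_pmf.expectation (p N) (\<lambda>n. f (real n / x N))"
      unfolding \<mu>_def by (subst integral_distr) auto
    also have "\<dots> = (\<Sum>n. pmf (p N) n * f (real n / x N))"
      by (rule measure_pmf_nat_expectation(1)[of _ C]) (use that(2) less_imp_le[OF x] in simp)
    finally show ?thesis by (simp add: p)
  qed
  have weak: "weak_conv_m \<mu> (gamma_law \<gamma>)"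
  proof (rule weak_conv_from_laplace[OF \<mu> gamma_law_prob[OF \<gamma>]])
    show "AE t in \<mu> N. 0 \<le> t" for N
      unfolding \<mu>_def using less_imp_le[OF x] by (subst AE_distr_iff) auto
    show "AE t in gamma_law \<gamma>. 0 \<le> t"
      unfolding gamma_law_def by (subst AE_density) (auto simp: indicator_def)
    fix k :: nat
    have "(\<integral>t. exp (- (real k * t)) \<partial>\<mu> N) =
        (U (exp (- (real (Suc k) / x N))) / (x N ^ (m + 1) * T (x N))) / (U (exp (- (real 1 / x N))) / (x N ^ (m + 1) * T (x N)))"
      for N
    proof -
      have "(\<integral>t. exp (- (real k * t)) \<partial>\<mu> N) = (\<Sum>n. w N n * exp (- (real k * (real n / x N))))"
        by (rule \<mu>_int[of _ 1]) auto
      also have "w N n * exp (- (real k * (real n / x N))) =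
          u n * exp (- (real (Suc k) / x N)) ^ n / U (exp (- (1 / x N)))" for n
      proof -
        have "exp (- (real (Suc k) / x N)) ^ n = exp (- (1 / x N)) ^ n * exp (- (real k * (real n / x N)))"
          using x[of N] by (simp add: exp_of_nat_mult[symmetric] exp_add[symmetric] field_simps)
        then show ?thesis by (simp add: w_def)
      qed
      then have "(\<Sum>n. w N n * exp (- (real k * (real n / x N)))) =
         (\<Sum>n. u n * exp (- (real (Suc k) / x N)) ^ n / U (exp (- (1 / x N))))" by simp
      also have "\<dots> = U (exp (- (real (Suc k) / x N))) / U (exp (- (1 / x N)))"
      proof -
        have "summable (\<lambda>n. u n * exp (- (real (Suc k) / x N)) ^ n)"
          using x[of N] by (intro summ) auto
        from suminf_divide[OF this] show ?thesis unfolding U_def by simp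
      qed
      also have "\<dots> = (U (exp (- (real (Suc k) / x N))) / (x N ^ (m + 1) * T (x N))) / (U (exp (- (real 1 / x N))) / (x N ^ (m + 1) * T (x N)))"
        using x[of N] pos[of "x N"] by simp
      finally show ?thesis .
    qed
    moreover have "(\<lambda>N. (U (exp (- (real (Suc k) / x N))) / (x N ^ (m + 1) * T (x N))) / (U (exp (- (real 1 / x N))) / (x N ^ (m + 1) * T (x N))))
        \<longlonglongrightarrow> (K * real (Suc k) powr (- \<gamma>)) / (K * real 1 powr (- \<gamma>))"
      by (intro tendsto_divide lap) (use K in auto)
    ultimately show "(\<lambda>N. \<integral>t. exp (- (real k * t)) \<partial>\<mu> N) \<longlonglongrightarrow> (\<integral>t. exp (- (real k * t)) \<partial>gamma_law \<gamma>)"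
      using K by (simp add: gamma_law_laplace[OF \<gamma>])
  qed
  \<comment> \<open>\<open>exp t\<close> cancels the tilt exactly, and \<open>1 / t ^ m\<close>
    becomes the factor \<open>(N / n) ^ m\<close> of the claim.\<close>
  define f :: "real \<Rightarrow> real" where "f t = indicator {1<..2} t * (exp t / t ^ m)" for t
  have f_meas: "f \<in> borel_measurable borel" unfolding f_def by measurable
  have f_bound: "\<bar>f t\<bar> \<le> exp 2" for t
  proof (cases "t \<in> {1<..2}")
    case True
    then have "exp t / t ^ m \<le> exp 2 / 1" by (intro frac_le) auto
    then show ?thesis using True by (simp add: f_def)
  qed (simp add: f_def)
  \<comment> \<open>The only possible jumps are at 1 and 2, which the gamma law does not charge, so
    weak convergence extends to \<open>f\<close>.\<close>
  have f_cont: "{t. \<not> isCont f t} \<subseteq> {1, 2}"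
  proof (rule subsetI, rule ccontr)
    fix t assume "t \<in> {t. \<not> isCont f t}" "t \<notin> {1, 2}"
    then have "\<not> isCont f t" "t \<noteq> 1" "t \<noteq> 2" by auto
    consider "t < 1" | "1 < t" "t < 2" | "2 < t" using \<open>t \<noteq> 1\<close> \<open>t \<noteq> 2\<close> by linarith
    then have "isCont f t"
    proof cases
      case 1
      have "\<forall>\<^sub>F s in nhds t. f s = 0"
        by (rule eventually_mono[OF eventually_nhds_in_open[of "{..<1}" t]]) (use 1 in \<open>auto simp: f_def\<close>)
      from isCont_cong[OF this] show ?thesis by simp
    next
      case 2
      have "\<forall>\<^sub>F s in nhds t. f s = exp s / s ^ m"
        by (rule eventually_mono[OF eventually_nhds_in_open[of "{1<..<2}" t]]) (use 2 in \<open>auto simp: f_def\<close>)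
      moreover have "isCont (\<lambda>s. exp s / s ^ m) t" using 2 by (intro continuous_intros) auto
      ultimately show ?thesis using isCont_cong[of f "\<lambda>s. exp s / s ^ m" t] by simp
    next
      case 3
      have "\<forall>\<^sub>F s in nhds t. f s = 0"
        by (rule eventually_mono[OF eventually_nhds_in_open[of "{2<..}" t]]) (use 3 in \<open>auto simp: f_def\<close>)
      from isCont_cong[OF this] show ?thesis by simp
    qed
    with \<open>\<not> isCont f t\<close> show False by simp
  qed
  have "emeasure (gamma_law \<gamma>) {t. \<not> isCont f t} = 0"
  proof (rule emeasure_eq_0[OF _ _ f_cont])
    show "emeasure (gamma_law \<gamma>) {1, 2} = 0"
    proof -
      have "{1, 2::real} \<in> null_sets lborel" by (intro finite_imp_null_set_lborel) auto
      then have ae: "AE t in lborel. t \<notin> {1, 2::real}" by (rule AE_not_in)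
      have "AE t in lborel. t \<in> {1, 2} \<longrightarrow> ennreal (indicator {0<..} t * (t powr (\<gamma> - 1) * exp (- t)) / Gamma \<gamma>) = 0"
        by (rule eventually_mono[OF ae]) blast
      then have "{1, 2} \<in> null_sets (gamma_law \<gamma>)"
        unfolding gamma_law_def by (subst null_sets_density_iff) simp_all
      then show ?thesis by auto
    qed
  qed (auto simp: gamma_law_def)
  from weak_conv_imp_bdd_ae_continuous_conv[OF \<mu> gamma_law_prob[OF \<gamma>] weak this _ f_meas, of "exp 2"] f_bound
  have "(\<lambda>N. integral\<^sup>L (\<mu> N) f) \<longlonglongrightarrow> integral\<^sup>L (gamma_law \<gamma>) f" by simp
  moreover have "integral\<^sup>L (gamma_law \<gamma>) f = (1 - 2 powr (1 - a)) / ((a - 1) * Gamma \<gamma>)"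
    using gamma_law_interval[OF \<gamma>, of m] a_gt_1 by (simp add: f_def[abs_def] \<gamma>_def)
  ultimately have "(\<lambda>N. U (exp (- (real 1 / x N))) / (x N ^ (m + 1) * T (x N)) * integral\<^sup>L (\<mu> N) f)
      \<longlonglongrightarrow> K * real 1 powr (- \<gamma>) * ((1 - 2 powr (1 - a)) / ((a - 1) * Gamma \<gamma>))"
    by (intro tendsto_mult lap) auto
  moreover have "U (exp (- (real 1 / x N))) / (x N ^ (m + 1) * T (x N)) * integral\<^sup>L (\<mu> N) f
      = (\<Sum>n\<in>{Suc N<..2*Suc N}. u n * (real (Suc N) / real n) ^ m) / (real (Suc N) ^ (m + 1) * T (real (Suc N)))" for N
  proof -
    let ?U = "U (exp (- (1 / x N)))"
    have "integral\<^sup>L (\<mu> N) f = (\<Sum>n. w N n * f (real n / x N))"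
      by (rule \<mu>_int[OF f_meas f_bound])
    also have "\<dots> = (\<Sum>n\<in>{Suc N<..2*Suc N}. w N n * f (real n / x N))"
    proof (rule suminf_finite)
      fix n assume "n \<notin> {Suc N<..2*Suc N}"
      then have "real n / x N \<notin> {1<..2}" using x[of N] by (auto simp: field_simps x_def)
      then show "w N n * f (real n / x N) = 0" by (simp add: f_def)
    qed simp
    also have "\<dots> = (\<Sum>n\<in>{Suc N<..2*Suc N}. u n * (real (Suc N) / real n) ^ m / ?U)"
    proof (rule sum.cong)
      fix n assume n: "n \<in> {Suc N<..2*Suc N}"
      then have "real n / x N \<in> {1<..2}" using x[of N] by (auto simp: field_simps x_def)
      then have "f (real n / x N) = exp (real n / x N) / (real n / x N) ^ m" by (simp add: f_def)
      moreover have "exp (- (1 / x N)) ^ n * exp (real n / x N) = 1"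
        by (simp add: exp_of_nat_mult[symmetric] exp_add[symmetric])
      ultimately have "w N n * f (real n / x N) = u n * (1 / (real n / x N) ^ m) / ?U"
        by (simp add: w_def mult.assoc)
      then show "w N n * f (real n / x N) = u n * (real (Suc N) / real n) ^ m / ?U"
        by (simp add: power_divide x_def)
    qed simp
    also have "\<dots> = (\<Sum>n\<in>{Suc N<..2*Suc N}. u n * (real (Suc N) / real n) ^ m) / ?U"
      by (simp only: sum_divide_distrib)
    finally show ?thesis using Upos[of "exp (- (1 / x N))"] x[of N] unfolding x_def by simp
  qed
  ultimately have "(\<lambda>N. (\<Sum>n\<in>{Suc N<..2*Suc N}. u n * (real (Suc N) / real n) ^ m) / (real (Suc N) ^ (m + 1) * T (real (Suc N))))
      \<longlonglongrightarrow> K * ((1 - 2 powr (1 - a)) / ((a - 1) * Gamma \<gamma>))" by simp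
  then show ?thesis
    unfolding \<gamma>_def
    by (rule LIMSEQ_imp_Suc[where f = "\<lambda>N. (\<Sum>n\<in>{N<..2*N}. u n * (real N / real n) ^ m) / (real N ^ (m + 1) * T (real N))"])
qed

text \<open>A Stolz-Cesaro argument along \<open>N, 2 * N, 4 * N, ...\<close>: for
  \<open>e N = N * T N\<close> the ratio \<open>e (2 * N) / e N\<close> tends to
  \<open>2 powr (1 - a) < 1\<close>, so the blocks of \<open>S\<close> are asymptotic to
  \<open>d\<close> times the blocks of \<open>e\<close>. From some index on the error is at most
  \<open>\<epsilon>\<close> times the block of \<open>e\<close>, so it telescopes too, and
  \<open>S\<close> and \<open>e\<close> vanish at infinity.\<close>

lemma dyadic_telescope:
  assumes S: "S \<longlonglongrightarrow> (0::real)"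
    and block: "(\<lambda>N. (S N - S (2 * N)) / (real N * T (real N))) \<longlonglongrightarrow> d * (1 - 2 powr (1 - a))"
  shows "(\<lambda>N. S N / (real N * T (real N))) \<longlonglongrightarrow> d"
proof -
  define e where "e N = real N * T (real N)" for N :: nat
  have epos: "0 < e N" if "0 < N" for N using that pos by (simp add: e_def)
  have lim2: "filterlim (\<lambda>i. 2 ^ i * N :: nat) at_top sequentially" if "0 < N" for N :: nat
  proof (rule filterlim_subseq)
    show "strict_mono (\<lambda>i. 2 ^ i * N :: nat)" using that by (intro strict_mono_Suc_iff[THEN iffD2]) auto
  qed
  have e0: "e \<longlonglongrightarrow> 0"
  proof -
    \<comment> \<open>An exponent strictly between 1 and \<open>a\<close> makes
      \<open>N * N powr (- b)\<close> tend to 0.\<close>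
    define b where "b = (1 + a) / 2"
    have b: "0 < b" "b < a" "1 - b < 0" using a_gt_1 by (auto simp: b_def)
    obtain C t0 where C: "0 < C" "0 < t0" "\<And>t x. t0 \<le> t \<Longrightarrow> 1 \<le> x \<Longrightarrow> T (x * t) \<le> C * x powr (- b) * T t"
      using potter_upper[OF b(1,2)] by blast
    define D where "D = C * t0 powr b * T t0"
    have "\<forall>\<^sub>F N in sequentially. norm (e N) \<le> D * real N powr (1 - b)"
      using filterlim_real_sequentially[unfolded filterlim_at_top, rule_format, of t0]
    proof eventually_elim
      case (elim N)
      have N: "0 < real N" using elim C by linarith
      have "T (real N / t0 * t0) \<le> C * (real N / t0) powr (- b) * T t0"
        using elim C by (intro C(3)) auto
      then have "T (real N) \<le> D * real N powr (- b)"
        using C N by (simp add: D_def powr_divide powr_minus field_simps)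
      then have "real N * T (real N) \<le> real N * (D * real N powr (- b))" using N by (intro mult_left_mono) auto
      also have "\<dots> = D * real N powr (1 - b)" using N by (simp add: powr_diff powr_minus field_simps)
      finally show ?case using N pos[of "real N"] by (simp add: e_def)
    qed
    moreover have "(\<lambda>N. D * real N powr (1 - b)) \<longlonglongrightarrow> D * 0"
      by (intro tendsto_intros tendsto_neg_powr b filterlim_real_sequentially)
    ultimately show ?thesis using Lim_null_comparison[of e] by simp
  qed
  have e2: "(\<lambda>N. e (2 * N) / e N) \<longlonglongrightarrow> 2 powr (1 - a)"
  proof -
    have l: "(\<lambda>N. 2 * (T (2 * real N) / T (real N))) \<longlonglongrightarrow> 2 * 2 powr (- a)"
      by (intro tendsto_intros filterlim_compose[OF ratio[of 2] filterlim_real_sequentially]) auto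
    have ev: "\<forall>\<^sub>F N in sequentially. 2 * (T (2 * real N) / T (real N)) = e (2 * N) / e N"
      using eventually_gt_at_top[of 0] by eventually_elim (simp add: e_def)
    have "2 * 2 powr (- a) = 2 powr (1 - a)" by (simp add: powr_diff powr_minus divide_inverse)
    with Lim_transform_eventually[OF l ev] show ?thesis by simp
  qed
  have "(2::real) powr (1 - a) < 2 powr 0" using a_gt_1 by (intro powr_less_mono) auto
  then have q: "(2::real) powr (1 - a) < 1" by simp
  have "(\<lambda>N. (S N - S (2 * N)) / e N / (1 - e (2 * N) / e N)) \<longlonglongrightarrow> d * (1 - 2 powr (1 - a)) / (1 - 2 powr (1 - a))"
    using block q by (intro tendsto_intros e2) (auto simp: e_def)
  then have r: "(\<lambda>N. (S N - S (2 * N)) / e N / (1 - e (2 * N) / e N)) \<longlonglongrightarrow> d" using q a_gt_1 by simp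
  have dec: "\<forall>\<^sub>F N in sequentially. e (2 * N) / e N < 1" using order_tendstoD(2)[OF e2 q] .
  show ?thesis unfolding e_def[symmetric]
  proof (rule LIMSEQ_I)
    fix r' :: real assume r': "0 < r'"
    define \<epsilon> where "\<epsilon> = r' / 2"
    have eps: "0 < \<epsilon>" using r' by (simp add: \<epsilon>_def)
    have "\<forall>\<^sub>F N in sequentially. \<bar>(S N - S (2 * N)) - d * (e N - e (2 * N))\<bar> \<le> \<epsilon> * (e N - e (2 * N))"
      using tendstoD[OF r eps] dec eventually_gt_at_top[of 0]
    proof eventually_elim
      case (elim N)
      define q where "q = e N - e (2 * N)"
      have eN: "0 < e N" using epos elim by simp
      then have q: "0 < q" using elim by (simp add: q_def field_simps)
      have eq: "(S N - S (2 * N)) / e N / (1 - e (2 * N) / e N) = (S N - S (2 * N)) / q"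
      proof -
        have "1 - e (2 * N) / e N = q / e N" using eN by (simp add: q_def diff_divide_distrib)
        then show ?thesis using eN by simp
      qed
      have "\<bar>(S N - S (2 * N)) / q - d\<bar> < \<epsilon>" using elim(1) unfolding eq dist_real_def .
      then have "\<bar>(S N - S (2 * N)) / q - d\<bar> * q \<le> \<epsilon> * q" using q by (intro mult_right_mono) auto
      moreover have "\<bar>(S N - S (2 * N)) / q - d\<bar> * q = \<bar>((S N - S (2 * N)) / q - d) * q\<bar>"
        using q by (simp add: abs_mult)
      moreover have "((S N - S (2 * N)) / q - d) * q = S N - S (2 * N) - d * q" using q by (simp add: field_simps)
      ultimately show ?case by (simp add: q_def)
    qed
    then obtain n0 where n0: "\<And>N. n0 \<le> N \<Longrightarrow> \<bar>(S N - S (2 * N)) - d * (e N - e (2 * N))\<bar> \<le> \<epsilon> * (e N - e (2 * N))"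
      unfolding eventually_sequentially by blast
    show "\<exists>no. \<forall>N\<ge>no. norm (S N / e N - d) < r'"
    proof (intro exI[of _ "max n0 1"] allI impI)
      fix N assume "max n0 1 \<le> N"
      then have N: "n0 \<le> N" "0 < N" by auto
      have le: "\<bar>(S N - S (2 ^ i * N)) - d * (e N - e (2 ^ i * N))\<bar> \<le> \<epsilon> * (e N - e (2 ^ i * N))" for i
      proof (induction i)
        case (Suc i)
        have "N \<le> 2 ^ i * N" by simp
        then have "\<bar>(S (2 ^ i * N) - S (2 * (2 ^ i * N))) - d * (e (2 ^ i * N) - e (2 * (2 ^ i * N)))\<bar>
            \<le> \<epsilon> * (e (2 ^ i * N) - e (2 * (2 ^ i * N)))"
          using N by (intro n0) linarith
        with Suc have "\<bar>(S N - S (2 * (2 ^ i * N))) - d * (e N - e (2 * (2 ^ i * N)))\<bar> \<le> \<epsilon> * (e N - e (2 * (2 ^ i * N)))"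
          unfolding right_diff_distrib by linarith
        then show ?case by (simp add: mult.assoc)
      qed simp
      have l1: "(\<lambda>i. \<bar>(S N - S (2 ^ i * N)) - d * (e N - e (2 ^ i * N))\<bar>) \<longlonglongrightarrow> \<bar>(S N - 0) - d * (e N - 0)\<bar>"
        by (intro tendsto_intros filterlim_compose[OF S lim2] filterlim_compose[OF e0 lim2] N)
      have l2: "(\<lambda>i. \<epsilon> * (e N - e (2 ^ i * N))) \<longlonglongrightarrow> \<epsilon> * (e N - 0)"
        by (intro tendsto_intros filterlim_compose[OF e0 lim2] N)
      have "\<bar>S N - d * e N\<bar> \<le> \<epsilon> * e N"
        using LIMSEQ_le[OF l1 l2] le by simp
      then have "\<bar>S N - d * e N\<bar> / e N \<le> \<epsilon>" using epos[OF N(2)] by (simp add: field_simps)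
      moreover have "S N / e N - d = (S N - d * e N) / e N" using epos[OF N(2)] by (simp add: field_simps)
      ultimately have "\<bar>S N / e N - d\<bar> \<le> \<epsilon>" using epos[OF N(2)] by (simp add: abs_divide)
      then show "norm (S N / e N - d) < r'" using r' by (simp add: \<epsilon>_def)
    qed
  qed
qed

text \<open>The \<open>n\<close>-th coefficient of the \<open>m\<close>-th derivative is
  \<open>pmf p (n + m)\<close> times a product of \<open>m\<close> factors between \<open>n\<close>
  and \<open>n + m\<close>. On the block above \<open>N\<close> the weight
  \<open>(N / n) ^ m\<close> turns this product into \<open>N ^ m\<close>, up to a factor between 1
  and \<open>(1 + m / N) ^ m\<close>.\<close>

lemma pmf_tail_tauberian:
  fixes p :: "nat pmf" and m :: nat
  assumes m: "a - 1 < real m" and K: "0 < K"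
    and lim: "((\<lambda>v. (\<Sum>n. (diffs ^^ m) (pmf p) n * (1 - v) ^ n) * v ^ (m + 1) / T (1 / v)) \<longlongrightarrow> K) (at_right 0)"
  shows "(\<lambda>j. measure_pmf.prob p {j<..} / (real j * T (real j))) \<longlonglongrightarrow> K / ((a - 1) * Gamma (real m + 1 - a))"
proof -
  define u where "u = (diffs ^^ m) (pmf p)"
  have u: "u n = pochhammer (real (Suc n)) m * pmf p (n + m)" for n
    unfolding u_def by (rule diffs_funpow)
  have u0: "0 \<le> u n" for n unfolding u by (intro mult_nonneg_nonneg pochhammer_nonneg) auto
  have summ: "summable (\<lambda>n. u n * z ^ n)" if "0 \<le> z" "z < 1" for z
    unfolding u_def using that by (intro summable_diffs_funpow_pmf) auto
  define c where "c = (1 - 2 powr (1 - a)) / ((a - 1) * Gamma (real m + 1 - a))"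
  define B where "B N = (\<Sum>n\<in>{N<..2*N}. u n * (real N / real n) ^ m) / (real N ^ (m + 1) * T (real N))" for N
  have B: "B \<longlonglongrightarrow> K * c"
    unfolding B_def[abs_def] c_def using karamata_blocks[OF u0 summ m _ K] lim by (simp add: u_def)
  \<comment> \<open>Shifted by \<open>m\<close> because differentiation moves the mass at
    \<open>n + m\<close> to the index \<open>n\<close>; \<open>ratio_general\<close> allows the
    shift to be removed at the end.\<close>
  define S where "S N = measure_pmf.prob p {N + m<..}" for N
  have SD: "S N - S (2 * N) = (\<Sum>n\<in>{N<..2*N}. pmf p (n + m))" for N
  proof -
    have "S N - S (2 * N) = measure_pmf.prob p ({N + m<..} - {2 * N + m<..})"
      unfolding S_def by (rule measure_pmf.finite_measure_Diff[symmetric]) auto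
    also have "{N + m<..} - {2 * N + m<..} = (\<lambda>n. n + m) ` {N<..2*N}"
    proof (rule set_eqI)
      fix n show "n \<in> {N + m<..} - {2 * N + m<..} \<longleftrightarrow> n \<in> (\<lambda>n. n + m) ` {N<..2*N}"
        by (auto intro!: image_eqI[of _ _ "n - m"])
    qed
    also have "measure_pmf.prob p \<dots> = (\<Sum>n\<in>{N<..2*N}. pmf p (n + m))"
      by (subst measure_measure_pmf_finite) (auto simp: sum.reindex inj_on_def)
    finally show ?thesis .
  qed
  have low: "(S N - S (2 * N)) / (real N * T (real N)) \<le> B N" and
    high: "B N \<le> (1 + real m / real N) ^ m * ((S N - S (2 * N)) / (real N * T (real N)))" if N: "0 < N" for N
  proof -
    have 1: "pmf p (n + m) * real N ^ m \<le> u n * (real N / real n) ^ m"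
      "u n * (real N / real n) ^ m \<le> (1 + real m / real N) ^ m * (pmf p (n + m) * real N ^ m)" if n: "N < n" for n
    proof -
      have "real n ^ m \<le> pochhammer (real (Suc n)) m"
      proof -
        have "(\<Prod>i\<in>{0..<m}. real n) \<le> (\<Prod>i\<in>{0..<m}. real (Suc n) + real i)" by (intro prod_mono) auto
        then show ?thesis by (simp add: pochhammer_prod)
      qed
      then have "1 \<le> pochhammer (real (Suc n)) m / real n ^ m" using n by simp
      then have "pmf p (n + m) * real N ^ m * 1 \<le> pmf p (n + m) * real N ^ m * (pochhammer (real (Suc n)) m / real n ^ m)"
        by (intro mult_left_mono) auto
      then show "pmf p (n + m) * real N ^ m \<le> u n * (real N / real n) ^ m"
        by (simp add: u power_divide mult_ac)
      have "pochhammer (real (Suc n)) m \<le> (real n + real m) ^ m"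
      proof -
        have "(\<Prod>i\<in>{0..<m}. real (Suc n) + real i) \<le> (\<Prod>i\<in>{0..<m}. real n + real m)" by (intro prod_mono) auto
        then show ?thesis by (simp add: pochhammer_prod)
      qed
      then have "pochhammer (real (Suc n)) m / real n ^ m \<le> (real n + real m) ^ m / real n ^ m"
        by (intro divide_right_mono) auto
      also have "\<dots> = (1 + real m / real n) ^ m" using n by (simp add: power_divide[symmetric] add_divide_distrib)
      also have "\<dots> \<le> (1 + real m / real N) ^ m" using n N by (intro power_mono add_left_mono divide_left_mono) auto
      finally have "pmf p (n + m) * real N ^ m * (pochhammer (real (Suc n)) m / real n ^ m) \<le> pmf p (n + m) * real N ^ m * (1 + real m / real N) ^ m"
        by (intro mult_left_mono) auto
      then show "u n * (real N / real n) ^ m \<le> (1 + real m / real N) ^ m * (pmf p (n + m) * real N ^ m)"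
        by (simp add: u power_divide mult_ac)
    qed
    have TN: "0 < real N * T (real N)" "0 < real N ^ (m + 1) * T (real N)" using N pos by auto
    have eq: "(S N - S (2 * N)) / (real N * T (real N)) = (\<Sum>n\<in>{N<..2*N}. pmf p (n + m) * real N ^ m) / (real N ^ (m + 1) * T (real N))"
      unfolding SD sum_distrib_right[symmetric] using N pos[of "real N"] by simp
    show "(S N - S (2 * N)) / (real N * T (real N)) \<le> B N"
      unfolding eq B_def using TN by (intro divide_right_mono sum_mono 1) auto
    have "(\<Sum>n\<in>{N<..2*N}. u n * (real N / real n) ^ m) \<le> (\<Sum>n\<in>{N<..2*N}. (1 + real m / real N) ^ m * (pmf p (n + m) * real N ^ m))"
      by (intro sum_mono 1) auto
    then show "B N \<le> (1 + real m / real N) ^ m * ((S N - S (2 * N)) / (real N * T (real N)))"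
      unfolding eq B_def times_divide_eq_right sum_distrib_left using TN by (intro divide_right_mono) auto
  qed
  have f1: "(\<lambda>N. (1 + real m / real N) ^ m) \<longlonglongrightarrow> (1 + 0) ^ m"
    by (intro tendsto_intros tendsto_divide_0[OF tendsto_const] filterlim_at_top_imp_at_infinity filterlim_real_sequentially)
  have block: "(\<lambda>N. (S N - S (2 * N)) / (real N * T (real N))) \<longlonglongrightarrow> K * c"
  proof (rule tendsto_sandwich)
    show "(\<lambda>N. B N / (1 + real m / real N) ^ m) \<longlonglongrightarrow> K * c"
      using tendsto_divide[OF B f1] by simp
    show "\<forall>\<^sub>F N in sequentially. B N / (1 + real m / real N) ^ m \<le> (S N - S (2 * N)) / (real N * T (real N))"
      using eventually_gt_at_top[of 0]
    proof eventually_elim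
      case (elim N)
      have "0 < (1 + real m / real N) ^ m" by (intro zero_less_power) (simp add: add_pos_nonneg)
      moreover have "B N \<le> (S N - S (2 * N)) / (real N * T (real N)) * (1 + real m / real N) ^ m"
        using high[OF elim] by (subst mult.commute)
      ultimately show ?case by (rule mult_imp_div_pos_le)
    qed
    show "\<forall>\<^sub>F N in sequentially. (S N - S (2 * N)) / (real N * T (real N)) \<le> B N"
      using eventually_gt_at_top[of 0] by eventually_elim (rule low)
  qed (rule B)
  define d where "d = K / ((a - 1) * Gamma (real m + 1 - a))"
  have Kc: "K * c = d * (1 - 2 powr (1 - a))" by (simp add: c_def d_def)
  have S0: "S \<longlonglongrightarrow> 0"
  proof -
    have "(\<lambda>N. measure_pmf.prob p {N<..}) \<longlonglongrightarrow> measure_pmf.prob p (\<Inter>N. {N<..})"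
      by (intro measure_pmf.finite_Lim_measure_decseq) (auto simp: decseq_def)
    also have "(\<Inter>N::nat. {N<..}) = {}" by auto
    finally show ?thesis unfolding S_def by (intro LIMSEQ_ignore_initial_segment) simp
  qed
  have "(\<lambda>N. S N / (real N * T (real N))) \<longlonglongrightarrow> d"
    by (rule dyadic_telescope[OF S0 block[unfolded Kc]])
  moreover have r1: "(\<lambda>N. real N * T (real N) / (real (N + m) * T (real (N + m)))) \<longlonglongrightarrow> 1 / 1 * 1"
  proof -
    have g: "filterlim (\<lambda>N. real (N + m)) at_top sequentially"
      by (rule filterlim_compose[OF filterlim_real_sequentially]) (rule filterlim_add_const_nat_at_top)
    have "(\<lambda>N. 1 + real m / real N) \<longlonglongrightarrow> 1 + 0"
      by (intro tendsto_intros tendsto_divide_0[OF tendsto_const] filterlim_at_top_imp_at_infinity filterlim_real_sequentially)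
    then have "(\<lambda>N. 1 / (1 + real m / real N)) \<longlonglongrightarrow> 1 / 1" by (intro tendsto_intros) auto
    then have r: "(\<lambda>N. real N / real (N + m)) \<longlonglongrightarrow> 1 / 1"
    proof (rule Lim_transform_eventually)
      show "\<forall>\<^sub>F N in sequentially. 1 / (1 + real m / real N) = real N / real (N + m)"
        using eventually_gt_at_top[of 0] by eventually_elim (simp add: field_simps)
    qed
    have "(\<lambda>N. T (real N) / T (real (N + m))) \<longlonglongrightarrow> 1 powr (- a)"
      using ratio_general[OF g r] by simp
    then have "(\<lambda>N. real N / real (N + m) * (T (real N) / T (real (N + m)))) \<longlonglongrightarrow> 1 / 1 * 1 powr (- a)"
      by (intro tendsto_mult r)
    then show ?thesis by simp
  qed
  ultimately have l: "(\<lambda>N. S N / (real N * T (real N)) * (real N * T (real N) / (real (N + m) * T (real (N + m))))) \<longlonglongrightarrow> d * (1 / 1 * 1)"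
    by (rule tendsto_mult)
  have ev: "\<forall>\<^sub>F N in sequentially. S N / (real N * T (real N)) * (real N * T (real N) / (real (N + m) * T (real (N + m))))
      = measure_pmf.prob p {N + m<..} / (real (N + m) * T (real (N + m)))"
    using eventually_gt_at_top[of 0]
  proof eventually_elim
    case (elim N)
    then have "real N * T (real N) \<noteq> 0" using pos[of "real N"] by simp
    then show ?case by (simp add: S_def)
  qed
  have "(\<lambda>N. measure_pmf.prob p {N + m<..} / (real (N + m) * T (real (N + m)))) \<longlonglongrightarrow> d"
    using Lim_transform_eventually[OF l ev] by simp
  then show ?thesis unfolding d_def by (rule LIMSEQ_offset)
qed

end

section \<open>The law of the service time\<close>

text \<open>Tonelli for \<open>F x\<close> written as the integral of \<open>f\<close> over
  \<open>(0, x)\<close>, which expresses the expectation of \<open>F\<close> through the tail. It is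
  applied to \<open>F x = 1 - exp (- s * x)\<close> and to \<open>F x = x\<close>.\<close>

lemma (in real_distribution) nn_integral_primitive:
  fixes f F :: "real \<Rightarrow> real"
  assumes null: "cdf M 0 = 0"
    and F: "\<And>x. 0 \<le> x \<Longrightarrow> (F has_real_derivative f x) (at x)" "F 0 = 0"
    and f: "f \<in> borel_measurable borel" "\<And>x. 0 \<le> x \<Longrightarrow> 0 \<le> f x"
  shows "(\<integral>\<^sup>+x. ennreal (F x) \<partial>M) = (\<integral>\<^sup>+t. ennreal (indicator {0<..} t * (f t * measure M {t<..})) \<partial>lborel)"
proof -
  interpret pair_sigma_finite lborel M ..
  note f(1)[measurable]
  have supp: "AE x in M. 0 < x"
  proof (rule AE_I[of _ _ "{..0}"])
    show "emeasure M {..0} = 0" using null by (simp add: cdf_def emeasure_eq_measure)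
  qed auto
  have inner: "ennreal (F x) = (\<integral>\<^sup>+t. ennreal (f t) * indicator {0<..<x} t \<partial>lborel)" if "0 < x" for x
  proof -
    have "(\<integral>\<^sup>+t. ennreal (f t) * indicator {0<..<x} t \<partial>lborel) = (\<integral>\<^sup>+t. ennreal (f t) * indicator {0..x} t \<partial>lborel)"
    proof (rule nn_integral_cong_AE)
      have "AE t in lborel. t \<noteq> 0 \<and> t \<noteq> x" using AE_lborel_singleton[of 0] AE_lborel_singleton[of x] by auto
      then show "AE t in lborel. ennreal (f t) * indicator {0<..<x} t = ennreal (f t) * indicator {0..x} t"
        by eventually_elim (auto simp: indicator_def)
    qed
    also have "\<dots> = ennreal (F x - F 0)"
      using that F f by (intro nn_integral_FTC_Icc) auto
    finally show ?thesis using F by simp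
  qed
  have "(\<integral>\<^sup>+x. ennreal (F x) \<partial>M) = (\<integral>\<^sup>+x. (\<integral>\<^sup>+t. ennreal (f t) * indicator {0<..<x} t \<partial>lborel) \<partial>M)"
    using supp by (intro nn_integral_cong_AE) (auto elim!: eventually_mono simp: inner)
  also have "\<dots> = (\<integral>\<^sup>+t. (\<integral>\<^sup>+x. ennreal (f t) * indicator {0<..<x} t \<partial>M) \<partial>lborel)"
  proof (rule Fubini')
    have "(\<lambda>(t, x). ennreal (f t) * indicator {p. 0 < fst p \<and> fst p < snd p} (t, x))
        \<in> borel_measurable (lborel \<Otimes>\<^sub>M M)"
      by measurable
    then show "(\<lambda>(t, x). ennreal (f t) * indicator {0<..<x} t) \<in> borel_measurable (lborel \<Otimes>\<^sub>M M)"
      by (simp add: indicator_def case_prod_beta' greaterThanLessThan_iff)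
  qed
  also have "\<dots> = (\<integral>\<^sup>+t. ennreal (indicator {0<..} t * (f t * measure M {t<..})) \<partial>lborel)"
  proof (rule nn_integral_cong)
    fix t :: real
    have "(\<integral>\<^sup>+x. ennreal (f t) * indicator {0<..<x} t \<partial>M) =
      (\<integral>\<^sup>+x. (ennreal (f t) * indicator {0<..} t) * indicator {t<..} x \<partial>M)"
      by (intro nn_integral_cong) (auto simp: indicator_def)
    also have "\<dots> = ennreal (f t) * indicator {0<..} t * emeasure M {t<..}"
      by (rule nn_integral_cmult_indicator) simp
    finally show "(\<integral>\<^sup>+x. ennreal (f t) * indicator {0<..<x} t \<partial>M) =
       ennreal (indicator {0<..} t * (f t * measure M {t<..}))"
      using f(2)[of t] by (auto simp: emeasure_eq_measure ennreal_mult indicator_def)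
  qed
  finally show ?thesis .
qed

locale service_law = real_distribution D for D :: "real measure" +
  fixes a :: real and L :: "real \<Rightarrow> real"
  assumes null: "cdf D 0 = 0"
    and mean_finite: "integrable D (\<lambda>x. x)"
    and a_gt_1: "1 < a" and sv: "slowly_varying L"
    and tail: "(\<lambda>t. measure D {t<..}) \<sim>[at_top] (\<lambda>t. t powr (- a) * L t)"
begin

abbreviation T :: "real \<Rightarrow> real" where "T t \<equiv> measure D {t<..}"

lemma T_ratio:
  assumes x: "0 < x"
  shows "((\<lambda>t. T (x * t) / T t) \<longlongrightarrow> x powr (- a)) at_top"
proof -
  let ?r = "\<lambda>t. t powr (- a) * L t"
  have pos: "\<forall>\<^sub>F t in at_top. 0 < ?r t"
    using eventually_gt_at_top[of 0] by eventually_elim (use sv in \<open>auto simp: slowly_varying_def\<close>)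
  have 1: "((\<lambda>t. T t / ?r t) \<longlongrightarrow> 1) at_top"
    by (rule asymp_equivD_strong[OF tail]) (use pos in \<open>auto elim: eventually_mono\<close>)
  have xt: "filterlim (\<lambda>t. x * t) at_top at_top"
    using x by (intro filterlim_tendsto_pos_mult_at_top[OF tendsto_const _ filterlim_ident])
  have 2: "((\<lambda>t. T (x * t) / ?r (x * t)) \<longlongrightarrow> 1) at_top"
    using filterlim_compose[OF 1 xt] .
  have L: "((\<lambda>t. L (x * t) / L t) \<longlongrightarrow> 1) at_top"
    using sv x by (simp add: slowly_varying_def)
  have "((\<lambda>t. T (x * t) / ?r (x * t) / (T t / ?r t) * (x powr (- a) * (L (x * t) / L t)))
      \<longlongrightarrow> 1 / 1 * (x powr (- a) * 1)) at_top"
    by (intro tendsto_intros 1 2 L) auto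
  moreover have "\<forall>\<^sub>F t in at_top. T (x * t) / ?r (x * t) / (T t / ?r t) * (x powr (- a) * (L (x * t) / L t))
      = T (x * t) / T t"
    using eventually_gt_at_top[of 0]
  proof eventually_elim
    case (elim t)
    then have "0 < L t" "0 < L (x * t)" using sv x by (auto simp: slowly_varying_def)
    then show ?case using elim x by (simp add: powr_mult field_simps)
  qed
  ultimately show ?thesis by (simp add: tendsto_cong)
qed

text \<open>A tail that vanishes at one point vanishes from there on. Its ratio for
  \<open>x = 1\<close> is then eventually \<open>0 / 0\<close>, which is 0 by convention, against
  the limit 1.\<close>

lemma T_pos: "0 < T t"
proof (rule ccontr)
  assume "\<not> 0 < T t"
  then have t: "T t = 0" by (simp add: less_le)
  have z: "T s = 0" if "t \<le> s" for s
    using finite_measure_mono[of "{s<..}" "{t<..}"] that t measure_nonneg[of D "{s<..}"] by simp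
  have "((\<lambda>t. T (1 * t) / T t) \<longlongrightarrow> 0) at_top"
    by (rule tendsto_eventually) (unfold eventually_at_top_linorder, use z in \<open>auto intro!: exI[of _ t]\<close>)
  then show False using tendsto_unique[OF _ T_ratio[of 1]] by force
qed

sublocale regularly_varying_tail T a
proof
  show "T y \<le> T x" if "x \<le> y" for x y using that by (intro finite_measure_mono) auto
qed (auto simp: T_pos T_ratio a_gt_1)

lemma AE_pos: "AE x in D. 0 < x"
proof (rule AE_I[of _ _ "{..0}"])
  show "emeasure D {..0} = 0" using null by (simp add: cdf_def emeasure_eq_measure)
qed auto

text \<open>Integration by parts, which carries the asymptotics of the tail over to the service
  transform.\<close>

lemma lst_eq_J:
  assumes "0 \<le> s"
  shows "1 - lst D s = s * J 0 s"
proof -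
  have bd: "AE x in D. norm (exp (- s * x)) \<le> 1"
    using AE_pos by eventually_elim (use assms in auto)
  have int: "integrable D (\<lambda>x. exp (- s * x))"
    by (rule integrable_const_bound[OF bd]) auto
  have "(\<integral>\<^sup>+x. ennreal (1 - exp (- s * x)) \<partial>D) =
      (\<integral>\<^sup>+t. ennreal (indicator {0<..} t * (s * exp (- s * t) * T t)) \<partial>lborel)"
    using assms by (intro nn_integral_primitive null) (auto intro!: derivative_eq_intros)
  then have "enn2real (\<integral>\<^sup>+x. ennreal (1 - exp (- s * x)) \<partial>D) =
      enn2real (\<integral>\<^sup>+t. ennreal (indicator {0<..} t * (s * exp (- s * t) * T t)) \<partial>lborel)" by simp
  also have "enn2real (\<integral>\<^sup>+x. ennreal (1 - exp (- s * x)) \<partial>D) = (\<integral>x. 1 - exp (- s * x) \<partial>D)"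
  proof (rule integral_eq_nn_integral[symmetric])
    show "AE x in D. 0 \<le> 1 - exp (- s * x)" using AE_pos by eventually_elim (use assms in auto)
  qed auto
  also have "\<dots> = 1 - lst D s" using int using prob_space by (simp add: lst_def)
  also have "enn2real (\<integral>\<^sup>+t. ennreal (indicator {0<..} t * (s * exp (- s * t) * T t)) \<partial>lborel) =
      (\<integral>t. indicator {0<..} t * (s * exp (- s * t) * T t) \<partial>lborel)"
    using assms by (intro integral_eq_nn_integral[symmetric]) auto
  also have "\<dots> = (\<integral>t. s * (indicator {0<..} t * (t ^ 0 * exp (- (s * t)) * T t)) \<partial>lborel)"
    by (intro Bochner_Integration.integral_cong) (auto simp: mult_ac)
  also have "\<dots> = s * J 0 s" unfolding J_def by (rule integral_mult_right_zero)
  finally show ?thesis .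
qed

lemma mean_eq_J: "mean D = J 0 0"
proof -
  have "(\<integral>\<^sup>+x. ennreal x \<partial>D) = (\<integral>\<^sup>+t. ennreal (indicator {0<..} t * (1 * T t)) \<partial>lborel)"
    by (intro nn_integral_primitive[of "\<lambda>x. x" "\<lambda>_. 1"] null) (auto intro!: derivative_eq_intros)
  moreover have "mean D = enn2real (\<integral>\<^sup>+x. ennreal x \<partial>D)"
    unfolding mean_def by (rule integral_eq_nn_integral) (use AE_pos in \<open>auto elim: eventually_mono\<close>)
  moreover have "J 0 0 = enn2real (\<integral>\<^sup>+t. ennreal (indicator {0<..} t * (1 * T t)) \<partial>lborel)"
    unfolding J_def by (subst integral_eq_nn_integral) auto
  ultimately show ?thesis by simp
qed

lemma J_0_mono:
  assumes "0 \<le> s" "s \<le> s'"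
  shows "J 0 s' \<le> J 0 s"
proof -
  have int: "integrable lborel (\<lambda>t. indicator {0<..} t * (t ^ 0 * exp (- (s * t)) * T t))" if "0 \<le> s" for s
    using J_integrable[of s 0] T_integrable that by (cases "s = 0") auto
  have "exp (- (s' * t)) * T t \<le> exp (- (s * t)) * T t" if "0 < t" for t
  proof (rule mult_right_mono)
    show "exp (- (s' * t)) \<le> exp (- (s * t))" using assms that by (simp add: mult_right_mono)
  qed (simp add: less_imp_le[OF pos])
  then have "indicator {0<..} t * (t ^ 0 * exp (- (s' * t)) * T t) \<le> indicator {0<..} t * (t ^ 0 * exp (- (s * t)) * T t)" for t
    by (cases "0 < t") simp_all
  then show ?thesis
    unfolding J_def using int[of s] int[of s'] assms by (intro integral_mono) simp_all
qed

lemma mean_pos: "0 < mean D"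
proof -
  have int: "integrable lborel (\<lambda>t. indicator {0<..<1::real} t * T 1)"
    by (intro integrable_mult_left integrable_real_indicator) auto
  have "T 1 = (\<integral>t. indicator {0<..<1::real} t * T 1 \<partial>lborel)" by simp
  also have "\<dots> \<le> (\<integral>t. indicator {0<..} t * T t \<partial>lborel)"
  proof (rule integral_mono[OF int T_integrable])
    fix t :: real
    show "indicator {0<..<1} t * T 1 \<le> indicator {0<..} t * T t"
      using antimono[of t 1] pos[of t] by (cases "0 < t"; cases "t < 1") simp_all
  qed
  also have "\<dots> = mean D" by (simp add: mean_eq_J J_def)
  finally show ?thesis using pos[of 1] by linarith
qed

end

section \<open>The generating function of the orbit size\<close>

locale stable_retrial_law = service_law D a L
  for D :: "real measure" and a :: real and L :: "real \<Rightarrow> real" +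
  fixes lam mu q :: real
  assumes lam: "0 < lam" and mu: "0 < mu" and q: "0 < q" "q < 1" and stable: "lam * mean D < 1"
begin

abbreviation rho :: real where "rho \<equiv> lam * mean D"

text \<open>
  The equation for \<open>h\<close> is solved by the parametrization \<open>q * h z + (1 - q) * z = 1 - w\<close>: then
  \<open>h z = lst D (lam * w) = 1 - w * G 0 w\<close> and \<open>z = 1 - V w\<close>, \<open>G k\<close> is the \<open>k\<close>-th derivative of \<open>G 0\<close>,
  and \<open>K w = (1 - h z) / (h z - z)\<close>. Since \<open>V w_max = 1\<close>, the range \<open>0 < w \<le> w_max\<close> covers \<open>0 \<le> z < 1\<close>.
\<close>

definition G :: "nat \<Rightarrow> real \<Rightarrow> real" where
  "G k w = lam * (- lam) ^ k * J k (lam * w)"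

definition V :: "real \<Rightarrow> real" where
  "V w = w * (1 - q * G 0 w) / (1 - q)"

definition K :: "real \<Rightarrow> real" where
  "K w = (1 - q) * G 0 w / (1 - G 0 w)"

section \<open>Inverting the parametrization\<close>

lemma G_0: "G 0 0 = rho" by (simp add: G_def mean_eq_J)

lemma lst_eq_G: "0 \<le> w \<Longrightarrow> lst D (lam * w) = 1 - w * G 0 w"
  using lst_eq_J[of "lam * w"] lam by (simp add: G_def algebra_simps)

lemma G_nonneg: "0 \<le> G 0 w" using lam J_nonneg by (simp add: G_def)

lemma G_antimono: "0 \<le> w \<Longrightarrow> w \<le> w' \<Longrightarrow> G 0 w' \<le> G 0 w"
  using lam by (auto simp: G_def intro!: J_0_mono)

lemma G_le_rho: "0 \<le> w \<Longrightarrow> G 0 w \<le> rho"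
  using G_antimono[of 0 w] by (simp add: G_0)

lemma G_less_1: "0 \<le> w \<Longrightarrow> G 0 w < 1"
  using G_le_rho stable by fastforce

lemma q_G_less_1: "0 \<le> w \<Longrightarrow> q * G 0 w < 1"
  using mult_strict_mono[of q 1 "G 0 w" 1] G_less_1[of w] G_nonneg[of w] q by simp

lemma lst_less_1:
  assumes "0 < s" shows "lst D s < 1"
proof -
  have "integrable D (\<lambda>x. exp (- s * x))"
  proof (rule integrable_const_bound[of _ 1])
    show "AE x in D. norm (exp (- s * x)) \<le> 1"
      using AE_pos by eventually_elim (use assms in simp)
  qed simp
  then have "(\<integral>x. exp (- s * x) \<partial>D) < (\<integral>x. 1 \<partial>D)"
  proof (rule integral_less_AE_space)
    show "AE x in D. exp (- s * x) < 1"
      using AE_pos by eventually_elim (use assms in simp)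
    show "emeasure D (space D) \<noteq> 0" using emeasure_space_1 by simp
  qed simp
  then show ?thesis using prob_space by (simp add: lst_def)
qed

text \<open>If \<open>G 0\<close> vanished at \<open>w\<close>, monotonicity would make it vanish at
  \<open>w + 1\<close>, and the service transform would equal 1 at a positive argument.\<close>

lemma G_pos: assumes "0 \<le> w" shows "0 < G 0 w"
proof (rule ccontr)
  assume "\<not> 0 < G 0 w"
  then have "G 0 w = 0" using G_nonneg[of w] by simp
  have "1 - lst D (lam * (w + 1)) = (w + 1) * G 0 (w + 1)" using lst_eq_G[of "w + 1"] assms by simp
  moreover have "G 0 (w + 1) = 0" using G_antimono[of w "w + 1"] G_nonneg[of "w + 1"] assms \<open>G 0 w = 0\<close> by simp
  ultimately have "lst D (lam * (w + 1)) = 1" by simp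
  moreover have "lst D (lam * (w + 1)) < 1" using lam assms by (intro lst_less_1) simp
  ultimately show False by simp
qed

lemma G_deriv:
  assumes "0 < w" shows "(G k has_real_derivative G (Suc k) w) (at w)"
proof -
  have "((\<lambda>w. J k (lam * w)) has_real_derivative - J (Suc k) (lam * w) * lam) (at w)"
    using lam assms by (intro DERIV_chain2[OF J_derivative]) (auto intro!: derivative_eq_intros)
  from DERIV_cmult[OF this, of "lam * (- lam) ^ k"] show ?thesis
    by (simp add: G_def[abs_def] mult_ac)
qed

lemma G_continuous: "continuous_on {0..} (G 0)"
proof (rule continuous_on_eq_continuous_within[THEN iffD2], rule ballI)
  fix w :: real assume "w \<in> {0..}"
  then consider "w = 0" | "0 < w" by fastforce
  then show "continuous (at w within {0..}) (G 0)"
  proof cases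
    case 1
    have "filterlim (\<lambda>w. lam * w) (at_right 0) (at_right 0)"
      unfolding filterlim_at using lam eventually_at_right_less[of "0::real"]
      by (auto intro!: tendsto_eq_intros elim!: eventually_mono)
    then have "((\<lambda>w. lam * (- lam) ^ 0 * J 0 (lam * w)) \<longlongrightarrow> lam * (- lam) ^ 0 * J 0 0) (at_right 0)"
      by (intro tendsto_intros filterlim_compose[OF J_0_tendsto])
    then have "(G 0 \<longlongrightarrow> G 0 0) (at_right 0)" by (simp add: G_def[abs_def])
    then show ?thesis using 1 by (simp add: continuous_within at_within_Ici_at_right)
  next
    case 2
    then show ?thesis using G_deriv[of w 0] DERIV_isCont continuous_at_imp_continuous_at_within by blast
  qed
qed

lemma K_continuous: "continuous_on {0..} K"
  unfolding K_def[abs_def] using G_less_1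
  by (intro continuous_intros G_continuous) force

lemma V_continuous: "continuous_on {0..} V"
  unfolding V_def[abs_def] using q by (intro continuous_intros G_continuous) auto

lemma V_0 [simp]: "V 0 = 0" by (simp add: V_def)

lemma V_strict_mono:
  assumes "0 \<le> w" "w < w'" shows "V w < V w'"
proof -
  have "w * (1 - q * G 0 w) < w' * (1 - q * G 0 w)"
    using assms q_G_less_1[of w] by (intro mult_strict_right_mono) auto
  also have "\<dots> \<le> w' * (1 - q * G 0 w')"
    using assms q G_antimono[of w w'] by (intro mult_left_mono) auto
  finally show ?thesis unfolding V_def using q by (intro divide_strict_right_mono) auto
qed

lemma V_inj: "0 \<le> w \<Longrightarrow> 0 \<le> w' \<Longrightarrow> V w = V w' \<Longrightarrow> w = w'"
  using V_strict_mono[of w w'] V_strict_mono[of w' w] by linarith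

lemma V_onto: "\<exists>w. 0 < w \<and> w \<le> 1 \<and> V w = 1"
proof -
  have "1 \<le> V 1"
    unfolding V_def using q G_less_1[of 1] by (simp add: field_simps)
  then obtain w where "0 \<le> w" "w \<le> 1" "V w = 1"
    using IVT'[of V 0 1 1] continuous_on_subset[OF V_continuous, of "{0..1}"] by auto
  moreover then have "w \<noteq> 0" by auto
  ultimately show ?thesis by (intro exI[of _ w]) auto
qed

text \<open>Injectivity of \<open>V\<close> makes the choice unique. The bound by 1 is what the
  order calculus demands of its interval.\<close>

definition w_max :: real where "w_max = (SOME w. 0 < w \<and> w \<le> 1 \<and> V w = 1)"

lemma w_max: "0 < w_max" "w_max \<le> 1" "V w_max = 1"
  using someI_ex[OF V_onto] by (simp_all add: w_max_def)

lemma V_range: "0 < w \<Longrightarrow> w < w_max \<Longrightarrow> 0 < V w \<and> V w < 1"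
  using V_strict_mono[of 0 w] V_strict_mono[of w w_max] w_max by auto

definition W :: "real \<Rightarrow> real" where "W v = (THE w. w \<in> {0..w_max} \<and> V w = v)"

lemma W_V: "w \<in> {0..w_max} \<Longrightarrow> W (V w) = w"
  unfolding W_def by (rule the_equality) (auto intro: V_inj)

lemma V_image: "V ` {0..w_max} = {0..1}"
proof
  show "V ` {0..w_max} \<subseteq> {0..1}"
    using V_strict_mono[of 0] V_strict_mono[of _ w_max] w_max by (force simp: less_eq_real_def)
  show "{0..1} \<subseteq> V ` {0..w_max}"
  proof
    fix v :: real assume "v \<in> {0..1}"
    then obtain w where "0 \<le> w" "w \<le> w_max" "V w = v"
      using IVT'[of V 0 v w_max] continuous_on_subset[OF V_continuous, of "{0..w_max}"] w_max by auto
    then show "v \<in> V ` {0..w_max}" by auto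
  qed
qed

lemma W_range: "v \<in> {0..1} \<Longrightarrow> W v \<in> {0..w_max} \<and> V (W v) = v"
  using V_image W_V by (metis imageE)

lemma W_continuous: "continuous_on {0..1} W"
  using continuous_on_inv[of "{0..w_max}" V W] continuous_on_subset[OF V_continuous, of "{0..w_max}"] W_V
  by (auto simp: V_image)

text \<open>The parametrization turns the argument of the transform into \<open>lam * w\<close>, so
  the candidate solves the equation. Conversely a solution \<open>x\<close> defines a parameter
  \<open>w'\<close> with \<open>V w' = V w\<close>, and injectivity of \<open>V\<close> forces
  \<open>w' = w\<close>; this is the uniqueness that the \<open>THE\<close> in \<open>h\<close> asks
  for.\<close>

lemma h_eq:
  assumes "w \<in> {0..w_max}"
  shows "h lam q D (1 - V w) = 1 - w * G 0 w"
  unfolding h_def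
proof (rule the_equality)
  have w: "0 \<le> w" using assms by simp
  have eq: "lam - lam * q * (1 - w * G 0 w) - lam * (1 - q) * (1 - V w) = lam * w"
    using q by (simp add: V_def field_simps)
  have "w * G 0 w \<le> 1 * 1" using assms w_max w G_less_1[OF w] G_nonneg[of w] by (intro mult_mono) auto
  then show "0 \<le> 1 - w * G 0 w \<and> 1 - w * G 0 w \<le> 1 \<and>
      1 - w * G 0 w = lst D (lam - lam * q * (1 - w * G 0 w) - lam * (1 - q) * (1 - V w))"
    unfolding eq using lst_eq_G[OF w] w G_nonneg[of w] by simp
  fix x assume x: "0 \<le> x \<and> x \<le> 1 \<and> x = lst D (lam - lam * q * x - lam * (1 - q) * (1 - V w))"
  define w' where "w' = 1 - q * x - (1 - q) * (1 - V w)"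
  have Vw: "0 \<le> V w" "V w \<le> 1" using V_image assms by auto
  have "q * x + (1 - q) * (1 - V w) \<le> q * 1 + (1 - q) * 1"
    using q x Vw by (intro add_mono mult_left_mono) auto
  then have w': "0 \<le> w'" by (simp add: w'_def)
  have "lam - lam * q * x - lam * (1 - q) * (1 - V w) = lam * w'" by (simp add: w'_def algebra_simps)
  then have x': "x = 1 - w' * G 0 w'" using x lst_eq_G[OF w'] by simp
  have "w' * (1 - q * G 0 w') = (1 - q) * V w"
    using w'_def x' by (simp add: algebra_simps)
  then have "V w' = (1 - q) * V w / (1 - q)" by (simp only: V_def[of w'])
  then have "V w' = V w" using q by simp
  then have "w' = w" using V_inj w w' by simp
  then show "x = 1 - w * G 0 w" using x' by simp
qed

lemma K_eq:
  assumes "w \<in> {0<..w_max}"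
  shows "(1 - h lam q D (1 - V w)) / (h lam q D (1 - V w) - (1 - V w)) = K w"
proof -
  have h: "h lam q D (1 - V w) = 1 - w * G 0 w" using assms by (intro h_eq) auto
  have "V w - w * G 0 w = w * (1 - G 0 w) / (1 - q)" using q by (simp add: V_def field_simps)
  moreover have "1 - h lam q D (1 - V w) = w * G 0 w"
    "h lam q D (1 - V w) - (1 - V w) = V w - w * G 0 w" by (simp_all add: h)
  ultimately have "(1 - h lam q D (1 - V w)) / (h lam q D (1 - V w) - (1 - V w)) =
      w * G 0 w / (w * (1 - G 0 w) / (1 - q))" by (simp only:)
  also have "\<dots> = K w" using assms by (simp add: K_def)
  finally show ?thesis .
qed

section \<open>The retrial factor as the solution of a linear differential equation\<close>

definition E :: "real \<Rightarrow> real" where "E w = R_0 lam mu q D (1 - V w)"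

definition F :: "real \<Rightarrow> real" where "F z = integral {0..z} (\<lambda>u. K (W (1 - u)))"

lemma KW_continuous: "continuous_on {0..1} (\<lambda>u. K (W (1 - u)))"
  using W_range
  by (intro continuous_on_compose2[OF K_continuous] continuous_on_compose2[OF W_continuous] continuous_intros) auto

lemma E_eq:
  assumes "w \<in> {0..w_max}"
  shows "E w = exp (- (lam / mu) * (F 1 - F (1 - V w)))"
proof -
  have Vw: "0 \<le> V w" "V w \<le> 1" using V_image assms by auto
  have "integral {1 - V w..1} (\<lambda>u. (1 - h lam q D u) / (h lam q D u - u)) = integral {1 - V w..1} (\<lambda>u. K (W (1 - u)))"
  \<comment> \<open>At \<open>u = 1\<close> the quotient is \<open>0 / 0\<close>, while
    \<open>K (W 0)\<close> is its continuous value; a single point does not affect the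
    integral.\<close>
  proof (rule integral_spike[of "{1}"])
    fix u assume "u \<in> {1 - V w..1} - {1}"
    then have u: "1 - u \<in> {0..1}" "1 - u \<noteq> 0" using Vw by auto
    have "W (1 - u) \<in> {0..w_max}" "V (W (1 - u)) = 1 - u" using W_range[OF u(1)] by auto
    moreover then have "W (1 - u) \<noteq> 0" using u(2) V_0 by metis
    ultimately show "K (W (1 - u)) = (1 - h lam q D u) / (h lam q D u - u)"
      using K_eq[of "W (1 - u)"] by simp
  qed auto
  moreover have "F (1 - V w) + integral {1 - V w..1} (\<lambda>u. K (W (1 - u))) = F 1"
    unfolding F_def using Vw
    by (intro Henstock_Kurzweil_Integration.integral_combine integrable_continuous_interval KW_continuous) auto
  ultimately show ?thesis by (simp add: E_def R_0_def)
qed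

lemma F_deriv:
  assumes "z \<in> {0..1}"
  shows "(F has_real_derivative K (W (1 - z))) (at z within {0..1})"
  unfolding F_def[abs_def] by (rule integral_has_real_derivative[OF KW_continuous assms])

lemma inverse_\<theta>_pos: "0 < w \<Longrightarrow> 0 < 1 - q * G 0 w - q * (w * G 1 w)"
proof -
  assume w: "0 < w"
  have "G 1 w \<le> 0" using lam J_nonneg[of 1 "lam * w"] by (simp add: G_def)
  then have "q * (w * G 1 w) \<le> 0" using w q by (simp add: mult_le_0_iff)
  then show ?thesis using q_G_less_1[of w] w by simp
qed

text \<open>\<open>\<theta> = 1 / V'\<close>, so that \<open>d/dv = \<theta> w * d/dw\<close> for \<open>v = V w\<close>.\<close>

definition \<theta> :: "real \<Rightarrow> real" where "\<theta> w = (1 - q) * (1 / (1 - q * G 0 w - q * (w * G 1 w)))"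

lemma \<theta>_pos: "0 < w \<Longrightarrow> 0 < \<theta> w"
  using inverse_\<theta>_pos[of w] q by (simp add: \<theta>_def)

lemma V_deriv:
  assumes "0 < w" shows "(V has_real_derivative 1 / \<theta> w) (at w)"
proof -
  have "((\<lambda>w. w * (1 - q * G 0 w)) has_real_derivative 1 - q * G 0 w - q * (w * G 1 w)) (at w)"
    using G_deriv[OF assms, of 0] by (auto intro!: derivative_eq_intros simp: algebra_simps)
  from DERIV_cdivide[OF this, of "1 - q"]
  have "(V has_real_derivative (1 - q * G 0 w - q * (w * G 1 w)) / (1 - q)) (at w)"
    by (simp add: V_def[abs_def])
  also have "(1 - q * G 0 w - q * (w * G 1 w)) / (1 - q) = 1 / \<theta> w" by (simp add: \<theta>_def)
  finally show ?thesis .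
qed

lemma K_nonneg: "0 \<le> w \<Longrightarrow> 0 \<le> K w"
  using q G_nonneg[of w] G_less_1[of w] by (simp add: K_def)

text \<open>The form \<open>E' = \<phi> * E\<close> is the one that
  \<open>growth_order_linear_ode\<close> expects; \<open>1 / \<theta>\<close> enters as the
  derivative of \<open>V\<close>, the speed at which the range of integration in \<open>R_0\<close>
  grows.\<close>

lemma E_deriv:
  assumes "w \<in> {0<..<w_max}"
  shows "(E has_real_derivative (- (lam / mu) * (K w * (1 / \<theta> w))) * E w) (at w)"
proof -
  have w: "0 < w" "w < w_max" "w \<in> {0..w_max}" using assms by auto
  have z: "1 - V w \<in> {0<..<1}" using V_range[OF w(1,2)] by auto
  have "(F has_real_derivative K (W (1 - (1 - V w)))) (at (1 - V w))"
    using F_deriv[of "1 - V w"] z by (simp add: at_within_Icc_at)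
  then have F: "(F has_real_derivative K w) (at (1 - V w))" using W_V[OF w(3)] by simp
  have "((\<lambda>w. F (1 - V w)) has_real_derivative K w * (0 - 1 / \<theta> w)) (at w)"
    by (rule DERIV_chain2[where f = F and g = "\<lambda>w. 1 - V w"]) (intro F derivative_intros V_deriv w)+
  from DERIV_cmult[OF DERIV_diff[OF DERIV_const this], of "- (lam / mu)" "F 1"]
  have "((\<lambda>w. exp (- (lam / mu) * (F 1 - F (1 - V w)))) has_real_derivative
       exp (- (lam / mu) * (F 1 - F (1 - V w))) * (- (lam / mu) * (0 - K w * (0 - 1 / \<theta> w)))) (at w)"
    by (intro DERIV_chain2[OF DERIV_exp])
  also have "exp (- (lam / mu) * (F 1 - F (1 - V w))) * (- (lam / mu) * (0 - K w * (0 - 1 / \<theta> w))) = (- (lam / mu) * (K w * (1 / \<theta> w))) * E w"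
    using E_eq[OF w(3)] by simp
  finally show ?thesis
    by (rule has_field_derivative_transform_within_open[of _ _ _ "{0<..<w_max}"]) (use assms E_eq in auto)
qed

lemma E_bounds:
  assumes "w \<in> {0..w_max}" shows "0 < E w" "E w \<le> 1"
proof -
  have Vw: "0 \<le> V w" "V w \<le> 1" using V_image assms by auto
  have "F (1 - V w) \<le> F 1"
    unfolding F_def using Vw W_range K_nonneg
    by (intro integral_subset_le integrable_continuous_interval continuous_on_subset[OF KW_continuous]) auto
  then have "- (lam / mu) * (F 1 - F (1 - V w)) \<le> 0" using lam mu by (simp add: mult_nonpos_nonneg)
  then show "0 < E w" "E w \<le> 1" by (simp_all only: E_eq[OF assms] exp_gt_zero exp_le_one_iff)
qed

lemma E_tendsto: "(E \<longlongrightarrow> 1) (at_right 0)"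
proof -
  have F: "continuous_on {0..1} F"
    using F_deriv has_field_derivative_imp_has_derivative has_derivative_continuous_on
    by (metis DERIV_continuous continuous_on_eq_continuous_within)
  have c: "continuous_on {0..w_max} (\<lambda>w. exp (- (lam / mu) * (F 1 - F (1 - V w))))"
    using V_image
    by (intro continuous_intros continuous_on_compose2[OF F] continuous_on_subset[OF V_continuous]) auto
  then have "((\<lambda>w. exp (- (lam / mu) * (F 1 - F (1 - V w)))) \<longlongrightarrow> exp (- (lam / mu) * (F 1 - F (1 - V 0)))) (at 0 within {0..w_max})"
    using w_max by (intro bspec[OF c[unfolded continuous_on_def]]) simp
  then have "((\<lambda>w. exp (- (lam / mu) * (F 1 - F (1 - V w)))) \<longlongrightarrow> 1) (at_right 0)"
    using w_max by (simp add: at_within_Icc_at_right)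
  moreover have "\<forall>\<^sub>F w in at_right 0. exp (- (lam / mu) * (F 1 - F (1 - V w))) = E w"
    using eventually_at_right_real[OF w_max(1)] by eventually_elim (use E_eq in auto)
  ultimately show ?thesis using Lim_transform_eventually by blast
qed

end

section \<open>The generating function of the orbit size at \<open>z1 = 1\<close>\<close>

context stable_retrial_law
begin

lemma lst_isCont: assumes "0 < s" shows "isCont (lst D) s"
proof -
  have ev: "\<forall>\<^sub>F s in nhds s. lst D s = 1 - s * J 0 s"
    by (rule eventually_mono[OF eventually_nhds_in_open[of "{0<..}" s]])
       (use assms lst_eq_J in \<open>auto simp: algebra_simps\<close>)
  have "isCont (\<lambda>s. 1 - s * J 0 s) s"
    by (intro continuous_intros DERIV_isCont[OF J_derivative] assms)
  with isCont_cong[OF ev] show ?thesis by blast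
qed

text \<open>The constants that survive at \<open>z1 = 1\<close>, after
  \<open>1 - lam * q * mean D\<close>, \<open>V w\<close> and the factor one minus the service
  transform have cancelled among \<open>M_a\<close>, \<open>M_b\<close> and
  \<open>M_c\<close>.\<close>

definition c0 :: real where "c0 = (1 - rho) / (rho * (1 - q))"

text \<open>\<open>choi_park\<close> speaks of \<open>z1 < 1\<close>, so 1 is approached from below:
  by dominated convergence on the side of the expectation, and by continuity of \<open>lst D\<close>
  at a positive argument on the side of the formula.\<close>

lemma orbit_pgf:
  assumes cp: "choi_park lam mu q D P" and w: "w \<in> {0<..<w_max}"
  shows "(\<Sum>n. pmf (map_pmf in_orbit (given_busy P)) n * (1 - V w) ^ n) = c0 * (K w * E w)"
proof -
  define z where "z = 1 - V w"
  define \<eta> where "\<eta> = h lam q D z"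
  define s where "s = lam * (1 - q) * V w"
  have w0: "0 < w" "w < w_max" "w \<in> {0..w_max}" "w \<in> {0<..w_max}" "0 \<le> w" using w by auto
  have V: "0 < V w" "V w < 1" using V_range[OF w0(1,2)] by auto
  have z: "z \<in> {0..<1}" using V by (auto simp: z_def)
  have s: "0 < s" using V lam q by (simp add: s_def)
  have eta: "\<eta> = 1 - w * G 0 w" unfolding \<eta>_def z_def by (rule h_eq[OF w0(3)])
  have eta1: "\<eta> < 1" using G_pos[OF w0(5)] w0 by (simp add: eta)
  have "w * G 0 w \<le> 1 * 1" using w0 w_max G_less_1[OF w0(5)] G_nonneg[of w] by (intro mult_mono) auto
  then have eta0: "0 \<le> \<eta>" by (simp add: eta)
  \<comment> \<open>\<open>N + 2\<close> keeps \<open>x N\<close> strictly above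
    \<open>\<eta>\<close>, the removable singularity, and strictly below 1.\<close>
  define x where "x N = 1 - (1 - \<eta>) / real (N + 2)" for N
  have x: "\<eta> < x N" "x N < 1" "x N \<in> {0..<1}" "x N \<noteq> \<eta>" for N
  proof -
    have "(1 - \<eta>) / real (N + 2) < (1 - \<eta>) / 1" using eta1 by (intro divide_strict_left_mono) auto
    moreover have "0 < (1 - \<eta>) / real (N + 2)" using eta1 by simp
    ultimately have *: "\<eta> < x N \<and> x N < 1" unfolding x_def by auto
    then show "\<eta> < x N" "x N < 1" by auto
    from * show "x N \<in> {0..<1}" "x N \<noteq> \<eta>" using eta0 by auto
  qed
  have "x \<longlonglongrightarrow> 1 - 0"
    unfolding x_def
    by (intro tendsto_intros tendsto_divide_0[OF tendsto_const] filterlim_at_top_imp_at_infinity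
        filterlim_compose[OF filterlim_real_sequentially] filterlim_add_const_nat_at_top)
  then have xlim: "x \<longlonglongrightarrow> 1" by simp
  let ?E = "\<lambda>N. measure_pmf.expectation (given_busy P) (\<lambda>y. x N ^ in_queue y * z ^ in_orbit y)"
  have lhs: "?E \<longlonglongrightarrow> measure_pmf.expectation (given_busy P) (\<lambda>y. z ^ in_orbit y)"
  proof (rule integral_dominated_convergence[where w = "\<lambda>_. 1"])
    show "AE y in measure_pmf (given_busy P). (\<lambda>N. x N ^ in_queue y * z ^ in_orbit y) \<longlonglongrightarrow> z ^ in_orbit y"
    proof (rule AE_I2)
      fix y
      have "(\<lambda>N. x N ^ in_queue y * z ^ in_orbit y) \<longlonglongrightarrow> 1 ^ in_queue y * z ^ in_orbit y"
        by (intro tendsto_intros xlim)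
      then show "(\<lambda>N. x N ^ in_queue y * z ^ in_orbit y) \<longlonglongrightarrow> z ^ in_orbit y" by simp
    qed
    show "AE y in measure_pmf (given_busy P). norm (x N ^ in_queue y * z ^ in_orbit y) \<le> 1" for N
    proof (rule AE_I2)
      fix y
      have "\<bar>x N\<bar> ^ in_queue y * \<bar>z\<bar> ^ in_orbit y \<le> 1 * 1"
        using x(3)[of N] z by (intro mult_mono power_le_one) auto
      then show "norm (x N ^ in_queue y * z ^ in_orbit y) \<le> 1" by (simp add: abs_mult power_abs)
    qed
  qed auto
  let ?l = "\<lambda>N. lst D (lam - lam * q * x N - lam * (1 - q) * z)"
  have "(\<lambda>N. lam - lam * q * x N - lam * (1 - q) * z) \<longlonglongrightarrow> lam - lam * q * 1 - lam * (1 - q) * z"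
    by (intro tendsto_intros xlim)
  moreover have "lam - lam * q * 1 - lam * (1 - q) * z = s" by (simp add: s_def z_def algebra_simps)
  ultimately have l: "?l \<longlonglongrightarrow> lst D s"
    using isCont_tendsto_compose[OF lst_isCont[OF s]] by simp
  have l1: "lst D s < 1" by (rule lst_less_1[OF s])
  have d: "1 - (1 - q) * z - q * 1 = (1 - q) * V w" by (simp add: z_def algebra_simps)
  have d0: "1 - (1 - q) * z - q * 1 \<noteq> 0" unfolding d using V q by simp
  have Mc: "(1 - z) / (\<eta> - z) = V w / (\<eta> - z)" by (simp add: z_def)
  have "(\<lambda>N. M_a lam q D (x N) z * M_b lam q D (x N) z * M_c lam q D z * R_0 lam mu q D z) \<longlonglongrightarrow>
     (1 / rho * ((1 - lst D s) / (1 - (1 - q) * z - q * 1))) * ((1 - lam * q * mean D) * ((\<eta> - 1) / (lst D s - 1)))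
      * M_c lam q D z * R_0 lam mu q D z"
    unfolding M_a_def M_b_def \<eta>_def[symmetric] using V q l1
    by (intro tendsto_intros xlim l d0) simp
  moreover have "?E N = M_a lam q D (x N) z * M_b lam q D (x N) z * M_c lam q D z * R_0 lam mu q D z" for N
    using cp x[of N] z unfolding choi_park_def \<eta>_def by blast
  ultimately have "measure_pmf.expectation (given_busy P) (\<lambda>y. z ^ in_orbit y) =
     (1 / rho * ((1 - lst D s) / (1 - (1 - q) * z - q * 1))) * ((1 - lam * q * mean D) * ((\<eta> - 1) / (lst D s - 1)))
      * M_c lam q D z * R_0 lam mu q D z"
    using LIMSEQ_unique[OF lhs] by simp
  also have "\<dots> = c0 * (((1 - \<eta>) / (\<eta> - z)) * R_0 lam mu q D z)"
  proof -
    have "rho * q \<le> rho * 1" using lam mean_pos q by (intro mult_left_mono) auto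
    then have r1: "1 - lam * q * mean D \<noteq> 0" using stable by (simp add: mult_ac)
    have "(\<eta> - 1) / (lst D s - 1) = (1 - \<eta>) / (1 - lst D s)"
      using minus_divide_divide[of "1 - \<eta>" "1 - lst D s"] by simp
    then show ?thesis unfolding d M_c_def \<eta>_def[symmetric] Mc c0_def
      using r1 l1 V by simp (simp add: mult_ac)
  qed
  also have "(1 - \<eta>) / (\<eta> - z) = K w" unfolding \<eta>_def z_def by (rule K_eq[OF w0(4)])
  also have "R_0 lam mu q D z = E w" by (simp add: E_def z_def)
  finally have "measure_pmf.expectation (given_busy P) (\<lambda>y. z ^ in_orbit y) = c0 * (K w * E w)" .
  moreover have "(\<Sum>n. pmf (map_pmf in_orbit (given_busy P)) n * z ^ n) =
     measure_pmf.expectation (map_pmf in_orbit (given_busy P)) (\<lambda>n. z ^ n)"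
    by (rule measure_pmf_nat_expectation(1)[symmetric, of _ 1]) (use z in \<open>auto simp: power_abs power_le_one\<close>)
  ultimately show ?thesis by (simp add: z_def)
qed

definition u :: "real \<Rightarrow> real" where "u w = 1 / (1 - G 0 w)"

text \<open>The coefficient of \<open>G 1\<close> in the first derivative of the generating function
  with respect to \<open>v = V w\<close>; the derivative of \<open>K\<close> is
  \<open>(1 - q) * (G 1 w * (u w * u w))\<close>.\<close>

definition A :: "real \<Rightarrow> real" where "A w = c0 * (1 - q) * (\<theta> w * (u w * (u w * E w)))"

definition \<theta>0 :: real where "\<theta>0 = (1 - q) / (1 - q * rho)"

lemma \<theta>0_pos: "0 < \<theta>0"
  using q_G_less_1[of 0] q by (simp add: \<theta>0_def G_0)

lemma G_tendsto: "(G 0 \<longlongrightarrow> rho) (at_right 0)"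
proof -
  have "(G 0 \<longlongrightarrow> G 0 0) (at 0 within {0..})"
    using G_continuous by (simp add: continuous_on_def)
  then show ?thesis by (simp add: G_0 at_within_Ici_at_right)
qed

section \<open>Orders at \<open>w = 0\<close> of the factors of the generating function\<close>

context
  fixes \<kappa> :: real
  assumes \<kappa>: "0 < \<kappa>" "\<kappa> < a - 1"
begin

text \<open>\<open>J_bound\<close> bounds each \<open>G k\<close>, and differentiation merely raises
  \<open>k\<close>. The loss from \<open>\<kappa> < a - 1\<close> is made good in
  \<open>remainder_negligible\<close>.\<close>

lemma G_order: "smooth_order w_max (real k - \<kappa>) (G k)"
proof -
  have le: "growth_le w_max (real k - \<kappa>) (G k)" for k
  proof -
    obtain C where C: "\<And>s. 0 < s \<Longrightarrow> J k s \<le> C * s powr (- max (real k - \<kappa>) 0)"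
      using J_bound[OF \<kappa>] by blast
    have "\<bar>G k w\<bar> \<le> (lam ^ Suc k * C * lam powr (- max (real k - \<kappa>) 0)) * w powr (- max (real k - \<kappa>) 0)"
      if w: "w \<in> {0<..<w_max}" for w
    proof -
      have "\<bar>G k w\<bar> = lam ^ Suc k * J k (lam * w)"
        using lam J_nonneg by (simp add: G_def abs_mult power_abs)
      also have "\<dots> \<le> lam ^ Suc k * (C * (lam * w) powr (- max (real k - \<kappa>) 0))"
        using w lam by (intro mult_left_mono C) auto
      also have "(lam * w) powr (- max (real k - \<kappa>) 0) = lam powr (- max (real k - \<kappa>) 0) * w powr (- max (real k - \<kappa>) 0)"
        by (rule powr_mult)
      finally show ?thesis by (simp only: mult.assoc)
    qed
    then show ?thesis unfolding growth_le_def by blast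
  qed
  have "growth_order w_max n (real k - \<kappa>) (G k)" for n
  proof (induction n arbitrary: k)
    case (Suc n)
    have "real k - \<kappa> + 1 = real (Suc k) - \<kappa>" by simp
    then have "growth_order w_max n (real k - \<kappa> + 1) (G (Suc k))" using Suc by (simp only:)
    show ?case
    proof (rule growth_order_SucI[OF le])
      show "(G k has_real_derivative G (Suc k) w) (at w)" if "w \<in> {0<..<w_max}" for w
        using that by (intro G_deriv) simp
    qed fact
  qed (simp add: le)
  then show ?thesis by (simp add: smooth_order_def)
qed

lemma wG_order: "smooth_order w_max (- \<kappa>) (\<lambda>w. w * G 1 w)"
  unfolding smooth_order_def
proof (intro allI growth_order_id_mult)
  show "growth_order w_max n (- \<kappa> + 1) (G 1)" for n
    using G_order[of 1] by (simp add: smooth_order_def algebra_simps)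
qed (rule w_max)

lemma G0_order: "smooth_order w_max (- \<kappa>) (G 0)"
  using G_order[of 0] by simp

lemma u_order: "smooth_order w_max (- \<kappa>) u"
proof -
  have "smooth_order w_max (- \<kappa>) (\<lambda>w. 1 + -1 * G 0 w)"
    using w_max by (intro smooth_order_add smooth_order_const smooth_order_cmult G0_order)
  then have "smooth_order w_max (- \<kappa>) (\<lambda>w. 1 - G 0 w)" by simp
  then have f: "growth_order w_max n (- \<kappa>) (\<lambda>w. 1 - G 0 w)" for n by (simp add: smooth_order_def)
  have "growth_order w_max n (- \<kappa>) (\<lambda>w. 1 / (1 - G 0 w))" for n
  proof (rule growth_order_inverse[OF f])
    show "1 - rho \<le> 1 - G 0 w" if "w \<in> {0<..<w_max}" for w using G_le_rho[of w] that by simp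
  qed (use stable \<kappa> w_max in auto)
  then show ?thesis by (simp add: smooth_order_def u_def[abs_def])
qed

lemma inverse_\<theta>_order: "smooth_order w_max (- \<kappa>) (\<lambda>w. 1 - q * G 0 w - q * (w * G 1 w))"
proof -
  have "smooth_order w_max (- \<kappa>) (\<lambda>w. (1 + (- q) * G 0 w) + (- q) * (w * G 1 w))"
    using w_max by (intro smooth_order_add smooth_order_const smooth_order_cmult G0_order wG_order)
  then show ?thesis by simp
qed

lemma \<theta>_order: "smooth_order w_max (- \<kappa>) \<theta>"
proof -
  have "1 - q * rho \<le> 1 - q * G 0 w - q * (w * G 1 w)" if "w \<in> {0<..<w_max}" for w
  proof -
    have "G 1 w \<le> 0" using lam J_nonneg[of 1 "lam * w"] by (simp add: G_def)
    then have "q * (w * G 1 w) \<le> 0" using that q by (simp add: mult_le_0_iff)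
    moreover have "q * G 0 w \<le> q * rho" using G_le_rho[of w] that q by (intro mult_left_mono) auto
    ultimately show ?thesis by linarith
  qed
  moreover have "0 < 1 - q * rho" using q_G_less_1[of 0] by (simp add: G_0)
  ultimately have "growth_order w_max n (- \<kappa>) (\<lambda>w. 1 / (1 - q * G 0 w - q * (w * G 1 w)))" for n
    by (intro growth_order_inverse[where c = "1 - q * rho"])
       (use inverse_\<theta>_order \<kappa> w_max in \<open>auto simp: smooth_order_def\<close>)
  then have "smooth_order w_max (- \<kappa>) (\<lambda>w. 1 / (1 - q * G 0 w - q * (w * G 1 w)))" by (simp add: smooth_order_def)
  then show ?thesis unfolding \<theta>_def[abs_def] using w_max by (intro smooth_order_cmult)
qed

lemma K_order: "smooth_order w_max (- \<kappa>) K"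
proof -
  have "smooth_order w_max (- \<kappa>) (\<lambda>w. (1 - q) * (G 0 w * u w))"
    using w_max \<kappa> by (intro smooth_order_cmult smooth_order_mult[OF G0_order u_order]) auto
  then show ?thesis by (simp add: K_def[abs_def] u_def)
qed

lemma E_order: "smooth_order w_max (- \<kappa>) E"
proof -
  have "smooth_order w_max (- \<kappa>) (\<lambda>w. 1 / (1 - q) * (1 - q * G 0 w - q * (w * G 1 w)))"
    using w_max by (intro smooth_order_cmult inverse_\<theta>_order)
  then have "smooth_order w_max (- \<kappa>) (\<lambda>w. 1 / \<theta> w)" by (simp add: \<theta>_def)
  then have "smooth_order w_max (- \<kappa> + 1) (\<lambda>w. K w * (1 / \<theta> w))"
    by (rule smooth_order_mult[OF K_order _ w_max(2)]) (use \<kappa> in auto)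
  then have "smooth_order w_max (- \<kappa> + 1) (\<lambda>w. - (lam / mu) * (K w * (1 / \<theta> w)))"
    by (rule smooth_order_cmult) (rule w_max)
  then have \<phi>: "growth_order w_max n (- \<kappa> + 1) (\<lambda>w. - (lam / mu) * (K w * (1 / \<theta> w)))" for n
    by (simp only: smooth_order_def)
  have bd: "\<bar>E w\<bar> \<le> 1" if "w \<in> {0<..<w_max}" for w using E_bounds[of w] that by simp
  have "growth_order w_max n (- \<kappa>) E" for n
    by (rule growth_order_linear_ode[OF \<phi> bd _ w_max(2) E_deriv]) (use \<kappa> in auto)
  then show ?thesis by (simp add: smooth_order_def)
qed

lemma A_order: "smooth_order w_max (- \<kappa>) A"
proof -
  have 1: "smooth_order w_max (- \<kappa>) (\<lambda>w. u w * E w)"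
    using w_max \<kappa> by (intro smooth_order_mult[OF u_order E_order]) auto
  have 2: "smooth_order w_max (- \<kappa>) (\<lambda>w. u w * (u w * E w))"
    using w_max \<kappa> by (intro smooth_order_mult[OF u_order 1]) auto
  have "smooth_order w_max (- \<kappa>) (\<lambda>w. \<theta> w * (u w * (u w * E w)))"
    using w_max \<kappa> by (intro smooth_order_mult[OF \<theta>_order 2]) auto
  then show ?thesis unfolding A_def[abs_def] using w_max by (intro smooth_order_cmult)
qed

text \<open>
  Only the term in which all derivatives fall on \<open>G 0\<close> matters: any other term is a product of at least
  two differentiated factors and gains \<open>min \<kappa> 1\<close> powers of \<open>w\<close>.
\<close>

lemma pgf_derivative_expansion:
  fixes p :: "nat pmf"
  assumes pgf: "\<And>w. w \<in> {0<..<w_max} \<Longrightarrow> (\<Sum>n. pmf p n * (1 - V w) ^ n) = c0 * (K w * E w)"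
  shows "\<exists>r. smooth_order w_max (real (Suc k) - \<kappa> - min \<kappa> 1) r \<and> (\<forall>w\<in>{0<..<w_max}.
           (- 1) ^ Suc k * (\<Sum>n. (diffs ^^ Suc k) (pmf p) n * (1 - V w) ^ n) = A w * \<theta> w ^ k * G (Suc k) w + r w)"
proof -
  \<comment> \<open>The sign makes \<open>f (Suc k)\<close> the derivative of \<open>f k\<close>
    with respect to \<open>v = V w = 1 - z\<close>, that is, \<open>\<theta>\<close> times the
    derivative in \<open>w\<close>.\<close>
  define f where "f k w = (- 1) ^ k * (\<Sum>n. (diffs ^^ k) (pmf p) n * (1 - V w) ^ n)" for k w
  have f_deriv: "(f k has_real_derivative f (Suc k) w / \<theta> w) (at w)" if w: "w \<in> {0<..<w_max}" for k w
  proof -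
    have V: "\<bar>1 - V w\<bar> < 1" using V_range[of w] w by auto
    have F: "((\<lambda>z. \<Sum>n. (diffs ^^ k) (pmf p) n * z ^ n) has_real_derivative
        (\<Sum>n. diffs ((diffs ^^ k) (pmf p)) n * (1 - V w) ^ n)) (at (1 - V w))"
    proof (rule termdiffs_strong'[where K = 1])
      show "summable (\<lambda>n. (diffs ^^ k) (pmf p) n * z ^ n)" if "norm z < 1" for z :: real
        using that by (intro summable_diffs_funpow_pmf) simp
    qed (use V in simp)
    have "((\<lambda>w. \<Sum>n. (diffs ^^ k) (pmf p) n * (1 - V w) ^ n) has_real_derivative
        (\<Sum>n. diffs ((diffs ^^ k) (pmf p)) n * (1 - V w) ^ n) * (0 - 1 / \<theta> w)) (at w)"
      by (rule DERIV_chain2[where f = "\<lambda>z. \<Sum>n. (diffs ^^ k) (pmf p) n * z ^ n" and g = "\<lambda>w. 1 - V w"])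
         (use w in \<open>intro F derivative_intros V_deriv; simp\<close>)+
    from DERIV_cmult[OF this, of "(- 1) ^ k"] show ?thesis by (simp add: f_def[abs_def])
  qed
  have f_Suc: "f (Suc k) w = \<theta> w * d" if "w \<in> {0<..<w_max}" "\<And>w. w \<in> {0<..<w_max} \<Longrightarrow> f k w = g w"
    "(g has_real_derivative d) (at w)" for k w g d
  proof -
    have "(f k has_real_derivative d) (at w)"
      by (rule has_field_derivative_transform_within_open[OF that(3), of "{0<..<w_max}"]) (use that in auto)
    then have "f (Suc k) w / \<theta> w = d" using f_deriv[OF that(1)] DERIV_unique by blast
    then show ?thesis using \<theta>_pos[of w] that(1) by (auto simp: field_simps)
  qed
  \<comment> \<open>The order of the remainder, \<open>min \<kappa> 1\<close> below that of
    \<open>G (Suc k)\<close>. The critical term is \<open>B' * G (Suc k)\<close> in the induction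
    step: it has order \<open>max (k + 1 - \<kappa>) (k + 2 - 2 * \<kappa>)\<close>, against
    \<open>k + 2 - \<kappa>\<close> for the main term.\<close>
  define t where "t k = real (Suc k) - \<kappa> - min \<kappa> 1" for k
  have t: "0 \<le> t k + \<kappa>" "- \<kappa> \<le> t k" "1 - \<kappa> \<le> t (Suc k)" "real (Suc k) - \<kappa> \<le> t (Suc k)"
     "real (Suc k) - \<kappa> + (1 - \<kappa>) \<le> t (Suc k)" "t k + 1 = t (Suc k)" for k
    unfolding t_def by auto
  have "\<exists>r. smooth_order w_max (t k) r \<and> (\<forall>w\<in>{0<..<w_max}. f (Suc k) w = A w * \<theta> w ^ k * G (Suc k) w + r w)"
  proof (induction k)
    case 0
    \<comment> \<open>At first order the remainder comes from differentiating \<open>E\<close>; it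
      contains no derivative of \<open>G 0\<close>.\<close>
    have r: "smooth_order w_max (t 0) (\<lambda>w. - (c0 * (lam / mu)) * (K w * (K w * E w)))"
    proof -
      have KE: "smooth_order w_max (- \<kappa>) (\<lambda>w. K w * E w)"
        using w_max \<kappa> by (intro smooth_order_mult[OF K_order E_order]) auto
      have "smooth_order w_max (- \<kappa>) (\<lambda>w. K w * (K w * E w))"
        using w_max \<kappa> by (intro smooth_order_mult[OF K_order KE]) auto
      from smooth_order_mono[OF this t(2)] show ?thesis using w_max by (intro smooth_order_cmult) auto
    qed
    have eq: "f (Suc 0) w = A w * \<theta> w ^ 0 * G (Suc 0) w + - (c0 * (lam / mu)) * (K w * (K w * E w))"
      if w: "w \<in> {0<..<w_max}" for w
    proof -
      have w0: "0 < w" using w by simp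
      have K': "(K has_real_derivative (1 - q) * (G 1 w * (u w * u w))) (at w)"
      proof -
        have "(K has_real_derivative ((1 - q) * G 1 w * (1 - G 0 w) - (1 - q) * G 0 w * (0 - G 1 w)) / ((1 - G 0 w) * (1 - G 0 w))) (at w)"
          unfolding K_def[abs_def] using G_less_1[of w] w0 G_deriv[OF w0, of 0]
          by (auto intro!: derivative_eq_intros)
        also have "(1 - q) * G 1 w * (1 - G 0 w) - (1 - q) * G 0 w * (0 - G 1 w) = (1 - q) * G 1 w" by (simp add: algebra_simps)
        finally show ?thesis by (simp add: u_def)
      qed
      have "((\<lambda>w. c0 * (K w * E w)) has_real_derivative
         c0 * ((1 - q) * (G 1 w * (u w * u w)) * E w + (- (lam / mu) * (K w * (1 / \<theta> w))) * E w * K w)) (at w)"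
        by (intro DERIV_cmult DERIV_mult K' E_deriv[OF w])
      from f_Suc[OF w _ this, of 0] pgf
      have "f (Suc 0) w = \<theta> w * (c0 * ((1 - q) * (G 1 w * (u w * u w)) * E w + (- (lam / mu) * (K w * (1 / \<theta> w))) * E w * K w))"
        by (simp add: f_def)
      then show ?thesis using \<theta>_pos[OF w0] by (simp add: A_def algebra_simps)
    qed
    show ?case by (intro exI[of _ "\<lambda>w. - (c0 * (lam / mu)) * (K w * (K w * E w))"] conjI r ballI eq)
  next
    case (Suc k)
    then obtain r where r: "smooth_order w_max (t k) r" "\<And>w. w \<in> {0<..<w_max} \<Longrightarrow> f (Suc k) w = A w * \<theta> w ^ k * G (Suc k) w + r w"
      by blast
    obtain r' where r': "\<And>w. w \<in> {0<..<w_max} \<Longrightarrow> (r has_real_derivative r' w) (at w)" "smooth_order w_max (t k + 1) r'"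
      using smooth_order_derivative[OF r(1)] by blast
    have "smooth_order w_max (- \<kappa>) (\<lambda>w. \<theta> w ^ k)" using w_max \<kappa> by (intro smooth_order_power \<theta>_order) auto
    from smooth_order_mult[OF A_order this, of "- \<kappa>"] have "smooth_order w_max (- \<kappa>) (\<lambda>w. A w * \<theta> w ^ k)" using w_max \<kappa> by auto
    then obtain B' where B': "\<And>w. w \<in> {0<..<w_max} \<Longrightarrow> ((\<lambda>w. A w * \<theta> w ^ k) has_real_derivative B' w) (at w)"
      "smooth_order w_max (- \<kappa> + 1) B'" using smooth_order_derivative by blast
    have "smooth_order w_max (t (Suc k)) (\<lambda>w. B' w * G (Suc k) w)"
      using smooth_order_mult[OF B'(2) G_order[of "Suc k"] w_max(2)] t[of k] by auto
    moreover have "smooth_order w_max (t (Suc k)) r'" using r'(2) t(6) by simp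
    ultimately have "smooth_order w_max (t (Suc k)) (\<lambda>w. B' w * G (Suc k) w + r' w)" by (rule smooth_order_add)
    from smooth_order_mult[OF \<theta>_order this w_max(2), of "t (Suc k)"]
    have o: "smooth_order w_max (t (Suc k)) (\<lambda>w. \<theta> w * (B' w * G (Suc k) w + r' w))"
      using t(2)[of "Suc k"] \<kappa> by auto
    have eq: "f (Suc (Suc k)) w = A w * \<theta> w ^ Suc k * G (Suc (Suc k)) w + \<theta> w * (B' w * G (Suc k) w + r' w)"
      if w: "w \<in> {0<..<w_max}" for w
    proof -
      have "((\<lambda>w. A w * \<theta> w ^ k * G (Suc k) w + r w) has_real_derivative
          B' w * G (Suc k) w + G (Suc (Suc k)) w * (A w * \<theta> w ^ k) + r' w) (at w)"
        using w by (intro DERIV_add DERIV_mult B' r' G_deriv) auto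
      from f_Suc[OF w r(2) this] show ?thesis by (simp add: algebra_simps)
    qed
    show ?case by (intro exI[of _ "\<lambda>w. \<theta> w * (B' w * G (Suc k) w + r' w)"] conjI o ballI eq)
  qed
  then show ?thesis unfolding t_def f_def by blast
qed


section \<open>Limits at \<open>w = 0\<close>\<close>

lemma \<theta>_tendsto: "(\<theta> \<longlongrightarrow> \<theta>0) (at_right 0)"
proof -
  obtain C where C: "\<And>s. 0 < s \<Longrightarrow> J 1 s \<le> C * s powr (- max (real 1 - \<kappa>) 0)"
    using J_bound[OF \<kappa>] by blast
  \<comment> \<open>This is \<open>min \<kappa> 1\<close>: although \<open>G 1\<close> may be
    unbounded at 0, \<open>w * G 1 w\<close> is \<open>O(w powr d)\<close> and vanishes.\<close>
  define d where "d = 1 - max (1 - \<kappa>) 0"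
  have d: "0 < d" using \<kappa> by (simp add: d_def)
  have "((\<lambda>w. lam ^ 2 * C * lam powr (d - 1) * w powr d) \<longlongrightarrow> lam ^ 2 * C * lam powr (d - 1) * 0 powr d) (at_right 0)"
    using d by (intro tendsto_intros tendsto_ident_at) (auto simp: eventually_at_filter)
  then have "((\<lambda>w. lam ^ 2 * C * lam powr (d - 1) * w powr d) \<longlongrightarrow> 0) (at_right 0)" using d by simp
  moreover have "\<forall>\<^sub>F w in at_right 0. norm (w * G 1 w) \<le> lam ^ 2 * C * lam powr (d - 1) * w powr d"
    using eventually_at_right_less[of "0::real"]
  proof eventually_elim
    case (elim w)
    have "norm (w * G 1 w) = w * (lam ^ 2 * J 1 (lam * w))"
      using lam elim J_nonneg[of 1 "lam * w"] by (simp add: G_def abs_mult power2_eq_square)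
    also have "\<dots> \<le> w * (lam ^ 2 * (C * (lam * w) powr (d - 1)))"
      using C[of "lam * w"] elim lam by (intro mult_left_mono) (auto simp: d_def)
    also have "(lam * w) powr (d - 1) = lam powr (d - 1) * w powr (d - 1)" by (rule powr_mult)
    also have "w powr d = w * w powr (d - 1)" using elim by (simp add: powr_diff)
    then have "w * (lam ^ 2 * (C * (lam powr (d - 1) * w powr (d - 1)))) = lam ^ 2 * C * lam powr (d - 1) * w powr d"
      by (simp only: mult_ac)
    finally show ?case .
  qed
  ultimately have wG: "((\<lambda>w. w * G 1 w) \<longlongrightarrow> 0) (at_right 0)"
    by (rule Lim_null_comparison[rotated])
  have "(\<theta> \<longlongrightarrow> (1 - q) * (1 / (1 - q * rho - q * 0))) (at_right 0)"
    unfolding \<theta>_def[abs_def] using q_G_less_1[of 0]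
    by (intro tendsto_intros G_tendsto wG) (simp add: G_0)
  then show ?thesis by (simp add: \<theta>0_def)
qed

lemma A_tendsto: "(A \<longlongrightarrow> \<theta>0 / (rho * (1 - rho))) (at_right 0)"
proof -
  have "(A \<longlongrightarrow> c0 * (1 - q) * (\<theta>0 * (1 / (1 - rho) * (1 / (1 - rho) * 1)))) (at_right 0)"
    unfolding A_def[abs_def] u_def using stable
    by (intro tendsto_intros G_tendsto \<theta>_tendsto E_tendsto) auto
  also have "c0 * (1 - q) * (\<theta>0 * (1 / (1 - rho) * (1 / (1 - rho) * 1))) = \<theta>0 / (rho * (1 - rho))"
    using q stable by (simp add: c0_def)
  finally show ?thesis .
qed

text \<open>The gain \<open>min \<kappa> 1\<close> exceeds the loss \<open>a - 1 - \<kappa>\<close>.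
  This leaves room for a Potter lower bound of \<open>T (1 / (lam * w))\<close> by a multiple of
  \<open>w powr b\<close> with \<open>b > a\<close>.\<close>

lemma remainder_negligible:
  assumes r: "growth_le w_max (real m - \<kappa> - min \<kappa> 1) r" and m: "a - 1 < real m"
    and \<kappa>': "a - 1 < \<kappa> + min \<kappa> 1"
  shows "((\<lambda>w. r w * w ^ (m + 1) / T (1 / (lam * w))) \<longlongrightarrow> 0) (at_right 0)"
proof -
  \<comment> \<open>Halfway between \<open>a\<close> and the largest exponent for which
    \<open>d\<close> stays nonnegative; the two entries of \<open>min\<close> belong to
    \<open>s = 0\<close> and to \<open>s > 0\<close>.\<close>
  define b where "b = (a + min (real m + 1) (\<kappa> + min \<kappa> 1 + 1)) / 2"
  define s where "s = max (real m - \<kappa> - min \<kappa> 1) 0"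
  define d where "d = real m + 1 - b - s"
  have b: "a < b" and d: "0 < d" using m \<kappa>' unfolding b_def d_def s_def by (auto simp: min_def max_def field_simps)
  obtain c t0 where c: "0 < c" "0 < t0" "\<And>t x. t0 \<le> t \<Longrightarrow> 1 \<le> x \<Longrightarrow> c * x powr (- b) * T t \<le> T (x * t)"
    using potter_lower[OF b] by blast
  obtain C where C: "\<forall>w\<in>{0<..<w_max}. \<bar>r w\<bar> \<le> C * w powr (- s)"
    using r unfolding growth_le_def s_def by blast
  define B where "B = c * (t0 * lam) powr b * T t0"
  have B: "0 < B" unfolding B_def using c lam pos by (intro mult_pos_pos) auto
  define e' where "e' = min w_max (1 / (t0 * lam))"
  have e': "0 < e'" using w_max c lam by (simp add: e'_def)
  have "((\<lambda>w. C / B * w powr d) \<longlongrightarrow> C / B * 0 powr d) (at_right 0)"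
    using d by (intro tendsto_intros tendsto_ident_at) (auto simp: eventually_at_filter)
  then have "((\<lambda>w. C / B * w powr d) \<longlongrightarrow> 0) (at_right 0)" using d by simp
  moreover have "\<forall>\<^sub>F w in at_right 0. norm (r w * w ^ (m + 1) / T (1 / (lam * w))) \<le> C / B * w powr d"
    using eventually_at_right_real[OF e']
  proof eventually_elim
    case (elim w)
    then have w: "0 < w" "w < w_max" "w < 1 / (t0 * lam)" by (auto simp: e'_def)
    have x1: "1 \<le> 1 / (t0 * lam * w)" using w c lam by (simp add: field_simps)
    have "c * (1 / (t0 * lam * w)) powr (- b) * T t0 \<le> T (1 / (t0 * lam * w) * t0)"
      using x1 by (intro c(3)) auto
    also have "1 / (t0 * lam * w) * t0 = 1 / (lam * w)" using c by simp
    also have "(1 / (t0 * lam * w)) powr (- b) = (t0 * lam) powr b * w powr b"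
    proof -
      have "(1 / (t0 * lam * w)) powr (- b) = (t0 * lam * w) powr b"
        using w c lam by (simp add: powr_divide powr_minus)
      then show ?thesis by (simp only: powr_mult)
    qed
    finally have T: "B * w powr b \<le> T (1 / (lam * w))" by (simp add: B_def mult_ac)
    have Bw: "0 < B * w powr b" using B w by simp
    have C0: "0 \<le> C * w powr (- s)" using C w by (smt (verit) greaterThanLessThan_iff)
    have "norm (r w * w ^ (m + 1) / T (1 / (lam * w))) = \<bar>r w\<bar> * w ^ (m + 1) / T (1 / (lam * w))"
      using w pos[of "1 / (lam * w)"] by (simp add: abs_mult)
    also have "\<dots> \<le> (C * w powr (- s)) * w ^ (m + 1) / (B * w powr b)"
    proof (rule frac_le)
      show "0 \<le> C * w powr (- s) * w ^ (m + 1)" using w by (intro mult_nonneg_nonneg[OF C0]) simp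
      show "\<bar>r w\<bar> * w ^ (m + 1) \<le> C * w powr (- s) * w ^ (m + 1)" using C w by (intro mult_right_mono) auto
    qed fact+
    also have "(C * w powr (- s)) * w ^ (m + 1) / (B * w powr b) = (C * w powr (- s)) * w powr real (m + 1) / (B * w powr b)"
      using w by (simp only: powr_realpow)
    also have "(C * w powr (- s)) * w powr real (m + 1) / (B * w powr b) = C / B * (w powr (- s) * w powr real (m + 1) / w powr b)"
      by simp
    also have "w powr (- s) * w powr real (m + 1) / w powr b = w powr d"
    proof -
      have "d = - s + real (m + 1) - b" by (simp add: d_def)
      then show ?thesis by (simp only: powr_add powr_diff)
    qed
    finally show ?case .
  qed
  ultimately show ?thesis by (rule Lim_null_comparison[rotated])
qed

text \<open>\<open>J_abelian\<close> at \<open>\<tau> = 1 / (lam * w)\<close>; the powers of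
  \<open>lam\<close> in \<open>G\<close> cancel against those of \<open>\<tau>\<close>.\<close>

lemma G_abelian:
  assumes "a - 1 < real m"
  shows "((\<lambda>w. (- 1) ^ m * G m w * w ^ (m + 1) / T (1 / (lam * w))) \<longlongrightarrow> Gamma (real m + 1 - a)) (at_right 0)"
proof -
  have "filterlim (\<lambda>w. 1 / (lam * w)) at_top (at_right 0)"
  proof -
    have "filterlim (\<lambda>w. inverse lam * inverse w) at_top (at_right 0)"
      using lam by (intro filterlim_tendsto_pos_mult_at_top[OF tendsto_const _ filterlim_inverse_at_top_right]) auto
    then show ?thesis by (simp add: divide_inverse)
  qed
  from filterlim_compose[OF J_abelian[OF assms] this]
  have "((\<lambda>w. J m (1 / (1 / (lam * w))) / ((1 / (lam * w)) ^ (m + 1) * T (1 / (lam * w)))) \<longlongrightarrow> Gamma (real m + 1 - a)) (at_right 0)" .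
  moreover have "\<forall>\<^sub>F w in at_right 0. J m (1 / (1 / (lam * w))) / ((1 / (lam * w)) ^ (m + 1) * T (1 / (lam * w)))
      = (- 1) ^ m * G m w * w ^ (m + 1) / T (1 / (lam * w))"
    using eventually_at_right_less[of "0::real"]
  proof eventually_elim
    case (elim w)
    have "(- 1) ^ m * G m w = lam ^ (m + 1) * J m (lam * w)"
      by (simp add: G_def power_mult_distrib[symmetric] mult.left_commute[of "(- 1) ^ m"] mult.assoc[symmetric])
    then show ?case using elim lam by (simp add: power_divide power_mult_distrib mult_ac)
  qed
  ultimately show ?thesis by (rule Lim_transform_eventually)
qed

text \<open>Each derivative after the first contributes one factor \<open>\<theta>\<close>; that of
  the first is contained in \<open>A\<close>, whence the exponent \<open>m - 1\<close>.\<close>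

lemma pgf_derivative_limit:
  fixes p :: "nat pmf"
  assumes pgf: "\<And>w. w \<in> {0<..<w_max} \<Longrightarrow> (\<Sum>n. pmf p n * (1 - V w) ^ n) = c0 * (K w * E w)"
    and m: "a - 1 < real m" and \<kappa>': "a - 1 < \<kappa> + min \<kappa> 1"
  shows "((\<lambda>w. (\<Sum>n. (diffs ^^ m) (pmf p) n * (1 - V w) ^ n) * w ^ (m + 1) / T (1 / (lam * w)))
     \<longlongrightarrow> \<theta>0 / (rho * (1 - rho)) * \<theta>0 ^ (m - 1) * Gamma (real m + 1 - a)) (at_right 0)"
proof -
  obtain k where k: "m = Suc k" using m a_gt_1 by (cases m) auto
  obtain r where r: "smooth_order w_max (real m - \<kappa> - min \<kappa> 1) r"
    "\<And>w. w \<in> {0<..<w_max} \<Longrightarrow> (- 1) ^ m * (\<Sum>n. (diffs ^^ m) (pmf p) n * (1 - V w) ^ n) = A w * \<theta> w ^ k * G m w + r w"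
    using pgf_derivative_expansion[OF pgf, of k] unfolding k by blast
  have "((\<lambda>w. A w * \<theta> w ^ k * ((- 1) ^ m * G m w * w ^ (m + 1) / T (1 / (lam * w))) + (- 1) ^ m * (r w * w ^ (m + 1) / T (1 / (lam * w))))
     \<longlongrightarrow> \<theta>0 / (rho * (1 - rho)) * \<theta>0 ^ k * Gamma (real m + 1 - a) + (- 1) ^ m * 0) (at_right 0)"
    by (intro tendsto_intros A_tendsto \<theta>_tendsto G_abelian m remainder_negligible[OF smooth_order_imp_le[OF r(1)]] \<kappa>')
  moreover have "\<forall>\<^sub>F w in at_right 0. A w * \<theta> w ^ k * ((- 1) ^ m * G m w * w ^ (m + 1) / T (1 / (lam * w))) + (- 1) ^ m * (r w * w ^ (m + 1) / T (1 / (lam * w)))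
     = (\<Sum>n. (diffs ^^ m) (pmf p) n * (1 - V w) ^ n) * w ^ (m + 1) / T (1 / (lam * w))"
    using eventually_at_right_real[OF w_max(1)]
  proof eventually_elim
    case (elim w)
    let ?S = "\<Sum>n. (diffs ^^ m) (pmf p) n * (1 - V w) ^ n"
    have sq: "(- 1) ^ m * ((- 1) ^ m * x) = x" for x :: real by (simp add: mult.assoc[symmetric] power_mult_distrib[symmetric])
    have "A w * \<theta> w ^ k * ((- 1) ^ m * G m w * w ^ (m + 1) / T (1 / (lam * w))) + (- 1) ^ m * (r w * w ^ (m + 1) / T (1 / (lam * w)))
      = (- 1) ^ m * (A w * \<theta> w ^ k * G m w + r w) * (w ^ (m + 1) / T (1 / (lam * w)))"
      by (simp add: algebra_simps)
    also have "\<dots> = ?S * (w ^ (m + 1) / T (1 / (lam * w)))"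
      unfolding r(2)[OF elim, symmetric] sq ..
    finally show ?case by simp
  qed
  ultimately show ?thesis using Lim_transform_eventually by (fastforce simp: k)
qed

end
end

section \<open>Return to the variable \<open>1 - z\<close> and evaluation of the constant\<close>

context stable_retrial_law
begin

lemma orbit_tail:
  assumes cp: "choi_park lam mu q D P"
  shows "(\<lambda>j. measure_pmf.prob (given_busy P) {x. j < in_orbit x} / (real j * T (real j)))
    \<longlonglongrightarrow> (lam * (1 - q)) powr (a - 1) / (mean D * (1 - rho) * (a - 1) * (1 - lam * q * mean D) powr (a - 1))"
proof -
  \<comment> \<open>Close enough to \<open>a - 1\<close> for the gain \<open>min \<kappa> 1\<close>
    to exceed the missing quarter of \<open>min (a - 1) 1\<close>.\<close>
  define \<kappa> where "\<kappa> = a - 1 - min (a - 1) 1 / 4"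
  have \<kappa>: "0 < \<kappa>" "\<kappa> < a - 1" "a - 1 < \<kappa> + min \<kappa> 1"
    using a_gt_1 unfolding \<kappa>_def by (auto simp: min_def field_simps)
  \<comment> \<open>Any natural number above \<open>a - 1\<close> would do; it cancels from the
    final constant.\<close>
  define m where "m = nat \<lceil>a\<rceil>"
  have m: "a - 1 < real m" "0 < m" using a_gt_1 unfolding m_def by linarith+
  define \<gamma> where "\<gamma> = Gamma (real m + 1 - a)"
  have \<gamma>: "0 < \<gamma>" unfolding \<gamma>_def using m by (intro Gamma_real_pos) simp
  define p where "p = map_pmf in_orbit (given_busy P)"
  define S where "S z = (\<Sum>n. (diffs ^^ m) (pmf p) n * z ^ n)" for z
  have lim_w: "((\<lambda>w. S (1 - V w) * w ^ (m + 1) / T (1 / (lam * w)))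
     \<longlongrightarrow> \<theta>0 / (rho * (1 - rho)) * \<theta>0 ^ (m - 1) * \<gamma>) (at_right 0)"
    unfolding S_def \<gamma>_def p_def
    by (rule pgf_derivative_limit[OF \<kappa>(1,2) orbit_pgf[OF cp] m(1) \<kappa>(3)])
  have W0: "W 0 = 0" using W_V[of 0] w_max by simp
  have Wpos: "0 < W v \<and> V (W v) = v" if "0 < v" "v < 1" for v
    using W_range[of v] V_0 that by (metis atLeastAtMost_iff less_eq_real_def)
  have "(W \<longlongrightarrow> W 0) (at 0 within {0..1})" using W_continuous by (simp add: continuous_on_def)
  then have W_lim: "(W \<longlongrightarrow> 0) (at_right 0)" by (simp add: W0 at_within_Icc_at_right)
  have W: "filterlim W (at_right 0) (at_right 0)"
    unfolding filterlim_at
  proof (rule conjI[OF _ W_lim])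
    show "\<forall>\<^sub>F v in at_right 0. W v \<in> {0<..} \<and> W v \<noteq> 0"
      by (rule eventually_mono[OF eventually_at_right_real[of 0 1]]) (use Wpos in force)+
  qed
  have "((\<lambda>w. (1 - q * G 0 w) / (1 - q)) \<longlongrightarrow> (1 - q * rho) / (1 - q)) (at_right 0)"
    using q by (intro tendsto_intros G_tendsto) auto
  from filterlim_compose[OF this W]
  have "((\<lambda>v. (1 - q * G 0 (W v)) / (1 - q)) \<longlongrightarrow> 1 / \<theta>0) (at_right 0)" by (simp add: \<theta>0_def)
  then have vW: "((\<lambda>v. v / W v) \<longlongrightarrow> 1 / \<theta>0) (at_right 0)"
  proof (rule Lim_transform_eventually)
    show "\<forall>\<^sub>F v in at_right 0. (1 - q * G 0 (W v)) / (1 - q) = v / W v"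
      using eventually_at_right_real[of 0 "1::real"]
    proof (rule eventually_mono)
      fix v :: real assume "v \<in> {0<..<1}"
      then have "0 < W v" "V (W v) = v" using Wpos by auto
      then show "(1 - q * G 0 (W v)) / (1 - q) = v / W v"
        by (metis V_def nonzero_mult_div_cancel_left less_irrefl times_divide_eq_right)
    qed simp
  qed
  have "((\<lambda>v. v / W v * (1 / lam)) \<longlongrightarrow> 1 / \<theta>0 * (1 / lam)) (at_right 0)" by (intro tendsto_intros vW)
  then have fg: "((\<lambda>v. 1 / (lam * W v) / (1 / v)) \<longlongrightarrow> 1 / (lam * \<theta>0)) (at_right 0)"
    by (simp add: mult.commute)
  have inf: "filterlim (\<lambda>v::real. 1 / v) at_top (at_right 0)"
    using filterlim_inverse_at_top_right by (simp add: inverse_eq_divide)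
  have Tr: "((\<lambda>v. T (1 / (lam * W v)) / T (1 / v)) \<longlongrightarrow> (1 / (lam * \<theta>0)) powr (- a)) (at_right 0)"
    by (rule ratio_general[OF inf fg]) (use lam \<theta>0_pos in simp)
  \<comment> \<open>The last two factors convert \<open>w = W v\<close> to \<open>v\<close>:
    \<open>W v\<close> is asymptotic to \<open>\<theta>0 * v\<close>, which affects both the power
    \<open>w ^ (m + 1)\<close> and the argument of \<open>T\<close>.\<close>
  define M where "M = \<theta>0 / (rho * (1 - rho)) * \<theta>0 ^ (m - 1) * \<gamma> * (1 / \<theta>0) ^ (m + 1) * (1 / (lam * \<theta>0)) powr (- a)"
  have "((\<lambda>v. S (1 - V (W v)) * W v ^ (m + 1) / T (1 / (lam * W v)) * (v / W v) ^ (m + 1) * (T (1 / (lam * W v)) / T (1 / v))) \<longlongrightarrow> M) (at_right 0)"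
    unfolding M_def by (intro tendsto_mult tendsto_power vW Tr filterlim_compose[OF lim_w W])
  then have lim_v: "((\<lambda>v. S (1 - v) * v ^ (m + 1) / T (1 / v)) \<longlongrightarrow> M) (at_right 0)"
  proof (rule Lim_transform_eventually)
    show "\<forall>\<^sub>F v in at_right 0. S (1 - V (W v)) * W v ^ (m + 1) / T (1 / (lam * W v)) * (v / W v) ^ (m + 1) * (T (1 / (lam * W v)) / T (1 / v))
       = S (1 - v) * v ^ (m + 1) / T (1 / v)"
      using eventually_at_right_real[of 0 "1::real"]
    proof (rule eventually_mono)
      fix v :: real assume "v \<in> {0<..<1}"
      then have Wv: "0 < W v" "V (W v) = v" using Wpos by auto
      have "T (1 / (lam * W v)) \<noteq> 0" using pos[of "1 / (lam * W v)"] by simp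
      then show "S (1 - V (W v)) * W v ^ (m + 1) / T (1 / (lam * W v)) * (v / W v) ^ (m + 1) * (T (1 / (lam * W v)) / T (1 / v))
       = S (1 - v) * v ^ (m + 1) / T (1 / v)"
        unfolding Wv(2) power_divide using Wv(1) by simp
    qed simp
  qed
  have rho: "0 < rho" "rho < 1" using lam mean_pos stable by auto
  have M: "0 < M"
    unfolding M_def using rho \<theta>0_pos \<gamma> lam mean_pos by (intro mult_pos_pos divide_pos_pos zero_less_power) auto
  have "(\<lambda>j. measure_pmf.prob p {j<..} / (real j * T (real j))) \<longlonglongrightarrow> M / ((a - 1) * \<gamma>)"
    unfolding \<gamma>_def by (rule pmf_tail_tauberian[OF m(1) M]) (use lim_v in \<open>simp only: S_def\<close>)
  moreover have "measure_pmf.prob p {j<..} = measure_pmf.prob (given_busy P) {x. j < in_orbit x}" for j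
    unfolding p_def by (simp add: measure_map_pmf vimage_def)
  \<comment> \<open>The powers of \<open>\<theta>0\<close> reduce to \<open>1 / \<theta>0\<close>,
    and \<open>lam / rho\<close> is \<open>1 / mean D\<close>. In the notation of the theorem
    \<open>lam * \<theta>0\<close> is \<open>lam2 / (1 - rho1)\<close>, the mean number of customers
    sent to the orbit per unit length of a long service: together with the queue that it creates,
    such a service occupies the server for about \<open>1 / (1 - rho1)\<close> times its
    length.\<close>
  moreover have "M / ((a - 1) * \<gamma>) = (lam * (1 - q)) powr (a - 1) / (mean D * (1 - rho) * (a - 1) * (1 - lam * q * mean D) powr (a - 1))"
  proof -
    have r1: "0 < 1 - lam * q * mean D" using q_G_less_1[of 0] by (simp add: G_0 mult_ac)
    have t: "lam * \<theta>0 = lam * (1 - q) / (1 - lam * q * mean D)" by (simp add: \<theta>0_def mult_ac)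
    have lt: "0 < lam * \<theta>0" using lam \<theta>0_pos by simp
    have "(1 / (lam * \<theta>0)) powr (- a) = (lam * \<theta>0) * (lam * \<theta>0) powr (a - 1)"
      using lt by (simp add: powr_divide powr_minus powr_diff)
    moreover have "\<theta>0 * \<theta>0 ^ (m - 1) * (1 / \<theta>0) ^ (m + 1) = 1 / \<theta>0"
    proof -
      obtain k where "m = Suc k" using m(2) gr0_conv_Suc by blast
      then show ?thesis using \<theta>0_pos by (simp add: power_divide)
    qed
    moreover have "M / ((a - 1) * \<gamma>) = (\<theta>0 * \<theta>0 ^ (m - 1) * (1 / \<theta>0) ^ (m + 1)) * (1 / (lam * \<theta>0)) powr (- a) / (rho * (1 - rho) * (a - 1))"
      using \<gamma> unfolding M_def by simp
    ultimately have "M / ((a - 1) * \<gamma>) = 1 / \<theta>0 * ((lam * \<theta>0) * (lam * \<theta>0) powr (a - 1)) / (rho * (1 - rho) * (a - 1))"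
      by (simp only:)
    also have "\<dots> = (lam * \<theta>0) powr (a - 1) / (mean D * (1 - rho) * (a - 1))"
      using \<theta>0_pos lam by simp
    also have "(lam * \<theta>0) powr (a - 1) = (lam * (1 - q)) powr (a - 1) / (1 - lam * q * mean D) powr (a - 1)"
      unfolding t by (rule powr_divide)
    finally show ?thesis by simp
  qed
  ultimately show ?thesis by simp
qed

end

theorem mainTheorem3:
  fixes M :: "'w measure"
    and lam mu q a :: real
    and D :: "real measure"
    and A S B :: "nat \<Rightarrow> 'w \<Rightarrow> real"
    and C :: "nat \<Rightarrow> 'w \<Rightarrow> bool"
    and R :: "nat \<Rightarrow> nat \<Rightarrow> 'w \<Rightarrow> real"
    and P :: "system_state pmf"
    and L :: "real \<Rightarrow> real"
  defines "lam1 \<equiv> lam * q" and "lam2 \<equiv> lam * (1 - q)"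
  defines "rho1 \<equiv> lam1 * mean D" and "rho \<equiv> lam * mean D"
  assumes model: "bernoulli_retrial_queue M lam mu q D A S C R B"
    and stable: "rho < 1"
    and steady: "steady_state_law M A S C B P"
    and known: "choi_park lam mu q D P"
    and "1 < a" and "slowly_varying L"
    and tail: "(\<lambda>t. measure D {t<..}) \<sim>[at_top] (\<lambda>t. t powr (- a) * L t)"
  shows "(\<lambda>j::nat. measure_pmf.prob (given_busy P) {x. j < in_orbit x})
           \<sim>[at_top]
         (\<lambda>j. lam2 powr (a - 1) / (mean D * (1 - rho) * (a - 1) * (1 - rho1) powr (a - 1))
                * real j powr (- a + 1) * L (real j))"
proof -
  interpret model: bernoulli_retrial_queue M lam mu q D A S C R B by fact
  interpret D: real_distribution D by (rule model.service_distribution)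
  interpret law: stable_retrial_law D a L lam mu q
    using model.service_pos model.service_mean_finite model.lam_pos model.mu_pos model.q_pos model.q_less_1
      assms by unfold_locales auto
  define c where "c = lam2 powr (a - 1) / (mean D * (1 - rho) * (a - 1) * (1 - rho1) powr (a - 1))"
  define f where "f j = measure_pmf.prob (given_busy P) {x. j < in_orbit x}" for j :: nat
  have f: "(\<lambda>j. f j / (real j * law.T (real j))) \<longlonglongrightarrow> c"
    using law.orbit_tail[OF known] by (simp add: f_def c_def lam2_def rho_def rho1_def lam1_def)
  have "q * rho < 1" using law.q_G_less_1[of 0] by (simp add: law.G_0 rho_def)
  then have "rho1 < 1" by (simp add: rho1_def rho_def lam1_def mult_ac)
  then have c: "0 < c"
    unfolding c_def using law.mean_pos stable \<open>1 < a\<close> model.lam_pos model.q_less_1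
    by (intro divide_pos_pos mult_pos_pos) (auto simp: lam2_def)
  have L: "0 < L t" if "0 < t" for t using \<open>slowly_varying L\<close> that by (simp add: slowly_varying_def)
  \<comment> \<open>The tail is traded back for \<open>t powr (- a) * L t\<close>; as
    \<open>T\<close> never vanishes, the equivalence is a genuine limit of quotients.\<close>
  have "((\<lambda>t. law.T t / (t powr (- a) * L t)) \<longlongrightarrow> 1) at_top"
  proof (rule asymp_equivD_strong[OF tail])
    show "\<forall>\<^sub>F t in at_top. law.T t \<noteq> 0 \<or> t powr (- a) * L t \<noteq> 0"
      using law.T_pos by (simp add: less_imp_neq[THEN not_sym])
  qed
  from filterlim_compose[OF this filterlim_real_sequentially]
  have T: "(\<lambda>j. law.T (real j) / (real j powr (- a) * L (real j))) \<longlonglongrightarrow> 1" .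
  have "(\<lambda>j. f j / (real j * law.T (real j)) / c * (law.T (real j) / (real j powr (- a) * L (real j)))) \<longlonglongrightarrow> c / c * 1"
    using c by (intro tendsto_intros f T) auto
  then have "(\<lambda>j. f j / (real j * law.T (real j)) / c * (law.T (real j) / (real j powr (- a) * L (real j)))) \<longlonglongrightarrow> 1"
    using c by simp
  then have "(\<lambda>j. f j / (c * real j powr (- a + 1) * L (real j))) \<longlonglongrightarrow> 1"
  proof (rule Lim_transform_eventually)
    show "\<forall>\<^sub>F j in sequentially. f j / (real j * law.T (real j)) / c * (law.T (real j) / (real j powr (- a) * L (real j)))
       = f j / (c * real j powr (- a + 1) * L (real j))"
      using eventually_gt_at_top[of 0]
    proof eventually_elim
      case (elim j)
      have "law.T (real j) \<noteq> 0" using law.T_pos[of "real j"] by simp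
      moreover have "real j powr (- a + 1) = real j powr (- a) * real j" using elim by (simp only: powr_add) simp
      ultimately show ?case using elim by (simp only:) simp
    qed
  qed
  then show ?thesis unfolding f_def c_def by (rule asymp_equivI')
qed

end
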